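(* Let $p$ be a prime, $C_p$ the cyclic group of order $p$ with generator $\alpha$, $R=\mathbb{Z}C_p$, and $t=\alpha-1\in R$. Let $M_0\subseteq M$ be an inclusion of $R$-modules with $M$ countable. The following are equivalent: (1) There exists a commutative diagram of $R$-modules with exact rows and injective columns $$\begin{matrix} 0&\to&N&\to&P&\to&M&\to&0\\ &&\uparrow&&\uparrow&&\uparrow&&\\ 0&\to&N_0&\to&P_0&\to&M_0&\to&0 \end{matrix}$$ (the right-hand column being the inclusion $M_0\subseteq M$) such that $N$, $N_0$, $P$ and $P_0$ are direct sums of free and trivial $R$-modules, and such that $N_0$, respectively $P_0$, is a direct summand (via the column maps) of $N$, respectively $P$. (2) $(tM)\cap M_0=tM_0$.
   Context: A module over $R$ is trivial if $\alpha$ acts on it as the identity. In this setting, the trivial summands of $N,N_0,P,P_0$ are understood to be free as abelian groups (the modules are generalized lattices, i.e. $R$-modules whose underlying abelian group is free). *)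

theory Defs
  imports "HOL-Algebra.Algebra" "HOL-Library.Countable_Set"
begin

text \<open>
  The integral group ring of a finite group: functions from the group to the integers
  (set to 0 outside the carrier) with pointwise addition and convolution. For an infinite group
  one would have to require finite support.
\<close>

definition int_group_ring :: "('g, 'm) monoid_scheme \<Rightarrow> ('g \<Rightarrow> int) ring" where
  "int_group_ring G =
    \<lparr>carrier = {a. \<forall>g. g \<notin> carrier G \<longrightarrow> a g = 0},
     monoid.mult = (\<lambda>a b g. if g \<in> carrier G
                     then \<Sum>h\<in>carrier G. a h * b (inv\<^bsub>G\<^esub> h \<otimes>\<^bsub>G\<^esub> g) else 0),
     one = (\<lambda>g. if g = \<one>\<^bsub>G\<^esub> then 1 else 0),
     ring.zero = (\<lambda>g. 0),
     ring.add = (\<lambda>a b g. a g + b g)\<rparr>"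

definition group_ring_of :: "'g \<Rightarrow> 'g \<Rightarrow> int" where
  "group_ring_of x = (\<lambda>g. if g = x then 1 else 0)"

lemma cring_int_group_ring:
  fixes G (structure)
  assumes "comm_group G" and fin: "finite (carrier G)"
  shows "cring (int_group_ring G)"
proof -
  interpret comm_group G by fact
  let ?R = "int_group_ring G"
  have tr: "(\<Sum>h\<in>carrier G. f h) = (\<Sum>h\<in>carrier G. f (x \<otimes> h))"
    if "x \<in> carrier G" for f :: "'a \<Rightarrow> int" and x
    by (rule sum.reindex_bij_witness[where i="\<lambda>h. x \<otimes> h" and j="\<lambda>h. inv x \<otimes> h"])
       (use that in \<open>auto simp: m_assoc[symmetric]\<close>)
  have ii: "inv (inv h \<otimes> x) \<otimes> x = h" if "h \<in> carrier G" "x \<in> carrier G" for h x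
    using that by (metis inv_closed inv_inv inv_mult_group inv_solve_left m_closed m_comm)
  have iv: "(\<Sum>h\<in>carrier G. f h) = (\<Sum>h\<in>carrier G. f (inv h \<otimes> x))"
    if "x \<in> carrier G" for f :: "'a \<Rightarrow> int" and x
    by (rule sum.reindex_bij_witness[where i="\<lambda>h. inv h \<otimes> x" and j="\<lambda>h. inv h \<otimes> x"])
       (use that in \<open>simp_all add: ii\<close>)
  have comm: "a \<otimes>\<^bsub>?R\<^esub> b = b \<otimes>\<^bsub>?R\<^esub> a" for a b
  proof
    fix g
    show "(a \<otimes>\<^bsub>?R\<^esub> b) g = (b \<otimes>\<^bsub>?R\<^esub> a) g"
    proof (cases "g \<in> carrier G")
      case True
      have "(\<Sum>h\<in>carrier G. a h * b (inv h \<otimes> g))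
          = (\<Sum>h\<in>carrier G. a (inv h \<otimes> g) * b (inv (inv h \<otimes> g) \<otimes> g))"
        by (rule iv[OF True])
      also have "\<dots> = (\<Sum>h\<in>carrier G. b h * a (inv h \<otimes> g))"
        by (rule sum.cong) (simp_all add: ii True)
      finally show ?thesis using True by (simp add: int_group_ring_def)
    qed (simp add: int_group_ring_def)
  qed
  have assoc: "(a \<otimes>\<^bsub>?R\<^esub> b) \<otimes>\<^bsub>?R\<^esub> c = a \<otimes>\<^bsub>?R\<^esub> (b \<otimes>\<^bsub>?R\<^esub> c)" for a b c
  proof
    fix g
    show "((a \<otimes>\<^bsub>?R\<^esub> b) \<otimes>\<^bsub>?R\<^esub> c) g = (a \<otimes>\<^bsub>?R\<^esub> (b \<otimes>\<^bsub>?R\<^esub> c)) g"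
    proof (cases "g \<in> carrier G")
      case True
      have "(\<Sum>k\<in>carrier G. (\<Sum>h\<in>carrier G. a h * b (inv h \<otimes> k)) * c (inv k \<otimes> g))
          = (\<Sum>h\<in>carrier G. a h * (\<Sum>k\<in>carrier G. b (inv h \<otimes> k) * c (inv k \<otimes> g)))"
        unfolding sum_distrib_left sum_distrib_right
        by (subst sum.swap) (simp add: mult.assoc)
      also have "\<dots> = (\<Sum>h\<in>carrier G. a h *
          (\<Sum>k\<in>carrier G. b k * c (inv k \<otimes> (inv h \<otimes> g))))"
      proof (rule sum.cong, simp)
        fix h assume h: "h \<in> carrier G"
        have "(\<Sum>k\<in>carrier G. b (inv h \<otimes> k) * c (inv k \<otimes> g))
            = (\<Sum>k\<in>carrier G. b (inv h \<otimes> (h \<otimes> k)) * c (inv (h \<otimes> k) \<otimes> g))"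
          by (rule tr[OF h])
        also have "\<dots> = (\<Sum>k\<in>carrier G. b k * c (inv k \<otimes> (inv h \<otimes> g)))"
          by (rule sum.cong) (use h True in \<open>simp_all add: m_assoc[symmetric] inv_mult_group\<close>)
        finally show "a h * (\<Sum>k\<in>carrier G. b (inv h \<otimes> k) * c (inv k \<otimes> g))
            = a h * (\<Sum>k\<in>carrier G. b k * c (inv k \<otimes> (inv h \<otimes> g)))" by simp
      qed
      finally show ?thesis using True by (simp add: int_group_ring_def)
    qed (simp add: int_group_ring_def)
  qed
  have one: "\<one>\<^bsub>?R\<^esub> \<otimes>\<^bsub>?R\<^esub> a = a" if "a \<in> carrier ?R" for a
    using that fin by (auto simp: int_group_ring_def if_distrib[of "\<lambda>x. x * _"] cong: if_cong)
  show ?thesis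
  proof (rule cringI)
    show "abelian_group ?R"
    proof (rule abelian_groupI)
      fix a assume "a \<in> carrier ?R"
      then show "\<exists>b\<in>carrier ?R. b \<oplus>\<^bsub>?R\<^esub> a = \<zero>\<^bsub>?R\<^esub>"
        by (intro bexI[of _ "\<lambda>g. - a g"]) (auto simp: int_group_ring_def)
    qed (auto simp: int_group_ring_def)
    show "comm_monoid ?R"
      by (rule comm_monoidI) (use comm assoc one in \<open>auto simp: int_group_ring_def\<close>)
  qed (auto simp: int_group_ring_def fun_eq_iff sum.distrib distrib_right)
qed

definition module_homs ::
  "('r, 'k) ring_scheme \<Rightarrow> ('r, 'a, 'm) module_scheme \<Rightarrow> ('r, 'b, 'n) module_scheme \<Rightarrow> ('a \<Rightarrow> 'b) set"
  where
  "module_homs R M N =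
    {f \<in> hom (add_monoid M) (add_monoid N).
      \<forall>a\<in>carrier R. \<forall>x\<in>carrier M. f (a \<odot>\<^bsub>M\<^esub> x) = a \<odot>\<^bsub>N\<^esub> f x}"

text \<open>Exactness of a row of module homomorphisms from 0 through N, P, M to 0. The library's
  \<open>short_exact_sequence\<close> would force the three modules to share one element type.\<close>

definition short_exact_row ::
  "('r, 'k) ring_scheme \<Rightarrow> ('r, 'a, 'l) module_scheme \<Rightarrow> ('r, 'b, 'm) module_scheme \<Rightarrow>
   ('r, 'c, 'n) module_scheme \<Rightarrow> ('a \<Rightarrow> 'b) \<Rightarrow> ('b \<Rightarrow> 'c) \<Rightarrow> bool"
  where
  "short_exact_row R N P M f g \<longleftrightarrow>
    f \<in> module_homs R N P \<and> g \<in> module_homs R P M \<and>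
    inj_on f (carrier N) \<and> f ` carrier N = a_kernel P M g \<and> g ` carrier P = carrier M"

definition free_module :: "('r, 'k) ring_scheme \<Rightarrow> ('r, 'a, 'm) module_scheme \<Rightarrow> bool" where
  "free_module R M \<longleftrightarrow>
    (\<exists>B \<subseteq> carrier M. \<forall>x\<in>carrier M. \<exists>!c.
      (\<forall>b\<in>B. c b \<in> carrier R) \<and> (\<forall>b. b \<notin> B \<longrightarrow> c b = \<zero>\<^bsub>R\<^esub>) \<and>
      finite {b. c b \<noteq> \<zero>\<^bsub>R\<^esub>} \<and>
      x = (\<Oplus>\<^bsub>M\<^esub>b\<in>{b. c b \<noteq> \<zero>\<^bsub>R\<^esub>}. c b \<odot>\<^bsub>M\<^esub> b))"

definition trivial_module :: "'g \<Rightarrow> ('g \<Rightarrow> int, 'a, 'm) module_scheme \<Rightarrow> bool" where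
  "trivial_module \<alpha> M \<longleftrightarrow> (\<forall>x\<in>carrier M. group_ring_of \<alpha> \<odot>\<^bsub>M\<^esub> x = x)"

text \<open>An index set of the same element type is no restriction, as a basis lies in the carrier.\<close>

definition additively_free :: "('r, 'a, 'm) module_scheme \<Rightarrow> bool" where
  "additively_free M \<longleftrightarrow> (\<exists>S :: 'a set. add_monoid M \<cong> free_Abelian_group S)"

text \<open>Indexing an internal direct sum by the set of its summands loses no generality: in a direct
  sum only the zero submodule can occur more than once.\<close>

definition internal_direct_sum ::
  "('r, 'k) ring_scheme \<Rightarrow> ('r, 'a, 'm) module_scheme \<Rightarrow> 'a set set \<Rightarrow> bool" where
  "internal_direct_sum R M \<S> \<longleftrightarrow>
    (\<forall>S\<in>\<S>. submodule S R M) \<and>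
    (\<forall>x\<in>carrier M. \<exists>!y.
      (\<forall>S\<in>\<S>. y S \<in> S) \<and> (\<forall>S. S \<notin> \<S> \<longrightarrow> y S = \<zero>\<^bsub>M\<^esub>) \<and>
      finite {S. y S \<noteq> \<zero>\<^bsub>M\<^esub>} \<and>
      x = (\<Oplus>\<^bsub>M\<^esub>S\<in>{S. y S \<noteq> \<zero>\<^bsub>M\<^esub>}. y S))"

text \<open>Direct sums of free and trivial modules. As the modules in question are generalized
  lattices, trivial summands are free as abelian groups.\<close>

definition sum_of_free_and_trivial ::
  "('g \<Rightarrow> int, 'k) ring_scheme \<Rightarrow> 'g \<Rightarrow> ('g \<Rightarrow> int, 'a, 'm) module_scheme \<Rightarrow> bool" where
  "sum_of_free_and_trivial R \<alpha> M \<longleftrightarrow>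
    (\<exists>\<S>. internal_direct_sum R M \<S> \<and>
      (\<forall>S\<in>\<S>. free_module R (M\<lparr>carrier := S\<rparr>) \<or>
        (trivial_module \<alpha> (M\<lparr>carrier := S\<rparr>) \<and> additively_free (M\<lparr>carrier := S\<rparr>))))"

definition direct_summand ::
  "('r, 'k) ring_scheme \<Rightarrow> ('r, 'a, 'm) module_scheme \<Rightarrow> 'a set \<Rightarrow> bool" where
  "direct_summand R M S \<longleftrightarrow> submodule S R M \<and>
    (\<exists>K. submodule K R M \<and> S <+>\<^bsub>M\<^esub> K = carrier M \<and> S \<inter> K = {\<zero>\<^bsub>M\<^esub>})"

end

theory Submission
  imports Defs "HOL-Library.Product_Plus"
begin

text \<open>
  Write \<open>\<sigma>\<close> for the sum of the elements of \<open>C\<^sub>p\<close>, so that \<open>t\<sigma> = 0\<close>. Call a module \<open>E\<close> acyclic if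
  every \<open>x \<in> E\<close> with \<open>\<sigma>x = 0\<close> lies in \<open>tE\<close>, that is, if the Tate group \<open>H\<^sup>-\<^sup>1(E)\<close> vanishes. Direct sums
  of free modules and of trivial modules that are free as abelian groups are acyclic, since they
  have acyclic summands (\<open>sum_of_free_and_trivial_acyclic\<close>).

  Given the diagram, let \<open>m \<in> M\<close> with \<open>tm \<in> M\<^sub>0\<close>. Then \<open>tm\<close> defines a class in \<open>H\<^sup>-\<^sup>1(M\<^sub>0)\<close> that
  vanishes in \<open>H\<^sup>-\<^sup>1(M)\<close>. As \<open>H\<^sup>-\<^sup>1(P\<^sub>0) = 0\<close>, the connecting map embeds \<open>H\<^sup>-\<^sup>1(M\<^sub>0)\<close> into the Tate group
  \<open>H\<^sup>0(N\<^sub>0)\<close>, and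
  \<open>H\<^sup>0(N\<^sub>0)\<close> embeds into \<open>H\<^sup>0(N)\<close> because \<open>N\<^sub>0\<close> is a summand of \<open>N\<close>. So the class is zero and
  \<open>tm \<in> tM\<^sub>0\<close>. The lemma \<open>resolution_imp_t_pure\<close> is this argument on elements.

  For the converse, the main fact is \<open>acyclic_decomposition\<close>: a submodule \<open>E\<close> of a countable
  permutation lattice that is acyclic is a direct summand of a permutation lattice. Precisely, there
  are additive maps \<open>\<theta> : E \<rightarrow> E\<close> and \<open>\<kappa> : E \<rightarrow> E\<close>, the latter with invariant values and constant on
  orbits, such that the identity is the trace \<open>\<Sum>\<^sub>k \<alpha>\<^sup>k \<theta> \<alpha>\<^sup>-\<^sup>k\<close> plus \<open>\<kappa>\<close>. It suffices to find such maps
  modulo \<open>p\<close>: if the identity is a trace plus \<open>\<kappa>\<close> minus \<open>p\<psi>\<close>, then \<open>\<psi>\<close> is equivariant, because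
  \<open>E\<close> is torsion-free, so \<open>p\<psi>\<close> is the trace of \<open>\<psi>\<close>. Modulo \<open>p\<close> it suffices to get a map \<open>\<omega>\<close> of
  this form that is the identity on the invariants, for then \<open>1 - \<omega>\<close> is nilpotent because \<open>t\<close> is.
  Finally \<open>\<omega>\<close> is found by linear algebra over the field with \<open>p\<close> elements
  (\<open>elementary_complement\<close>), and all additive choices are possible because subgroups of countable
  free abelian groups are free (\<open>additive_selection\<close>). It follows that an equivariant surjection
  onto \<open>E\<close> splits as soon as it is surjective on invariants (\<open>equivariant_selection\<close>).

  Let \<open>U\<close> be the direct sum of countably many free and countably many trivial modules of rank one.
  Map \<open>U\<close> onto \<open>M\<^sub>0\<close> and onto \<open>M\<close>, in both cases onto the invariants as well (\<open>cyclic_cover\<close>). Then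
  the kernel \<open>K\<close> of \<open>U \<rightarrow> M\<^sub>0\<close> is acyclic, and the condition \<open>tM \<inter> M\<^sub>0 = tM\<^sub>0\<close> is what makes the
  preimage \<open>E\<close> of \<open>M\<^sub>0\<close> under \<open>U \<rightarrow> M\<close> acyclic too (\<open>acyclic_preimage\<close>). The kernel of
  \<open>U \<oplus> U \<rightarrow> M\<close> is an extension of \<open>E\<close> by \<open>K\<close>, and it splits. Both \<open>K\<close> and \<open>E\<close> are isomorphic to direct
  summands of \<open>U\<close>, so by the Eilenberg swindle they become isomorphic to \<open>V\<close>, a countable direct sum
  of copies of \<open>U\<close>, once \<open>V\<close> is added to them (\<open>swindle\<close>). Hence
  \<open>N\<^sub>0 = P\<^sub>0 = V\<close> and \<open>N = P = V \<oplus> V\<close> can be taken, with suitable maps (\<open>relative_resolution\<close>).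
\<close>


section \<open>Subgroups of free abelian groups\<close>

text \<open>
  Subgroups are sets in a type of class \<open>ab_group_add\<close>. Free abelian groups are the types \<open>'i \<Rightarrow>\<^sub>0 int\<close>
  of finitely supported functions, with \<open>frag_cmul\<close> as integer multiplication.
\<close>
definition add_subgroup :: "'a::ab_group_add set \<Rightarrow> bool" where
  "add_subgroup H \<longleftrightarrow> 0 \<in> H \<and> (\<forall>x\<in>H. \<forall>y\<in>H. x - y \<in> H)"

text \<open>
  Additivity of a map on a subgroup; its values elsewhere are irrelevant.
\<close>
definition additive_on :: "'a::ab_group_add set \<Rightarrow> ('a \<Rightarrow> 'b::ab_group_add) \<Rightarrow> bool" where
  "additive_on H f \<longleftrightarrow> (\<forall>x\<in>H. \<forall>y\<in>H. f (x + y) = f x + f y)"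

lemma add_subgroupD:
  assumes "add_subgroup H"
  shows add_subgroup_zero: "0 \<in> H"
    and add_subgroup_diff: "x \<in> H \<Longrightarrow> y \<in> H \<Longrightarrow> x - y \<in> H"
    and add_subgroup_uminus: "x \<in> H \<Longrightarrow> - x \<in> H"
    and add_subgroup_add: "x \<in> H \<Longrightarrow> y \<in> H \<Longrightarrow> x + y \<in> H"
proof -
  show 0: "0 \<in> H" and d: "x \<in> H \<Longrightarrow> y \<in> H \<Longrightarrow> x - y \<in> H" for x y
    using assms by (auto simp: add_subgroup_def)
  show u: "x \<in> H \<Longrightarrow> - x \<in> H" for x using d[OF 0] by simp
  show "x \<in> H \<Longrightarrow> y \<in> H \<Longrightarrow> x + y \<in> H" using d[OF _ u] by force
qed

lemma add_subgroup_sum: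
  assumes "add_subgroup H" "\<And>k. k \<in> A \<Longrightarrow> f k \<in> H"
  shows "sum f A \<in> H"
  using assms(2)
  by (induction A rule: infinite_finite_induct)
     (auto intro: add_subgroup_zero[OF assms(1)] add_subgroup_add[OF assms(1)])

lemma add_subgroup_frag_cmul:
  assumes "add_subgroup H" "x \<in> H"
  shows "frag_cmul n x \<in> H"
  by (rule frag_closure_minus_cmul[of "\<lambda>x. x \<in> H"])
     (use assms add_subgroupD[OF assms(1)] in auto)

lemma frag_cmul_diff_distrib2: "frag_cmul c (a - b) = frag_cmul c a - frag_cmul c b"
  by (metis add_diff_cancel_right' diff_add_cancel frag_cmul_distrib2)

lemma frag_cmul_cancel: "frag_cmul c a = frag_cmul c b \<longleftrightarrow> c = 0 \<or> a = b"
  using frag_cmul_eq_0_iff[of c "a - b"] by (simp add: frag_cmul_diff_distrib2)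

lemma additive_onD:
  assumes "add_subgroup H" "additive_on H f"
  shows additive_on_add: "x \<in> H \<Longrightarrow> y \<in> H \<Longrightarrow> f (x + y) = f x + f y"
    and additive_on_zero: "f 0 = 0"
    and additive_on_uminus: "x \<in> H \<Longrightarrow> f (- x) = - f x"
    and additive_on_diff: "x \<in> H \<Longrightarrow> y \<in> H \<Longrightarrow> f (x - y) = f x - f y"
proof -
  show a: "x \<in> H \<Longrightarrow> y \<in> H \<Longrightarrow> f (x + y) = f x + f y" for x y
    using assms by (auto simp: additive_on_def)
  show z: "f 0 = 0" using a[OF add_subgroup_zero add_subgroup_zero, OF assms(1) assms(1)] by simp
  show u: "x \<in> H \<Longrightarrow> f (- x) = - f x" for x
    using a[of x "- x"] z add_subgroup_uminus[OF assms(1)] by (metis add.right_inverse minus_unique)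
  show "x \<in> H \<Longrightarrow> y \<in> H \<Longrightarrow> f (x - y) = f x - f y"
    using a[of x "- y"] u add_subgroup_uminus[OF assms(1)] by simp
qed

lemma add_subgroup_UNIV: "add_subgroup UNIV"
  by (simp add: add_subgroup_def)

lemma additive_UNIV_D:
  assumes "additive_on UNIV f"
  shows "f (x + y) = f x + f y" "f 0 = 0" "f (- x) = - f x" "f (x - y) = f x - f y"
  using additive_onD[OF _ assms] add_subgroup_UNIV by auto

lemma additive_on_sum:
  assumes "add_subgroup H" "additive_on H f" "\<And>k. k \<in> A \<Longrightarrow> g k \<in> H"
  shows "f (sum g A) = (\<Sum>k\<in>A. f (g k))"
  using assms(3)
  by (induction A rule: infinite_finite_induct)
     (auto simp: additive_on_zero[OF assms(1,2)] additive_on_add[OF assms(1,2)] add_subgroup_sum[OF assms(1)])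

lemma additive_on_frag_cmul:
  fixes f :: "('i \<Rightarrow>\<^sub>0 int) \<Rightarrow> ('j \<Rightarrow>\<^sub>0 int)"
  assumes "add_subgroup H" "additive_on H f" "x \<in> H"
  shows "f (frag_cmul n x) = frag_cmul n (f x)"
proof -
  have "frag_cmul n x \<in> H \<and> f (frag_cmul n x) = frag_cmul n (f x)"
  proof (induction n rule: int_induct[where k = 0])
    case base
    then show ?case using add_subgroup_zero[OF assms(1)] additive_on_zero[OF assms(1,2)] by simp
  next
    case (step1 i)
    then show ?case using assms add_subgroup_add[OF assms(1)] additive_on_add[OF assms(1,2)]
      by (simp add: frag_cmul_distrib)
  next
    case (step2 i)
    then show ?case using assms add_subgroup_diff[OF assms(1)] additive_on_diff[OF assms(1,2)]
      by (simp add: frag_cmul_diff_distrib)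
  qed
  then show ?thesis ..
qed

lemma int_subgroup_principal:
  fixes I :: "int set"
  assumes "add_subgroup I"
  shows "\<exists>d\<in>I. \<forall>x\<in>I. d dvd x"
proof (cases "I = {0}")
  case False
  have mul: "n * x \<in> I" if "x \<in> I" for n x
  proof (induction n rule: int_induct[where k = 0])
    case base
    then show ?case using add_subgroup_zero[OF assms] by simp
  next
    case (step1 i)
    then show ?case using add_subgroup_add[OF assms _ that] by (simp add: distrib_right)
  next
    case (step2 i)
    then show ?case using add_subgroup_diff[OF assms _ that] by (simp add: left_diff_distrib)
  qed
  define P where "P n \<longleftrightarrow> n > 0 \<and> int n \<in> I" for n
  obtain y where y: "y \<in> I" "y \<noteq> 0" using False add_subgroup_zero[OF assms] by blast
  have "P (nat \<bar>y\<bar>)" using y add_subgroup_uminus[OF assms] by (auto simp: P_def abs_if)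
  then have L: "P (Least P)" and min: "\<And>n. P n \<Longrightarrow> Least P \<le> n" by (auto intro: LeastI Least_le)
  let ?d = "int (Least P)"
  have "?d dvd x" if "x \<in> I" for x
  proof -
    have m: "x mod ?d \<in> I"
      using add_subgroup_diff[OF assms that mul[of ?d "x div ?d"]] L
      by (simp add: P_def minus_div_mult_eq_mod)
    have "\<not> P (nat (x mod ?d))"
    proof
      assume P': "P (nat (x mod ?d))"
      have "x mod ?d < ?d" using L by (simp add: P_def)
      moreover have "0 \<le> x mod ?d" using L by (simp add: P_def)
      ultimately show False using min[OF P'] by linarith
    qed
    moreover have "0 \<le> x mod ?d" using L by (simp add: P_def)
    ultimately have "x mod ?d = 0" using m by (auto simp: P_def)
    then show ?thesis by (simp add: dvd_eq_mod_eq_0)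
  qed
  then show ?thesis using L by (auto simp: P_def)
qed (use assms in \<open>auto simp: add_subgroup_def\<close>)

abbreviation coeff_at :: "('i \<Rightarrow>\<^sub>0 int) \<Rightarrow> 'i \<Rightarrow> int" where
  "coeff_at \<equiv> poly_mapping.lookup"

text \<open>
  An additive relation that is total on a subgroup \<open>H\<close> of a countable free abelian group contains an
  additive function on \<open>H\<close>. This is the projectivity of \<open>H\<close>. Stated for relations, it yields sections
  of surjections, lifts of maps, and maps into quotients without any quotient being formed.
\<close>
lemma additive_selection:
  fixes H :: "('i::countable \<Rightarrow>\<^sub>0 int) set" and \<rho> :: "(('i \<Rightarrow>\<^sub>0 int) \<times> ('j \<Rightarrow>\<^sub>0 int)) set"
  assumes H: "add_subgroup H" and \<rho>: "add_subgroup \<rho>"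
    and total: "\<And>x. x \<in> H \<Longrightarrow> \<exists>y. (x, y) \<in> \<rho>"
  obtains s where "additive_on H s" "\<And>x. x \<in> H \<Longrightarrow> (x, s x) \<in> \<rho>"
proof -
  \<comment> \<open>The elements whose support lies among the first \<open>n\<close> indices.\<close>
  define L where "L n = {h \<in> H. \<forall>i\<in>Poly_Mapping.keys h. to_nat i < n}" for n :: nat
  define co :: "nat \<Rightarrow> ('i \<Rightarrow>\<^sub>0 int) \<Rightarrow> int" where
    "co n h = (if n \<in> range (to_nat :: 'i \<Rightarrow> nat) then coeff_at h (from_nat n) else 0)" for n h
  have L: "add_subgroup (L n)" for n
    unfolding add_subgroup_def L_def using add_subgroupD[OF H]
    by (auto dest!: subsetD[OF keys_diff])
  have co_diff: "co n (x - y) = co n x - co n y" and co_add: "co n (x + y) = co n x + co n y"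
    and co_cmul: "co n (frag_cmul c x) = c * co n x" and co0: "co n 0 = 0" for n c x y
    by (auto simp: co_def lookup_minus lookup_add)
  have Lmono: "L m \<subseteq> L n" if "m \<le> n" for m n using that by (fastforce simp: L_def)
  have coL: "co n h = 0" if "h \<in> L n" for n h
    using that by (auto simp: co_def L_def simp flip: not_in_keys_iff_lookup_eq_zero)
  have Lco: "h \<in> L n" if "h \<in> L (Suc n)" "co n h = 0" for n h
    unfolding L_def
  proof (intro CollectI conjI ballI)
    show "h \<in> H" using that by (simp add: L_def)
    fix i assume i: "i \<in> Poly_Mapping.keys h"
    have "to_nat i \<noteq> n" using that(2) i by (auto simp: co_def in_keys_iff)
    then show "to_nat i < n" using that(1) i by (auto simp: L_def less_Suc_eq)
  qed
  \<comment> \<open>The last coordinates of the elements of \<open>L (Suc n)\<close> form a principal ideal; \<open>e n\<close> realizes a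
    generator of it.\<close>
  have "\<exists>e. e \<in> L (Suc n) \<and> (\<forall>h\<in>L (Suc n). co n e dvd co n h)" for n
  proof -
    have "add_subgroup (co n ` L (Suc n))"
      unfolding add_subgroup_def
    proof (intro conjI ballI)
      show "0 \<in> co n ` L (Suc n)"
        using add_subgroup_zero[OF L] co0 by (metis imageI)
      fix a b assume "a \<in> co n ` L (Suc n)" "b \<in> co n ` L (Suc n)"
      then obtain x y where "a = co n x" "b = co n y" "x \<in> L (Suc n)" "y \<in> L (Suc n)" by blast
      then show "a - b \<in> co n ` L (Suc n)"
        using add_subgroup_diff[OF L] by (metis co_diff imageI)
    qed
    from int_subgroup_principal[OF this] show ?thesis by auto
  qed
  then obtain e where e: "\<And>n. e n \<in> L (Suc n)" "\<And>n h. h \<in> L (Suc n) \<Longrightarrow> co n (e n) dvd co n h"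
    by metis
  have "\<exists>u. (e n, u) \<in> \<rho>" for n using e(1)[of n] total by (auto simp: L_def)
  then obtain u where u: "\<And>n. (e n, u n) \<in> \<rho>" by metis
  define q where "q n h = co n h div co n (e n)" for n h
  \<comment> \<open>The top coordinate is cleared by a multiple of \<open>e n\<close>. If \<open>co n (e n) = 0\<close>, then that coordinate
    vanishes on \<open>L (Suc n)\<close> and the quotient is \<open>0 div 0 = 0\<close>.\<close>
  define s where "s = rec_nat (\<lambda>h. 0) (\<lambda>n r h. r (h - frag_cmul (q n h) (e n)) + frag_cmul (q n h) (u n))"
  have s0: "s 0 h = 0"
    and sS: "s (Suc n) h = s n (h - frag_cmul (q n h) (e n)) + frag_cmul (q n h) (u n)" for n h
    by (simp_all add: s_def)
  have step: "h - frag_cmul (q n h) (e n) \<in> L n" if h: "h \<in> L (Suc n)" for n h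
  proof (rule Lco)
    show "h - frag_cmul (q n h) (e n) \<in> L (Suc n)"
      using add_subgroup_diff[OF L h add_subgroup_frag_cmul[OF L e(1)]] .
    show "co n (h - frag_cmul (q n h) (e n)) = 0"
      using e(2)[OF h] by (simp add: co_diff co_cmul q_def)
  qed
  have q_add: "q n (x + y) = q n x + q n y" if "x \<in> L (Suc n)" "y \<in> L (Suc n)" for n x y
    using e(2)[OF that(1)] by (simp add: q_def co_add div_plus_div_distrib_dvd_left)
  have s_stable: "s (Suc n) h = s n h" if "h \<in> L n" for n h
    using coL[OF that] by (simp add: sS q_def)
  have s_stable': "s m h = s n h" if "h \<in> L n" "n \<le> m" for m n h
    using that(2)
  proof (induction m rule: dec_induct)
    case (step k)
    then show ?case using s_stable[of h k] Lmono[of n k] that(1) by auto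
  qed simp
  have cmul_pair: "(frag_cmul c x, frag_cmul c y) \<in> \<rho>" if "(x, y) \<in> \<rho>" for c x y
  proof (induction c rule: int_induct[where k = 0])
    case base
    then show ?case using add_subgroup_zero[OF \<rho>] by (simp add: zero_prod_def)
  next
    case (step1 i)
    then show ?case using add_subgroup_add[OF \<rho> step1(2) that] by (simp add: frag_cmul_distrib)
  next
    case (step2 i)
    then show ?case using add_subgroup_diff[OF \<rho> step2(2) that] by (simp add: frag_cmul_diff_distrib)
  qed
  have main: "(\<forall>x\<in>L n. \<forall>y\<in>L n. s n (x + y) = s n x + s n y) \<and> (\<forall>x\<in>L n. (x, s n x) \<in> \<rho>)" for n
  proof (induction n)
    case 0
    have "x = 0" if "x \<in> L 0" for x using that by (auto simp: L_def)
    then show ?case using add_subgroup_zero[OF \<rho>] by (auto simp: s0 zero_prod_def)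
  next
    case (Suc n)
    have "s (Suc n) (x + y) = s (Suc n) x + s (Suc n) y" if xy: "x \<in> L (Suc n)" "y \<in> L (Suc n)" for x y
    proof -
      have "x + y - frag_cmul (q n (x + y)) (e n) =
          (x - frag_cmul (q n x) (e n)) + (y - frag_cmul (q n y) (e n))"
        by (simp add: q_add[OF xy] frag_cmul_distrib)
      then have "s n (x + y - frag_cmul (q n (x + y)) (e n)) =
          s n (x - frag_cmul (q n x) (e n)) + s n (y - frag_cmul (q n y) (e n))"
        using Suc step[OF xy(1)] step[OF xy(2)] by metis
      then show ?thesis by (simp add: sS q_add[OF xy] frag_cmul_distrib)
    qed
    moreover have "(x, s (Suc n) x) \<in> \<rho>" if x: "x \<in> L (Suc n)" for x
      using add_subgroup_add[OF \<rho> Suc[THEN conjunct2, rule_format, OF step[OF x]]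
          cmul_pair[OF u[of n], of "q n x"]]
      by (simp add: sS)
    ultimately show ?case by blast
  qed
  define b where "b h = Suc (\<Sum>i\<in>Poly_Mapping.keys h. to_nat i)" for h :: "'i \<Rightarrow>\<^sub>0 int"
  have b: "h \<in> L (b h)" if "h \<in> H" for h
    using that by (auto simp: L_def b_def less_Suc_eq_le intro!: member_le_sum)
  define S where "S h = s (b h) h" for h
  have S: "S h = s n h" if "h \<in> L n" for n h
  proof -
    have "h \<in> L (b h)" using b that by (simp add: L_def)
    then show ?thesis unfolding S_def using s_stable' that by (metis nle_le)
  qed
  show thesis
  proof
    show "additive_on H S"
      unfolding additive_on_def
    proof (intro ballI)
      fix x y assume "x \<in> H" "y \<in> H"
      then have "x \<in> L (b x + b y)" "y \<in> L (b x + b y)"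
        using b Lmono by (meson le_add1 le_add2 subsetD)+
      then show "S (x + y) = S x + S y"
        using main[of "b x + b y"] S add_subgroup_add[OF L] by metis
    qed
    show "(x, S x) \<in> \<rho>" if "x \<in> H" for x
      using main[of "b x"] b[OF that] by (auto simp: S_def)
  qed
qed

text \<open>
  In the elementary abelian \<open>p\<close>-group \<open>E/D\<close>, the image of \<open>A\<close> has a complement \<open>W/D\<close>.
\<close>
lemma elementary_complement:
  fixes E :: "('i \<Rightarrow>\<^sub>0 int) set" and p :: int
  assumes p: "Factorial_Ring.prime p"
    and E: "add_subgroup E" and A: "add_subgroup A" "A \<subseteq> E" and D: "add_subgroup D" "D \<subseteq> E"
    and pD: "\<And>x. x \<in> E \<Longrightarrow> frag_cmul p x \<in> D"
  obtains W where "add_subgroup W" "D \<subseteq> W" "W \<subseteq> E" "W \<inter> A \<subseteq> D"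
    "\<And>x. x \<in> E \<Longrightarrow> \<exists>a\<in>A. x - a \<in> W"
proof -
  define \<W> where "\<W> = {W. add_subgroup W \<and> D \<subseteq> W \<and> W \<subseteq> E \<and> W \<inter> A \<subseteq> D}"
  have "\<exists>W\<in>\<W>. \<forall>W'\<in>\<W>. W \<subseteq> W' \<longrightarrow> W' = W"
  proof (rule subset_Zorn_nonempty)
    have "D \<in> \<W>" using D by (simp add: \<W>_def)
    then show "\<W> \<noteq> {}" by blast
    fix \<C> assume ne: "\<C> \<noteq> {}" and ch: "subset.chain \<W> \<C>"
    have "add_subgroup (\<Union>\<C>)"
      unfolding add_subgroup_def
    proof (intro conjI ballI)
      obtain Q where "Q \<in> \<C>" using ne by blast
      moreover from this have "add_subgroup Q" using ch by (auto simp: subset_chain_def \<W>_def)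
      ultimately show "0 \<in> \<Union>\<C>" using add_subgroup_zero by blast
      fix x y assume "x \<in> \<Union>\<C>" "y \<in> \<Union>\<C>"
      then obtain Y Z where YZ: "x \<in> Y" "Y \<in> \<C>" "y \<in> Z" "Z \<in> \<C>" by blast
      then have "Y \<subseteq> Z \<or> Z \<subseteq> Y" using ch by (auto simp: subset_chain_def)
      then obtain Q where "Q \<in> \<C>" "x \<in> Q" "y \<in> Q" using YZ by blast
      moreover from this have "add_subgroup Q" using ch by (auto simp: subset_chain_def \<W>_def)
      ultimately show "x - y \<in> \<Union>\<C>" using add_subgroup_diff by blast
    qed
    moreover have "Q \<in> \<W>" if "Q \<in> \<C>" for Q using ch that by (auto simp: subset_chain_def)
    ultimately show "\<Union>\<C> \<in> \<W>" using ne by (simp add: \<W>_def) blast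
  qed
  then obtain W where W: "add_subgroup W" "D \<subseteq> W" "W \<subseteq> E" "W \<inter> A \<subseteq> D"
    and max: "\<And>W'. add_subgroup W' \<Longrightarrow> W' \<subseteq> E \<Longrightarrow> W' \<inter> A \<subseteq> D \<Longrightarrow> W \<subseteq> W' \<Longrightarrow> W' = W"
    unfolding \<W>_def by (smt (verit) mem_Collect_eq order_trans)
  note W0 = add_subgroupD[OF W(1)] and A0 = add_subgroupD[OF A(1)] and E0 = add_subgroupD[OF E]
  \<comment> \<open>Otherwise adjoining \<open>x\<close> to \<open>W\<close> would contradict maximality.\<close>
  have "\<exists>a\<in>A. x - a \<in> W" if x: "x \<in> E" for x
  proof (rule ccontr)
    assume no: "\<not> (\<exists>a\<in>A. x - a \<in> W)"
    have pW: "frag_cmul (p * c) x \<in> W" for c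
      using add_subgroup_frag_cmul[OF D(1) pD[OF x], of c] W(2) by (auto simp: mult.commute)
    define W' where "W' = {w + frag_cmul n x | w n. w \<in> W}"
    have "W' = W"
    proof (rule max)
      show "add_subgroup W'"
        unfolding add_subgroup_def
      proof (intro conjI ballI)
        have "0 = 0 + frag_cmul 0 x" by simp
        then show "0 \<in> W'" using W0(1) unfolding W'_def by blast
        fix y z assume "y \<in> W'" "z \<in> W'"
        then obtain w n v m where "y = w + frag_cmul n x" "w \<in> W" "z = v + frag_cmul m x" "v \<in> W"
          by (auto simp: W'_def)
        then have "y - z = (w - v) + frag_cmul (n - m) x \<and> w - v \<in> W"
          using W0(2) by (simp add: frag_cmul_diff_distrib)
        then show "y - z \<in> W'" unfolding W'_def by blast
      qed
      show "W' \<subseteq> E"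
        using W(3) E0(4) add_subgroup_frag_cmul[OF E x] by (auto simp: W'_def)
      show "W \<subseteq> W'"
      proof
        fix w assume "w \<in> W"
        moreover have "w = w + frag_cmul 0 x" by simp
        ultimately show "w \<in> W'" unfolding W'_def by blast
      qed
      show "W' \<inter> A \<subseteq> D"
      proof
        fix y assume y: "y \<in> W' \<inter> A"
        then obtain w n where wn: "y = w + frag_cmul n x" "w \<in> W" by (auto simp: W'_def)
        have "p dvd n"
        proof (rule ccontr)
          assume "\<not> p dvd n"
          then have "coprime n p" using p prime_imp_coprime coprime_commute by metis
          then obtain c d where cd: "c * n + d * p = 1" by (metis bezout_int coprime_imp_gcd_eq_1)
          have "x = frag_cmul (c * n + d * p) x" by (simp add: cd)
          also have "\<dots> = frag_cmul c (frag_cmul n x) + frag_cmul (p * d) x"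
            by (simp add: frag_cmul_distrib mult.commute)
          also have "frag_cmul n x = y - w" using wn by simp
          finally have "x - frag_cmul c y = frag_cmul (p * d) x - frag_cmul c w"
            by (simp add: frag_cmul_diff_distrib2 algebra_simps)
          also have "\<dots> \<in> W" using W0(2) pW add_subgroup_frag_cmul[OF W(1) wn(2)] by blast
          finally show False using no add_subgroup_frag_cmul[OF A(1)] y by blast
        qed
        then have "frag_cmul n x \<in> W" using pW by auto
        then show "y \<in> D" using wn W0(4) y W(4) by blast
      qed
    qed
    moreover have "x \<in> W'"
    proof -
      have "x = 0 + frag_cmul 1 x" by simp
      then show ?thesis using W0(1) unfolding W'_def by blast
    qed
    ultimately have "x - 0 \<in> W" by simp
    then show False using no A0(1) by blast
  qed
  then show thesis using that W by blast
qed

section \<open>Acyclic lattices over a cyclic group of prime order\<close>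

text \<open>
  An additive automorphism \<open>a\<close> with \<open>a\<^sup>p = 1\<close> of a free abelian group on countably many generators.
\<close>
locale cyclic_action =
  fixes p :: nat and a :: "('i::countable \<Rightarrow>\<^sub>0 int) \<Rightarrow> ('i \<Rightarrow>\<^sub>0 int)"
  assumes prime_p: "Factorial_Ring.prime p"
    and a_add: "a (x + y) = a x + a y"
    and a_pow_p: "(a ^^ p) x = x"
begin

text \<open>
  The operator \<open>t = a - 1\<close>.
\<close>
definition t_op :: "('i \<Rightarrow>\<^sub>0 int) \<Rightarrow> ('i \<Rightarrow>\<^sub>0 int)" where
  "t_op x = a x - x"

text \<open>
  The norm operator \<open>\<sigma> = 1 + a + \<dots> + a\<^sup>p\<^sup>-\<^sup>1\<close>.
\<close>
definition sigma :: "('i \<Rightarrow>\<^sub>0 int) \<Rightarrow> ('i \<Rightarrow>\<^sub>0 int)" where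
  "sigma x = (\<Sum>k<p. (a ^^ k) x)"

text \<open>
  Submodules: subgroups stable under \<open>a\<close>. As \<open>a\<^sup>p = 1\<close>, they are stable under the inverse of \<open>a\<close> as well.
\<close>
definition submod :: "('i \<Rightarrow>\<^sub>0 int) set \<Rightarrow> bool" where
  "submod E \<longleftrightarrow> add_subgroup E \<and> (\<forall>x\<in>E. a x \<in> E)"

text \<open>
  Vanishing of the Tate cohomology group \<open>H\<^sup>-\<^sup>1(E)\<close>, the kernel of \<open>\<sigma>\<close> modulo the image of \<open>t\<close>.
\<close>
definition acyclic :: "('i \<Rightarrow>\<^sub>0 int) set \<Rightarrow> bool" where
  "acyclic E \<longleftrightarrow> (\<forall>x\<in>E. sigma x = 0 \<longrightarrow> (\<exists>y\<in>E. t_op y = x))"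

text \<open>
  The trace of an additive map under conjugation by powers of \<open>a\<close>; here \<open>a\<^sup>p\<^sup>-\<^sup>k\<close> is the inverse of \<open>a\<^sup>k\<close>.
\<close>
definition conj_trace where
  "conj_trace f x = (\<Sum>k<p. (a ^^ k) (f ((a ^^ (p - k)) x)))"

lemma pow_add: "(a ^^ k) (x + y) = (a ^^ k) x + (a ^^ k) y"
  by (induction k) (simp_all add: a_add)

lemma pow_additive: "additive_on UNIV (a ^^ k)"
  by (simp add: additive_on_def pow_add)

lemmas pow_simps = additive_UNIV_D[OF pow_additive]
  additive_on_sum[OF add_subgroup_UNIV pow_additive UNIV_I]
  additive_on_frag_cmul[OF add_subgroup_UNIV pow_additive UNIV_I]

lemmas a_simps = pow_simps[of "Suc 0", simplified]

lemma a_pow_commute: "a ((a ^^ k) x) = (a ^^ k) (a x)"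
  by (metis funpow_swap1)

lemma t_op_additive: "additive_on UNIV t_op"
  by (simp add: additive_on_def t_op_def a_add)

lemmas t_op_simps = additive_UNIV_D[OF t_op_additive]
  additive_on_frag_cmul[OF add_subgroup_UNIV t_op_additive UNIV_I]

lemma sigma_additive: "additive_on UNIV sigma"
  by (simp add: additive_on_def sigma_def pow_add sum.distrib)

lemmas sigma_simps = additive_UNIV_D[OF sigma_additive]
  additive_on_frag_cmul[OF add_subgroup_UNIV sigma_additive UNIV_I]

lemma sum_rotate:
  fixes F :: "nat \<Rightarrow> 'i \<Rightarrow>\<^sub>0 int"
  assumes "F p = F 0"
  shows "(\<Sum>k<p. F (Suc k)) = (\<Sum>k<p. F k)"
  using sum.lessThan_Suc_shift[of F p] sum.lessThan_Suc[of F p] assms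
  by (simp add: add.commute)

lemma sigma_a: "sigma (a x) = sigma x"
  unfolding sigma_def using sum_rotate[of "\<lambda>k. (a ^^ k) x"]
  by (simp add: a_pow_p flip: a_pow_commute)

lemma sigma_t_op: "sigma (t_op x) = 0"
  by (simp add: t_op_def sigma_simps sigma_a)

lemma sum_const_frag: "(\<Sum>k<n. x) = frag_cmul (int n) x"
  by (induction n) (simp_all add: frag_cmul_distrib)

lemma pow_fixed: "a x = x \<Longrightarrow> (a ^^ k) x = x"
  by (induction k) simp_all

lemma sigma_fixed: "a x = x \<Longrightarrow> sigma x = frag_cmul (int p) x"
  by (simp add: sigma_def pow_fixed sum_const_frag)

lemma p_pos: "0 < p"
  using prime_p prime_gt_0_nat by blast

lemma submodD:
  assumes "submod E"
  shows submod_subgroup: "add_subgroup E"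
    and submod_a: "x \<in> E \<Longrightarrow> a x \<in> E"
    and submod_pow: "x \<in> E \<Longrightarrow> (a ^^ k) x \<in> E"
    and submod_t_op: "x \<in> E \<Longrightarrow> t_op x \<in> E"
    and submod_t_op_pow: "x \<in> E \<Longrightarrow> (t_op ^^ k) x \<in> E"
proof -
  show s: "add_subgroup E" and A: "x \<in> E \<Longrightarrow> a x \<in> E" for x
    using assms by (auto simp: submod_def)
  show P: "x \<in> E \<Longrightarrow> (a ^^ k) x \<in> E" for x k by (induction k) (auto intro: A)
  show T: "x \<in> E \<Longrightarrow> t_op x \<in> E" for x
    unfolding t_op_def using A by (intro add_subgroup_diff s)
  show "x \<in> E \<Longrightarrow> (t_op ^^ k) x \<in> E" for x by (induction k) (auto intro: T)
qed

lemma pow_binomial: "(a ^^ n) x = (\<Sum>k\<le>n. frag_cmul (int (n choose k)) ((t_op ^^ k) x))"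
proof (induction n)
  case (Suc n)
  have a_eq: "a y = y + t_op y" for y by (simp add: t_op_def)
  have tts: "t_op (sum f A) = (\<Sum>k\<in>A. t_op (f k))" for f :: "nat \<Rightarrow> 'i \<Rightarrow>\<^sub>0 int" and A
    by (rule additive_on_sum[OF add_subgroup_UNIV t_op_additive]) simp
  have "(a ^^ Suc n) x = (\<Sum>k\<le>n. frag_cmul (int (n choose k)) ((t_op ^^ k) x))
      + (\<Sum>k\<le>n. frag_cmul (int (n choose k)) ((t_op ^^ Suc k) x))"
    by (simp add: Suc a_eq[of "sum _ _"] tts t_op_simps)
  also have "(\<Sum>k\<le>n. frag_cmul (int (n choose k)) ((t_op ^^ k) x))
      = (\<Sum>k\<le>Suc n. frag_cmul (int (n choose k)) ((t_op ^^ k) x))"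
    by simp
  also have "\<dots> = x + (\<Sum>k\<le>n. frag_cmul (int (n choose Suc k)) ((t_op ^^ Suc k) x))"
    by (subst sum.atMost_Suc_shift) simp
  finally have "(a ^^ Suc n) x = x + (\<Sum>k\<le>n. frag_cmul (int (Suc n choose Suc k)) ((t_op ^^ Suc k) x))"
    by (simp add: sum.distrib frag_cmul_distrib add.commute add.left_commute)
  also have "\<dots> = (\<Sum>k\<le>Suc n. frag_cmul (int (Suc n choose k)) ((t_op ^^ k) x))"
    by (subst sum.atMost_Suc_shift[of _ n]) simp
  finally show ?case .
qed simp

text \<open>
  Modulo \<open>p\<close>, the operator \<open>t\<close> is nilpotent: \<open>t\<^sup>p\<close> is congruent to \<open>a\<^sup>p - 1 = 0\<close>.
\<close>
lemma t_op_pow_p: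
  assumes "submod E" "x \<in> E"
  shows "(t_op ^^ p) x \<in> frag_cmul (int p) ` E"
proof -
  obtain m where m: "p = Suc m" using p_pos by (cases p) auto
  have dv: "p dvd (p choose Suc k)" if "k < m" for k
    by (rule dvd_choose_prime) (use that m prime_p in auto)
  define y where "y = (\<Sum>k<m. frag_cmul (int ((p choose Suc k) div p)) ((t_op ^^ Suc k) x))"
  have "y \<in> E" unfolding y_def
    by (intro add_subgroup_sum add_subgroup_frag_cmul submod_subgroup submod_t_op_pow assms)
  have "x = (\<Sum>k\<le>Suc m. frag_cmul (int (p choose k)) ((t_op ^^ k) x))"
    using pow_binomial[of p x] a_pow_p m by simp
  also have "\<dots> = x + (\<Sum>k\<le>m. frag_cmul (int (p choose Suc k)) ((t_op ^^ Suc k) x))"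
    by (subst sum.atMost_Suc_shift) simp
  also have "(\<Sum>k\<le>m. frag_cmul (int (p choose Suc k)) ((t_op ^^ Suc k) x))
      = (\<Sum>k<m. frag_cmul (int (p choose Suc k)) ((t_op ^^ Suc k) x)) + (t_op ^^ p) x"
    using m by (simp add: lessThan_Suc_atMost[symmetric] binomial_eq_0)
  also have "(\<Sum>k<m. frag_cmul (int (p choose Suc k)) ((t_op ^^ Suc k) x)) = frag_cmul (int p) y"
    unfolding y_def frag_cmul_sum
  proof (rule sum.cong[OF refl])
    fix k assume "k \<in> {..<m}"
    then have "(p choose Suc k) = p * ((p choose Suc k) div p)" using dv by simp
    then have "int (p choose Suc k) = int p * int ((p choose Suc k) div p)"
      by (metis of_nat_mult)
    then show "frag_cmul (int (p choose Suc k)) ((t_op ^^ Suc k) x)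
        = frag_cmul (int p) (frag_cmul (int ((p choose Suc k) div p)) ((t_op ^^ Suc k) x))"
      by (simp only: frag_cmul_cmul)
  qed
  finally have "frag_cmul (int p) y + (t_op ^^ p) x = 0" by simp
  then have "(t_op ^^ p) x = - frag_cmul (int p) y" by (metis add.inverse_unique add.inverse_inverse)
  also have "\<dots> = frag_cmul (int p) (- y)" by (rule poly_mapping_eqI) simp
  finally have "(t_op ^^ p) x = frag_cmul (int p) (- y)" .
  then show ?thesis using \<open>y \<in> E\<close> add_subgroup_uminus submod_subgroup[OF assms(1)] by blast
qed

lemma conj_trace_equivariant: "conj_trace f (a x) = a (conj_trace f x)"
proof -
  define F where "F k = (a ^^ k) (f ((a ^^ (p - k)) (a x)))" for k
  have "a (conj_trace f x) = (\<Sum>k<p. F (Suc k))"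
    unfolding conj_trace_def a_simps
  proof (rule sum.cong[OF refl])
    fix k assume "k \<in> {..<p}"
    then have "p - k = Suc (p - Suc k)" by simp
    then have "(a ^^ (p - k)) x = (a ^^ (p - Suc k)) (a x)"
      by (simp add: a_pow_commute)
    then show "a ((a ^^ k) (f ((a ^^ (p - k)) x))) = F (Suc k)"
      by (simp add: F_def)
  qed
  also have "\<dots> = (\<Sum>k<p. F k)"
    by (rule sum_rotate) (simp add: F_def a_pow_p)
  finally show ?thesis by (simp add: conj_trace_def F_def)
qed

lemma conj_trace_fixed: "a x = x \<Longrightarrow> conj_trace f x = sigma (f x)"
  by (simp add: conj_trace_def sigma_def pow_fixed)

lemma equivariant_pow:
  assumes "submod E" "\<And>x. x \<in> E \<Longrightarrow> g (a x) = a (g x)" "x \<in> E"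
  shows "g ((a ^^ k) x) = (a ^^ k) (g x)"
  by (induction k) (simp_all add: assms submod_pow)

lemma conj_trace_comp:
  assumes "submod E" "\<And>x. x \<in> E \<Longrightarrow> g (a x) = a (g x)" "x \<in> E"
  shows "conj_trace (\<lambda>x. f (g x)) x = conj_trace f (g x)"
  unfolding conj_trace_def by (simp add: equivariant_pow[where g = g, OF assms])

lemma conj_trace_of_equivariant:
  assumes "submod E" "\<And>x. x \<in> E \<Longrightarrow> g (a x) = a (g x)" "x \<in> E"
  shows "conj_trace g x = frag_cmul (int p) (g x)"
proof -
  have "conj_trace g x = (\<Sum>k<p. g x)"
    unfolding conj_trace_def
  proof (rule sum.cong[OF refl])
    fix k assume "k \<in> {..<p}"
    then have "(a ^^ k) ((a ^^ (p - k)) (g x)) = g x"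
      by (metis a_pow_p comp_apply funpow_add le_add_diff_inverse lessThan_iff less_imp_le)
    then show "(a ^^ k) (g ((a ^^ (p - k)) x)) = g x"
      by (simp add: equivariant_pow[where g = g, OF assms])
  qed
  then show ?thesis by (simp add: sum_const_frag)
qed

lemma conj_trace_additive:
  assumes "submod E" "additive_on E f"
  shows "additive_on E (conj_trace f)"
  using assms unfolding additive_on_def conj_trace_def
  by (simp add: pow_add submod_pow sum.distrib)

lemma conj_trace_closed:
  assumes "submod E" "\<And>x. x \<in> E \<Longrightarrow> f x \<in> E" "x \<in> E"
  shows "conj_trace f x \<in> E"
  unfolding conj_trace_def
  by (intro add_subgroup_sum submod_subgroup submod_pow assms)

text \<open>
  On an acyclic submodule \<open>E\<close>, the identity is a trace plus a map that factors through a trivial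
  module. This makes \<open>E\<close> a direct summand of a direct sum of free and trivial modules.
\<close>
lemma acyclic_decomposition:
  assumes E: "submod E" and ac: "acyclic E"
  obtains \<theta> \<kappa> where "additive_on E \<theta>" "\<And>x. x \<in> E \<Longrightarrow> \<theta> x \<in> E"
    "additive_on E \<kappa>" "\<And>x. x \<in> E \<Longrightarrow> \<kappa> x \<in> E" "\<And>x. x \<in> E \<Longrightarrow> a (\<kappa> x) = \<kappa> x"
    "\<And>x. x \<in> E \<Longrightarrow> \<kappa> (a x) = \<kappa> x"
    "\<And>x. x \<in> E \<Longrightarrow> x = conj_trace \<theta> x + \<kappa> x"
proof -
  note E0 = add_subgroupD[OF submod_subgroup[OF E]]
  note Ecm = add_subgroup_frag_cmul[OF submod_subgroup[OF E]]
  have sE: "add_subgroup E" by (rule submod_subgroup[OF E])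
  \<comment> \<open>\<open>B\<close> consists of the invariants of \<open>E\<close>, and \<open>D\<close> below is \<open>tE + pE\<close>.\<close>
  define B where "B = {x \<in> E. a x = x}"
  have B: "add_subgroup B" "B \<subseteq> E"
    unfolding add_subgroup_def B_def using E0 by (auto simp: a_simps)
  let ?p = "int p"
  have prime_int: "Factorial_Ring.prime ?p" using prime_p by simp
  have p0: "?p \<noteq> 0" using p_pos by simp
  define pE where "pE = frag_cmul ?p ` E"
  have pE: "add_subgroup pE" "pE \<subseteq> E"
    unfolding add_subgroup_def
  proof (intro conjI ballI)
    have "0 = frag_cmul ?p 0" by simp
    then show "0 \<in> pE" using E0(1) unfolding pE_def by blast
    fix x y assume "x \<in> pE" "y \<in> pE"
    then show "x - y \<in> pE"
      using E0(2) unfolding pE_def by (auto simp flip: frag_cmul_diff_distrib2)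
  qed (auto simp: pE_def Ecm)
  define D where "D = {t_op y + z | y z. y \<in> E \<and> z \<in> pE}"
  have D: "add_subgroup D" "D \<subseteq> E"
    unfolding add_subgroup_def
  proof (intro conjI ballI)
    have "0 = t_op 0 + 0" by (simp add: t_op_simps)
    then show "0 \<in> D" using E0(1) add_subgroup_zero[OF pE(1)] unfolding D_def by blast
    fix x y assume "x \<in> D" "y \<in> D"
    then obtain u v w z where *: "u \<in> E" "v \<in> pE" "x = t_op u + v" "w \<in> E" "z \<in> pE" "y = t_op w + z"
      by (auto simp: D_def)
    then have "x - y = t_op (u - w) + (v - z)" by (simp add: t_op_simps)
    then show "x - y \<in> D"
      using * E0(2) add_subgroup_diff[OF pE(1)] unfolding D_def by blast
  next
    show "D \<subseteq> E" unfolding D_def using submod_t_op[OF E] pE(2) E0(4) by blast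
  qed
  have pED: "x \<in> pE \<Longrightarrow> x \<in> D" for x
  proof -
    assume "x \<in> pE"
    moreover have "x = t_op 0 + x" by (simp add: t_op_simps)
    ultimately show "x \<in> D" using E0(1) unfolding D_def by blast
  qed
  have ttD: "x \<in> E \<Longrightarrow> t_op x \<in> D" for x
  proof -
    assume "x \<in> E"
    moreover have "t_op x = t_op x + 0" by simp
    ultimately show "t_op x \<in> D" using add_subgroup_zero[OF pE(1)] unfolding D_def by blast
  qed
  \<comment> \<open>One has \<open>B \<inter> D \<subseteq> \<sigma>E\<close>: applying \<open>\<sigma>\<close> to \<open>b = ty + pz\<close> yields \<open>pb = p\<sigma>z\<close>. Hence projection to
    \<open>B\<close> along \<open>W\<close>, defined modulo \<open>\<sigma>E\<close>, kills \<open>tE\<close>. A lift \<open>\<kappa>0\<close> of it that kills \<open>tE\<close> on the nose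
    is obtained as a map on \<open>\<sigma>E\<close>, which is \<open>E/tE\<close> by acyclicity.\<close>
  obtain W where W: "add_subgroup W" "D \<subseteq> W" "W \<subseteq> E" "W \<inter> B \<subseteq> D"
      "\<And>x. x \<in> E \<Longrightarrow> \<exists>b\<in>B. x - b \<in> W"
    by (rule elementary_complement[OF prime_int sE B D]) (auto simp: pE_def intro: pED)
  obtain W2 where W2: "add_subgroup W2" "pE \<subseteq> W2" "W2 \<subseteq> E" "W2 \<inter> B \<subseteq> pE"
      "\<And>x. x \<in> E \<Longrightarrow> \<exists>b\<in>B. x - b \<in> W2"
    by (rule elementary_complement[OF prime_int sE B pE]) (auto simp: pE_def)
  define \<rho> where "\<rho> = {(sigma x, b) | x b. x \<in> E \<and> b \<in> B \<and> x - b \<in> W}"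
  have nmE: "add_subgroup (sigma ` E)"
    unfolding add_subgroup_def
  proof (intro conjI ballI)
    have "0 = sigma 0" by (simp add: sigma_simps)
    then show "0 \<in> sigma ` E" using E0(1) by blast
    fix x y assume "x \<in> sigma ` E" "y \<in> sigma ` E"
    then show "x - y \<in> sigma ` E" using E0(2) by (auto simp flip: sigma_simps)
  qed
  have \<rho>: "add_subgroup \<rho>"
    unfolding add_subgroup_def
  proof (intro conjI ballI)
    have "0 = (sigma 0, 0) \<and> 0 - 0 \<in> W"
      using add_subgroup_zero[OF W(1)] by (simp add: sigma_simps zero_prod_def)
    then show "0 \<in> \<rho>" using E0(1) add_subgroup_zero[OF B(1)] unfolding \<rho>_def by blast
    fix u v assume "u \<in> \<rho>" "v \<in> \<rho>"
    then obtain x b y c where *: "u = (sigma x, b)" "x \<in> E" "b \<in> B" "x - b \<in> W"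
        "v = (sigma y, c)" "y \<in> E" "c \<in> B" "y - c \<in> W"
      by (auto simp: \<rho>_def)
    then have "u - v = (sigma (x - y), b - c)" by (simp add: sigma_simps)
    moreover have "(x - y) - (b - c) \<in> W"
      using add_subgroup_diff[OF W(1) *(4) *(8)] by (simp add: algebra_simps)
    ultimately show "u - v \<in> \<rho>"
      using * E0(2) add_subgroup_diff[OF B(1)] unfolding \<rho>_def by blast
  qed
  obtain \<kappa>1 where k1: "additive_on (sigma ` E) \<kappa>1" "\<And>h. h \<in> sigma ` E \<Longrightarrow> (h, \<kappa>1 h) \<in> \<rho>"
  proof (rule additive_selection[OF nmE \<rho>])
    fix h assume "h \<in> sigma ` E"
    then show "\<exists>y. (h, y) \<in> \<rho>" using W(5) unfolding \<rho>_def by blast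
  qed blast
  define \<kappa>0 where "\<kappa>0 x = \<kappa>1 (sigma x)" for x
  have k0_add: "additive_on E \<kappa>0"
    using k1(1) by (auto simp: additive_on_def \<kappa>0_def sigma_simps)
  have k0B: "\<kappa>0 x \<in> B" if "x \<in> E" for x
    using k1(2)[of "sigma x"] that by (auto simp: \<rho>_def \<kappa>0_def)
  have k0E: "\<kappa>0 x \<in> E" and k0a: "a (\<kappa>0 x) = \<kappa>0 x" if "x \<in> E" for x
    using k0B[OF that] by (auto simp: B_def)
  have k0_a: "\<kappa>0 (a x) = \<kappa>0 x" for x by (simp add: \<kappa>0_def sigma_a)
  \<comment> \<open>The error of \<open>\<kappa>0\<close> on invariants consists of norms.\<close>
  have k0_sigma: "\<exists>z\<in>E. sigma z = b - \<kappa>0 b" if b: "b \<in> B" for b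
  proof -
    have bE: "b \<in> E" using b B by blast
    obtain x where x: "x \<in> E" "sigma x = sigma b" "x - \<kappa>0 b \<in> W"
      using k1(2)[of "sigma b"] bE by (auto simp: \<rho>_def \<kappa>0_def)
    have "sigma (x - b) = 0" using x by (simp add: sigma_simps)
    then obtain y where "y \<in> E" "t_op y = x - b"
      using ac E0(2)[OF x(1) bE] by (auto simp: acyclic_def)
    then have "x - b \<in> W" using ttD[of y] W(2) by auto
    from add_subgroup_diff[OF W(1) x(3) this] have "b - \<kappa>0 b \<in> W" by simp
    moreover have fB: "b - \<kappa>0 b \<in> B" using add_subgroup_diff[OF B(1) b k0B[OF bE]] .
    ultimately obtain y z where yz: "b - \<kappa>0 b = t_op y + frag_cmul ?p z" "z \<in> E"
      using W(4) by (auto simp: D_def pE_def)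
    have "frag_cmul ?p (b - \<kappa>0 b) = sigma (b - \<kappa>0 b)" using fB by (simp add: sigma_fixed B_def)
    also have "\<dots> = frag_cmul ?p (sigma z)" unfolding yz(1) by (simp add: sigma_simps sigma_t_op)
    finally show ?thesis using yz(2) p0 frag_cmul_cancel by metis
  qed
  \<comment> \<open>The map \<open>\<phi>\<close> corrects that error: it is chosen such that, modulo \<open>p\<close>, one has
    \<open>\<sigma>\<phi>(b) = b - \<kappa>0(b)\<close> for invariant \<open>b\<close>. It is defined on all of \<open>E\<close> through the projection to \<open>B\<close>
    along \<open>W2\<close>.\<close>
  define \<rho>2 where "\<rho>2 = {(x, y). x \<in> E \<and> y \<in> E \<and> (\<exists>b\<in>B. x - b \<in> W2 \<and> sigma y = b - \<kappa>0 b)}"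
  have \<rho>2: "add_subgroup \<rho>2"
    unfolding add_subgroup_def
  proof (intro conjI ballI)
    show "0 \<in> \<rho>2" unfolding \<rho>2_def zero_prod_def
      using E0(1) add_subgroup_zero[OF W2(1)] add_subgroup_zero[OF B(1)] additive_on_zero[OF sE k0_add]
      by (auto simp: sigma_simps intro!: bexI[of _ 0])
    fix u v assume "u \<in> \<rho>2" "v \<in> \<rho>2"
    then obtain x y b x' y' b' where *: "u = (x, y)" "x \<in> E" "y \<in> E" "b \<in> B" "x - b \<in> W2"
        "sigma y = b - \<kappa>0 b" "v = (x', y')" "x' \<in> E" "y' \<in> E" "b' \<in> B" "x' - b' \<in> W2"
        "sigma y' = b' - \<kappa>0 b'"
      by (auto simp: \<rho>2_def)
    have bE: "b \<in> E" "b' \<in> E" using * B by auto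
    have "(x - x') - (b - b') \<in> W2"
      using add_subgroup_diff[OF W2(1) *(5) *(11)] by (simp add: algebra_simps)
    moreover have "sigma (y - y') = (b - b') - \<kappa>0 (b - b')"
      using * additive_on_diff[OF sE k0_add bE] by (simp add: sigma_simps)
    ultimately show "u - v \<in> \<rho>2"
      using * E0(2) add_subgroup_diff[OF B(1)] unfolding \<rho>2_def by auto
  qed
  obtain \<phi> where ph: "additive_on E \<phi>" "\<And>x. x \<in> E \<Longrightarrow> (x, \<phi> x) \<in> \<rho>2"
  proof (rule additive_selection[OF sE \<rho>2])
    fix x assume x: "x \<in> E"
    obtain b where "b \<in> B" "x - b \<in> W2" using W2(5) x by blast
    then show "\<exists>y. (x, y) \<in> \<rho>2" using k0_sigma x unfolding \<rho>2_def by blast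
  qed blast
  have phE: "\<phi> x \<in> E" if "x \<in> E" for x using ph(2)[OF that] by (auto simp: \<rho>2_def)
  \<comment> \<open>The trace of \<open>\<phi>\<close> plus \<open>\<kappa>0\<close> is the identity on \<open>B\<close> modulo \<open>p\<close>; the difference \<open>\<nu>\<close> from the identity is nilpotent modulo \<open>p\<close>.\<close>
  define \<nu> where "\<nu> x = x - (conj_trace \<phi> x + \<kappa>0 x)" for x
  have nuE: "\<nu> x \<in> E" if "x \<in> E" for x
    unfolding \<nu>_def using that k0E conj_trace_closed[OF E phE] E0 by simp
  have nu_add: "additive_on E \<nu>"
    using conj_trace_additive[OF E ph(1)] k0_add by (auto simp: additive_on_def \<nu>_def)
  have nu_a: "\<nu> (a x) = a (\<nu> x)" if "x \<in> E" for x
    using k0a[OF that] by (simp add: \<nu>_def a_simps conj_trace_equivariant k0_a)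
  have nuB: "\<nu> x \<in> pE" if x: "x \<in> B" for x
  proof -
    have xE: "x \<in> E" and ax: "a x = x" using x by (auto simp: B_def)
    obtain b where b: "b \<in> B" "x - b \<in> W2" "sigma (\<phi> x) = b - \<kappa>0 b"
      using ph(2)[OF xE] by (auto simp: \<rho>2_def)
    have "x - b \<in> pE" using add_subgroup_diff[OF B(1) x b(1)] b(2) W2(4) by blast
    then obtain z where z: "z \<in> E" "x - b = frag_cmul ?p z" by (auto simp: pE_def)
    have bE: "b \<in> E" using b B by auto
    have "\<nu> x = (x - b) - \<kappa>0 (x - b)"
      using additive_on_diff[OF sE k0_add xE bE] by (simp add: \<nu>_def conj_trace_fixed ax b(3))
    also have "\<dots> = frag_cmul ?p (z - \<kappa>0 z)"
      by (simp add: z additive_on_frag_cmul[OF sE k0_add] frag_cmul_diff_distrib2)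
    finally show ?thesis using E0(2)[OF z(1) k0E[OF z(1)]] by (auto simp: pE_def)
  qed
  \<comment> \<open>By acyclicity, the invariants modulo \<open>p\<close> are the reductions of elements of \<open>B\<close>, so \<open>\<nu>\<close> kills them.\<close>
  have nu_lower: "\<nu> w \<in> pE" if w: "w \<in> E" "t_op w \<in> pE" for w
  proof -
    obtain y where y: "y \<in> E" "t_op w = frag_cmul ?p y" using w by (auto simp: pE_def)
    have "frag_cmul ?p (sigma y) = sigma (t_op w)" by (simp add: y sigma_simps)
    then have "sigma y = 0" using p0 by (simp add: sigma_t_op)
    then obtain z where z: "z \<in> E" "t_op z = y" using ac y by (auto simp: acyclic_def)
    have "t_op (w - frag_cmul ?p z) = 0" by (simp add: t_op_simps y z)
    then have "w - frag_cmul ?p z \<in> B" using E0(2)[OF w(1) Ecm[OF z(1)]] by (simp add: B_def t_op_def)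
    then have "\<nu> (w - frag_cmul ?p z) \<in> pE" by (rule nuB)
    moreover have "\<nu> w = \<nu> (w - frag_cmul ?p z) + frag_cmul ?p (\<nu> z)"
      using additive_on_diff[OF sE nu_add w(1) Ecm[OF z(1)]] additive_on_frag_cmul[OF sE nu_add z(1)]
      by simp
    moreover have "frag_cmul ?p (\<nu> z) \<in> pE" using nuE[OF z(1)] by (auto simp: pE_def)
    ultimately show ?thesis using add_subgroup_add[OF pE(1)] by simp
  qed
  have nu_t_op: "\<nu> ((t_op ^^ i) x) = (t_op ^^ i) (\<nu> x)" if "x \<in> E" for i x
  proof (induction i)
    case (Suc i)
    have "\<nu> (t_op y) = t_op (\<nu> y)" if "y \<in> E" for y
      using additive_on_diff[OF sE nu_add submod_a[OF E that] that] nu_a[OF that] by (simp add: t_op_def)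
    then show ?case using Suc submod_t_op_pow[OF E that] by simp
  qed simp
  \<comment> \<open>Hence \<open>\<nu>\<close> lowers the filtration of \<open>E/pE\<close> by the kernels of the powers of \<open>t\<close>.\<close>
  have nu_pow: "(\<nu> ^^ i) x \<in> pE" if "x \<in> E" "(t_op ^^ i) x \<in> pE" for i x
    using that
  proof (induction i arbitrary: x)
    case (Suc i)
    have "(t_op ^^ i) (\<nu> x) \<in> pE"
      using nu_lower[OF submod_t_op_pow[OF E Suc.prems(1)], of i] Suc.prems nu_t_op by simp
    then show ?case using Suc.IH[OF nuE[OF Suc.prems(1)]] by (simp add: funpow_swap1)
  qed simp
  have nupE: "(\<nu> ^^ i) x \<in> E" if "x \<in> E" for i x
    by (induction i) (auto simp: that nuE)
  have nup_add: "additive_on E (\<nu> ^^ i)" for i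
  proof (induction i)
    case (Suc i)
    then show ?case using nu_add nupE by (simp add: additive_on_def)
  qed (simp add: additive_on_def)
  have nup_a: "(\<nu> ^^ i) (a x) = a ((\<nu> ^^ i) x)" if "x \<in> E" for i x
    by (induction i) (simp_all add: nu_a nupE that)
  have "\<exists>y\<in>E. (\<nu> ^^ p) x = frag_cmul ?p y" if "x \<in> E" for x
    using nu_pow[OF that] t_op_pow_p[OF E that] by (auto simp: pE_def)
  then obtain \<psi> where psi: "\<And>x. x \<in> E \<Longrightarrow> \<psi> x \<in> E" "\<And>x. x \<in> E \<Longrightarrow> (\<nu> ^^ p) x = frag_cmul ?p (\<psi> x)"
    by metis
  have psi_add: "additive_on E \<psi>"
    unfolding additive_on_def
  proof (intro ballI)
    fix x y assume xy: "x \<in> E" "y \<in> E"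
    have "frag_cmul ?p (\<psi> (x + y)) = frag_cmul ?p (\<psi> x + \<psi> y)"
      using xy nup_add[of p] E0(4) psi(2)[symmetric] by (simp add: frag_cmul_distrib2 additive_on_def)
    then show "\<psi> (x + y) = \<psi> x + \<psi> y" using p0 by (simp add: frag_cmul_cancel)
  qed
  have psi_a: "\<psi> (a x) = a (\<psi> x)" if x: "x \<in> E" for x
  proof -
    have "frag_cmul ?p (\<psi> (a x)) = frag_cmul ?p (a (\<psi> x))"
      using nup_a[OF x, of p] psi(2)[OF x] psi(2)[OF submod_a[OF E x]] by (simp add: a_simps)
    then show ?thesis using p0 by (simp add: frag_cmul_cancel)
  qed
  \<comment> \<open>The inverse of \<open>1 - \<nu>\<close> modulo \<open>p\<close>.\<close>
  define \<mu> where "\<mu> x = (\<Sum>i<p. (\<nu> ^^ i) x)" for x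
  have muE: "\<mu> x \<in> E" if "x \<in> E" for x
    unfolding \<mu>_def using nupE that by (intro add_subgroup_sum sE)
  have mu_add: "additive_on E \<mu>"
    using nup_add unfolding additive_on_def \<mu>_def by (simp add: sum.distrib)
  have mu_a: "\<mu> (a x) = a (\<mu> x)" if "x \<in> E" for x
    by (simp add: \<mu>_def a_simps nup_a that)
  have tele: "\<mu> x - \<nu> (\<mu> x) = x - (\<nu> ^^ p) x" if x: "x \<in> E" for x
  proof -
    have "\<nu> (\<mu> x) = (\<Sum>i<p. (\<nu> ^^ Suc i) x)"
      unfolding \<mu>_def using additive_on_sum[OF sE nu_add, of "{..<p}" "\<lambda>i. (\<nu> ^^ i) x"] nupE[OF x] by simp
    then show ?thesis
      unfolding \<mu>_def
      using sum.lessThan_Suc_shift[of "\<lambda>i. (\<nu> ^^ i) x" p] sum.lessThan_Suc[of "\<lambda>i. (\<nu> ^^ i) x" p]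
      by (simp add: algebra_simps)
  qed
  \<comment> \<open>The summand \<open>\<psi>\<close> has trace \<open>p\<psi> = \<nu>\<^sup>p\<close>, which is the defect of \<open>\<mu>\<close> as an inverse.\<close>
  show thesis
  proof
    show "additive_on E (\<lambda>x. \<phi> (\<mu> x) + \<psi> x)"
      using ph(1) psi_add mu_add muE by (auto simp: additive_on_def)
    show "\<phi> (\<mu> x) + \<psi> x \<in> E" if "x \<in> E" for x using that phE muE psi E0(4) by simp
    show "additive_on E (\<lambda>x. \<kappa>0 (\<mu> x))" using k0_add mu_add muE by (auto simp: additive_on_def)
    show "\<kappa>0 (\<mu> x) \<in> E" "a (\<kappa>0 (\<mu> x)) = \<kappa>0 (\<mu> x)" if "x \<in> E" for x
      using that muE k0E k0a by auto
    show "\<kappa>0 (\<mu> (a x)) = \<kappa>0 (\<mu> x)" if "x \<in> E" for x using that by (simp add: mu_a k0_a)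
    show "x = conj_trace (\<lambda>x. \<phi> (\<mu> x) + \<psi> x) x + \<kappa>0 (\<mu> x)" if x: "x \<in> E" for x
    proof -
      have "conj_trace (\<lambda>x. \<phi> (\<mu> x) + \<psi> x) x = conj_trace (\<lambda>x. \<phi> (\<mu> x)) x + conj_trace \<psi> x"
        by (simp add: conj_trace_def pow_add sum.distrib)
      also have "\<dots> = conj_trace \<phi> (\<mu> x) + (\<nu> ^^ p) x"
        using conj_trace_comp[where g = \<mu> and f = \<phi>, OF E mu_a x] conj_trace_of_equivariant[where g = \<psi>, OF E psi_a x] psi(2)[OF x]
        by simp
      finally show ?thesis using tele[OF x] by (simp add: \<nu>_def algebra_simps)
    qed
  qed
qed

text \<open>
  The equivariant analogue of \<open>additive_selection\<close>. It says in particular that an equivariant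
  surjection onto an acyclic submodule splits if it is surjective on invariants.
\<close>
lemma equivariant_selection:
  assumes E: "submod E" and ac: "acyclic E" and \<rho>: "add_subgroup \<rho>"
    and inv: "\<And>x y. (x, y) \<in> \<rho> \<Longrightarrow> (a x, a y) \<in> \<rho>"
    and total: "\<And>x. x \<in> E \<Longrightarrow> \<exists>y. (x, y) \<in> \<rho>"
    and fixed: "\<And>x. x \<in> E \<Longrightarrow> a x = x \<Longrightarrow> \<exists>y. a y = y \<and> (x, y) \<in> \<rho>"
  obtains c where "additive_on E c" "\<And>x. x \<in> E \<Longrightarrow> c (a x) = a (c x)" "\<And>x. x \<in> E \<Longrightarrow> (x, c x) \<in> \<rho>"
proof -
  obtain \<theta> \<kappa> where th: "additive_on E \<theta>" "\<And>x. x \<in> E \<Longrightarrow> \<theta> x \<in> E"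
    and ka: "additive_on E \<kappa>" "\<And>x. x \<in> E \<Longrightarrow> \<kappa> x \<in> E" "\<And>x. x \<in> E \<Longrightarrow> a (\<kappa> x) = \<kappa> x"
    "\<And>x. x \<in> E \<Longrightarrow> \<kappa> (a x) = \<kappa> x"
    and dec: "\<And>x. x \<in> E \<Longrightarrow> x = conj_trace \<theta> x + \<kappa> x"
    by (rule acyclic_decomposition[OF E ac]) blast
  have sE: "add_subgroup E" by (rule submod_subgroup[OF E])
  obtain s where s: "additive_on E s" "\<And>x. x \<in> E \<Longrightarrow> (x, s x) \<in> \<rho>"
    by (rule additive_selection[OF sE \<rho> total]) blast+
  define B where "B = {x \<in> E. a x = x}"
  have B: "add_subgroup B"
    unfolding add_subgroup_def B_def using add_subgroupD[OF sE] by (auto simp: a_simps)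
  have \<rho>B: "add_subgroup {(x, y) \<in> \<rho>. a y = y}"
    using add_subgroupD[OF \<rho>] unfolding add_subgroup_def by (auto simp: a_simps zero_prod_def)
  obtain sB where sB: "additive_on B sB" "\<And>x. x \<in> B \<Longrightarrow> (x, sB x) \<in> {(x, y) \<in> \<rho>. a y = y}"
  proof (rule additive_selection[OF B \<rho>B])
    fix x assume "x \<in> B"
    then show "\<exists>y. (x, y) \<in> {(x, y) \<in> \<rho>. a y = y}" using fixed by (auto simp: B_def)
  qed blast
  have kaB: "\<kappa> x \<in> B" if "x \<in> E" for x using ka that by (simp add: B_def)
  show thesis
  proof
    let ?c = "\<lambda>x. conj_trace (\<lambda>y. s (\<theta> y)) x + sB (\<kappa> x)"
    have "additive_on E (\<lambda>y. s (\<theta> y))" using s(1) th by (auto simp: additive_on_def)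
    from conj_trace_additive[OF E this] show "additive_on E ?c"
      using sB(1) ka(1) kaB by (auto simp: additive_on_def)
    show "?c (a x) = a (?c x)" if "x \<in> E" for x
      using sB(2)[OF kaB[OF that]] ka(4)[OF that] by (simp add: conj_trace_equivariant a_simps)
    show "(x, ?c x) \<in> \<rho>" if x: "x \<in> E" for x
    proof -
      have pw: "((a ^^ k) u, (a ^^ k) v) \<in> \<rho>" if "(u, v) \<in> \<rho>" for u v k
        by (induction k) (auto simp: that inv)
      have "(\<Sum>k<p. ((a ^^ k) (\<theta> ((a ^^ (p - k)) x)), (a ^^ k) (s (\<theta> ((a ^^ (p - k)) x))))) \<in> \<rho>"
        by (intro add_subgroup_sum[OF \<rho>] pw s th submod_pow[OF E] x)
      moreover have "(\<Sum>k<p. ((a ^^ k) (\<theta> ((a ^^ (p - k)) x)), (a ^^ k) (s (\<theta> ((a ^^ (p - k)) x)))))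
          = (conj_trace \<theta> x, conj_trace (\<lambda>y. s (\<theta> y)) x)"
        by (simp add: conj_trace_def sum_prod)
      ultimately have "(conj_trace \<theta> x, conj_trace (\<lambda>y. s (\<theta> y)) x) \<in> \<rho>" by simp
      moreover have "(\<kappa> x, sB (\<kappa> x)) \<in> \<rho>" using sB(2)[OF kaB[OF x]] by simp
      ultimately have "(conj_trace \<theta> x + \<kappa> x, ?c x) \<in> \<rho>" using add_subgroup_add[OF \<rho>] by fastforce
      then show ?thesis using dec[OF x] by simp
    qed
  qed
qed

end

section \<open>Permutation lattices, covers and the Eilenberg swindle\<close>

text \<open>
  The permutation of the natural numbers that rotates the numbers below \<open>p\<close> and fixes the others.
\<close>
definition rot :: "nat \<Rightarrow> nat \<Rightarrow> nat" where
  "rot p n = (if n < p then Suc n mod p else n)"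

text \<open>
  The permutation lattice with basis \<open>nat \<times> 'x\<close>. The generator acts on the basis through \<open>rot\<close> on the
  first component. For each \<open>x\<close>, the basis elements \<open>(0, x), \<dots>, (p - 1, x)\<close> span a free module of rank one,
  and every \<open>(n, x)\<close> with \<open>n \<ge> p\<close> spans a trivial module. With this encoding the whole type is the
  lattice.
\<close>
type_synonym 'x perm_lattice = "nat \<times> 'x \<Rightarrow>\<^sub>0 int"

definition shift :: "nat \<Rightarrow> 'x perm_lattice \<Rightarrow> 'x perm_lattice" where
  "shift p = frag_extend (\<lambda>(n, x). frag_of (rot p n, x))"

lemma rot_pow: "(rot p ^^ k) n = (if n < p then (n + k) mod p else n)"
proof (induction k)
  case (Suc k)
  then show ?case by (auto simp: rot_def mod_Suc_eq)
qed simp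

lemma rot_less_iff: "rot p n < p \<longleftrightarrow> n < p"
  by (auto simp: rot_def)

lemma inj_rot: "inj (rot p)"
proof (rule injI)
  fix m n assume eq: "rot p m = rot p n"
  show "m = n"
  proof (cases "m < p")
    case True
    with eq have "n < p" by (metis rot_less_iff)
    with eq True show ?thesis by (auto simp: rot_def mod_Suc split: if_splits)
  next
    case False
    with eq have "\<not> n < p" by (metis rot_less_iff)
    with eq False show ?thesis by (simp add: rot_def)
  qed
qed

lemma frag_induct_UNIV [case_names zero of diff]:
  assumes "P 0" "\<And>x. P (frag_of x)" "\<And>x y. P x \<Longrightarrow> P y \<Longrightarrow> P (x - y)"
  shows "P v"
  by (rule frag_induction[where S = UNIV]) (use assms in auto)

lemma frag_extend_additive: "additive_on UNIV (frag_extend f)"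
  by (simp add: additive_on_def frag_extend_add)

lemmas shift_simps = additive_UNIV_D[OF frag_extend_additive, of "\<lambda>(n, x). frag_of (rot p n, x)" for p,
  folded shift_def]

lemma shift_of: "shift p (frag_of (n, x)) = frag_of (rot p n, x)"
  by (simp add: shift_def)

lemma shift_pow_simps: "(shift p ^^ k) 0 = 0" "(shift p ^^ k) (x - y) = (shift p ^^ k) x - (shift p ^^ k) y"
  by (induction k) (simp_all add: shift_simps)

lemma shift_pow_of: "(shift p ^^ k) (frag_of (n, x)) = frag_of ((rot p ^^ k) n, x)"
  by (induction k) (simp_all add: shift_of)

lemma shift_pow_p: "(shift p ^^ p) v = v"
proof (induction v rule: frag_induct_UNIV)
  case (of z)
  then show ?case by (cases z) (simp add: shift_pow_of rot_pow)
qed (simp_all add: shift_pow_simps)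

lemma shift_cyclic_action:
  "Factorial_Ring.prime p \<Longrightarrow> cyclic_action p (shift p :: ('x::countable) perm_lattice \<Rightarrow> _)"
  by (rule cyclic_action.intro) (simp_all add: shift_simps shift_pow_p)

lemma lookup_shift: "coeff_at (shift p v) (rot p n, x) = coeff_at v (n, x)"
proof (induction v rule: frag_induct_UNIV)
  case (of z)
  then show ?case using inj_rot[of p] by (cases z) (auto simp: shift_of inj_def)
qed (simp_all add: shift_simps lookup_minus)

lemma lookup_shift_pow:
  "coeff_at ((shift p ^^ k) v) ((rot p ^^ k) n, x) = coeff_at v (n, x)"
  by (induction k) (simp_all add: lookup_shift)

lemma acyclic_UNIV:
  assumes "Factorial_Ring.prime p"
  shows "cyclic_action.acyclic p (shift p) (UNIV :: ('x::countable) perm_lattice set)"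
proof -
  interpret cyclic_action p "shift p :: 'x perm_lattice \<Rightarrow> _"
    by (rule shift_cyclic_action[OF assms])
  define B where "B = {n. n = 0 \<or> p \<le> n} \<times> (UNIV :: 'x set)"
  \<comment> \<open>Modulo the image of \<open>t\<close>, all basis elements of a free orbit agree, and \<open>\<sigma>\<close> is injective on the span
    of the chosen representatives.\<close>
  have decomp: "\<exists>y w. v = t_op y + w \<and> Poly_Mapping.keys w \<subseteq> B" for v
  proof (induction v rule: frag_induct_UNIV)
    case zero
    show ?case by (intro exI[of _ 0]) (simp add: t_op_simps)
  next
    case (diff v v')
    then obtain y w y' w' where "v = t_op y + w" "Poly_Mapping.keys w \<subseteq> B"
        "v' = t_op y' + w'" "Poly_Mapping.keys w' \<subseteq> B" by blast
    moreover from this have "Poly_Mapping.keys (w - w') \<subseteq> B" by (blast dest: subsetD[OF keys_diff])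
    ultimately have "v - v' = t_op (y - y') + (w - w') \<and> Poly_Mapping.keys (w - w') \<subseteq> B"
      by (simp add: t_op_simps)
    then show ?case by blast
  next
    case (of z)
    obtain n x where z: "z = (n, x)" by (cases z)
    show ?case
    proof (cases "n < p")
      case False
      then show ?thesis by (intro exI[of _ 0] exI[of _ "frag_of z"]) (simp add: t_op_simps z B_def)
    next
      case True
      then have "\<exists>y. frag_of (n, x) = t_op y + frag_of (0, x)"
      proof (induction n)
        case 0
        show ?case by (intro exI[of _ 0]) (simp add: t_op_simps)
      next
        case (Suc n)
        then obtain y where y: "frag_of (n, x) = t_op y + frag_of (0, x)" by auto
        have "frag_of (Suc n, x) = t_op (frag_of (n, x)) + frag_of (n, x)"
          using Suc.prems by (simp add: t_op_def shift_of rot_def)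
        also have "\<dots> = t_op (frag_of (n, x) + y) + frag_of (0, x)"
          by (subst (2) y) (simp add: t_op_simps)
        finally show ?case by blast
      qed
      moreover have "Poly_Mapping.keys (frag_of (0 :: nat, x)) \<subseteq> B" by (simp add: B_def)
      ultimately show ?thesis unfolding z by blast
    qed
  qed
  show ?thesis
    unfolding acyclic_def
  proof (intro ballI impI)
    fix v :: "'x perm_lattice" assume v: "sigma v = 0"
    obtain y w where yw: "v = t_op y + w" "Poly_Mapping.keys w \<subseteq> B" using decomp by blast
    have nw: "sigma w = 0" using v by (simp add: yw sigma_simps sigma_t_op)
    have "coeff_at w (n, x) = 0" for n x
    proof -
      consider "n = 0" | "p \<le> n" | "(n, x) \<notin> B" by (auto simp: B_def)
      then show ?thesis
      proof cases
        case 1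
        have "coeff_at ((shift p ^^ k) w) (0, x) = (if k = 0 then coeff_at w (0, x) else 0)"
          if "k < p" for k
        proof (cases "k = 0")
          case False
          then have "(rot p ^^ k) (p - k) = 0" using that by (simp add: rot_pow)
          then have "coeff_at ((shift p ^^ k) w) (0, x) = coeff_at w (p - k, x)"
            using lookup_shift_pow[of k p w "p - k" x] by simp
          also have "\<dots> = 0" using yw(2) False that
            by (auto simp: B_def simp flip: not_in_keys_iff_lookup_eq_zero)
          finally show ?thesis using False by simp
        qed simp
        then have "coeff_at (sigma w) (0, x) = coeff_at w (0, x)"
          using p_pos by (simp add: sigma_def lookup_sum)
        then show ?thesis using 1 nw by simp
      next
        case 2
        then have "coeff_at ((shift p ^^ k) w) (n, x) = coeff_at w (n, x)" for k
          using lookup_shift_pow[of k p w n x] by (simp add: rot_pow)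
        then have "coeff_at (sigma w) (n, x) = int p * coeff_at w (n, x)"
          by (simp add: sigma_def lookup_sum)
        then show ?thesis using p_pos nw by simp
      next
        case 3
        then show ?thesis using yw(2) by (auto simp flip: not_in_keys_iff_lookup_eq_zero)
      qed
    qed
    then have "w = 0" by (intro poly_mapping_eqI) auto
    then show "\<exists>y\<in>UNIV. t_op y = v" using yw by auto
  qed
qed

lemma frag_extend_shift:
  assumes "\<And>n x. f (rot p n, x) = shift p (f (n, x))"
  shows "frag_extend f (shift p v) = shift p (frag_extend f v)"
proof (induction v rule: frag_induct_UNIV)
  case (of z)
  then show ?case by (cases z) (simp add: shift_of assms)
qed (simp_all add: shift_simps frag_extend_diff)

text \<open>
  If the second component of the index is a pair \<open>(l, x)\<close>, then the lattice is a direct sum of copies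
  indexed by \<open>l\<close>, with \<open>into l\<close> and the map following it as coordinate injections and projections.
\<close>
definition into :: "'l \<Rightarrow> 'x perm_lattice \<Rightarrow> ('l \<times> 'x) perm_lattice" where
  "into l = frag_extend (\<lambda>(n, x). frag_of (n, l, x))"

definition coord :: "'l \<Rightarrow> ('l \<times> 'x) perm_lattice \<Rightarrow> 'x perm_lattice" where
  "coord l = frag_extend (\<lambda>(n, m, x). if m = l then frag_of (n, x) else 0)"

lemma into_of: "into l (frag_of (n, x)) = frag_of (n, l, x)"
  and coord_of: "coord l (frag_of (n, m, x)) = (if m = l then frag_of (n, x) else 0)"
  by (simp_all add: into_def coord_def)

lemma into_additive: "additive_on UNIV (into l)" and coord_additive: "additive_on UNIV (coord l)"
  by (simp_all add: into_def coord_def frag_extend_additive)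

lemmas into_simps = additive_UNIV_D[OF into_additive]
lemmas coord_simps = additive_UNIV_D[OF coord_additive]

lemma into_shift: "into l (shift p v) = shift p (into l v)"
  unfolding into_def by (rule frag_extend_shift) (simp add: shift_of)

lemma coord_shift: "coord l (shift p v) = shift p (coord l v)"
  unfolding coord_def by (rule frag_extend_shift) (auto simp: shift_of shift_simps split: prod.split)

lemma coord_into: "coord l (into m v) = (if m = l then v else 0)"
proof (induction v rule: frag_induct_UNIV)
  case (of z)
  then show ?case by (cases z) (simp add: into_of coord_of)
qed (auto simp: into_simps coord_simps)

lemma frag_induct_into [case_names zero into diff]:
  assumes "P 0" "\<And>l x. P (into l x)" "\<And>x y. P x \<Longrightarrow> P y \<Longrightarrow> P (x - y)"
  shows "P v"
proof (induction v rule: frag_induct_UNIV)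
  case (of z)
  obtain n l x where "z = (n, l, x)" by (cases z)
  then show ?case using assms(2)[of l "frag_of (n, x)"] by (simp add: into_of)
qed (use assms in auto)

lemma frag_bool_decomp: "v = into True (coord True v) + into False (coord False v)"
proof (induction v rule: frag_induct_into)
  case (into l x)
  then show ?case by (cases l) (simp_all add: coord_into into_simps)
next
  case (diff x y)
  have "into True (coord True (x - y)) + into False (coord False (x - y))
      = (into True (coord True x) + into False (coord False x)) - (into True (coord True y) + into False (coord False y))"
    by (simp add: into_simps coord_simps)
  with diff show ?case by simp
qed (simp_all add: into_simps coord_simps)

text \<open>
  Let \<open>\<pi>\<close> be a split surjection from \<open>U\<close> to \<open>E\<close>, and let \<open>V\<close> be the direct sum of copies of \<open>U\<close>
  indexed by the natural numbers. The map \<open>F\<close> is an isomorphism from \<open>V\<close> to \<open>E \<oplus> V\<close>, where the latter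
  is the set of those \<open>w \<in> V\<close> whose coordinate at 0 lies in \<open>E\<close>.
\<close>
lemma swindle:
  fixes E :: "('x::countable) perm_lattice set"
    and \<pi> s :: "'x perm_lattice \<Rightarrow> 'x perm_lattice"
  assumes E: "add_subgroup E"
    and \<pi>: "additive_on UNIV \<pi>" "\<And>v. \<pi> (shift p v) = shift p (\<pi> v)" "\<And>v. \<pi> v \<in> E"
    and s: "additive_on E s" "\<And>x. x \<in> E \<Longrightarrow> s (shift p x) = shift p (s x)"
      "\<And>x. x \<in> E \<Longrightarrow> \<pi> (s x) = x"
  obtains F :: "(nat \<times> 'x) perm_lattice \<Rightarrow> (nat \<times> 'x) perm_lattice" where
    "additive_on UNIV F" "\<And>v. F (shift p v) = shift p (F v)" "inj F" "range F = {w. coord 0 w \<in> E}"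
proof -
  note pi_simps = additive_UNIV_D[OF \<pi>(1)]
  define e where "e v = s (\<pi> v)" for v
  have e_add: "additive_on UNIV e" using s(1) \<pi>(1,3) by (simp add: additive_on_def e_def)
  note e_simps = additive_UNIV_D[OF e_add]
  have e_shift: "e (shift p v) = shift p (e v)" for v by (simp add: e_def \<pi> s)
  have ee: "e (e v) = e v" and \<pi>e: "\<pi> (e v) = \<pi> v" for v by (simp_all add: e_def \<pi> s)
  \<comment> \<open>With the idempotent \<open>e = s \<circ> \<pi>\<close>, whose image is a copy of \<open>E\<close>, the map \<open>F\<close> shifts the component
    \<open>1 - e\<close> of each copy of \<open>U\<close> to the next copy and keeps the component \<open>e\<close> in place, except that in the
    copy at 0 the component \<open>e\<close> goes to \<open>E\<close> itself. \<open>H\<close> below is the inverse.\<close>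
  define F0 where "F0 l v = (case l of 0 \<Rightarrow> into 0 (\<pi> v) + into 1 (v - e v)
      | Suc k \<Rightarrow> into (Suc k) (e v) + into (Suc (Suc k)) (v - e v))" for l v
  define G0 where "G0 l v = (case l of 0 \<Rightarrow> 0 | Suc k \<Rightarrow> into k (v - e v) + into (Suc k) (e v))" for l v
  define F where "F = frag_extend (\<lambda>(n, l, x). F0 l (frag_of (n, x)))"
  define G where "G = frag_extend (\<lambda>(n, l, x). G0 l (frag_of (n, x)))"
  have F_add: "additive_on UNIV F" and G_add: "additive_on UNIV G"
    by (simp_all add: F_def G_def frag_extend_additive)
  note F_simps = additive_UNIV_D[OF F_add] and G_simps = additive_UNIV_D[OF G_add]
  have F0_diff: "F0 l (v - w) = F0 l v - F0 l w" and G0_diff: "G0 l (v - w) = G0 l v - G0 l w"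
    and F00: "F0 l 0 = 0" and G00: "G0 l 0 = 0" for l v w
    by (simp_all add: F0_def G0_def into_simps e_simps pi_simps split: nat.split)
  have F_into: "F (into l v) = F0 l v" and G_into: "G (into l v) = G0 l v" for l v
  proof -
    show "F (into l v) = F0 l v"
    proof (induction v rule: frag_induct_UNIV)
      case (of z) show ?case by (cases z) (simp add: F_def into_of)
    qed (simp_all add: into_simps F_simps F0_diff F00)
    show "G (into l v) = G0 l v"
    proof (induction v rule: frag_induct_UNIV)
      case (of z) show ?case by (cases z) (simp add: G_def into_of)
    qed (simp_all add: into_simps G_simps G0_diff G00)
  qed
  have F_shift: "F (shift p v) = shift p (F v)" for v
  proof (induction v rule: frag_induct_into)
    case (into l x)
    then show ?case
      by (simp add: F_into F0_def e_shift \<pi>(2) shift_simps flip: into_shift split: nat.split)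
  qed (simp_all add: F_simps shift_simps)
  have coord_F: "coord 0 (F v) = \<pi> (coord 0 v)" for v
  proof (induction v rule: frag_induct_into)
    case (into l x)
    then show ?case
      by (simp add: F_into F0_def coord_into coord_simps pi_simps split: nat.split)
  qed (simp_all add: F_simps coord_simps pi_simps)
  define H where "H w = into 0 (s (coord 0 w)) + G w" for w
  note s_simps = additive_onD[OF E s(1)]
  have HF: "H (F v) = v" for v
  proof (induction v rule: frag_induct_into)
    case zero
    show ?case by (simp add: H_def F_simps G_simps coord_simps s_simps into_simps)
  next
    case (into l x)
    show ?case
    proof (cases l)
      case 0
      then show ?thesis
        by (simp add: H_def coord_F coord_into F_into F0_def G_simps G_into G0_def e_simps ee into_simps)
           (simp add: e_def coord_simps coord_into)
    next
      case (Suc k)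
      then show ?thesis
        by (simp add: H_def coord_F coord_into F_into F0_def G_simps G_into G0_def e_simps pi_simps
            s_simps ee into_simps coord_simps)
    qed
  next
    case (diff x y)
    have "s (\<pi> (coord 0 x) - \<pi> (coord 0 y)) = s (\<pi> (coord 0 x)) - s (\<pi> (coord 0 y))"
      by (intro s_simps \<pi>(3))
    then have "H (F (x - y)) = H (F x) - H (F y)"
      by (simp add: H_def coord_F F_simps coord_simps pi_simps G_simps into_simps)
    with diff show ?case by simp
  qed
  have FG: "F (G w) = w - into 0 (coord 0 w)" for w
  proof (induction w rule: frag_induct_into)
    case (into l x)
    then show ?case
      by (cases l; cases "l - 1")
         (simp_all add: G_into G0_def F_simps F_into F0_def e_simps pi_simps ee \<pi>e into_simps coord_into)
  qed (simp_all add: F_simps G_simps coord_simps into_simps)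
  have FH: "F (H w) = w" if "coord 0 w \<in> E" for w
    using that by (simp add: H_def F_simps FG F_into F0_def s e_def into_simps)
  show thesis
  proof
    show "inj F" using HF by (metis injI)
    show "range F = {w. coord 0 w \<in> E}"
      using FH coord_F \<pi>(3) by (auto simp: image_iff) metis
  qed (use F_add F_shift in auto)
qed


lemma countable_lattice: "countable (UNIV :: ('x::countable) perm_lattice set)"
proof -
  have "infinite (UNIV :: (nat \<times> 'x) set)"
    using finite_cartesian_productD1[of "UNIV :: nat set" "UNIV :: 'x set"] by auto
  from eqpoll_free_Abelian_group_infinite[OF this]
  have "(UNIV :: 'x perm_lattice set) \<approx> (UNIV :: (nat \<times> 'x) set)"
    by (simp add: free_Abelian_group_def)
  then show ?thesis
    by (metis bij_betw_imp_inj_on countableI_type countable_image_inj_on eqpoll_def eqpoll_sym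
        bij_betw_imp_surj_on countable_image)
qed

text \<open>
  Every countable abelian group with an automorphism of order dividing \<open>p\<close> is an equivariant image of
  the permutation lattice on \<open>nat \<times> nat\<close>, in such a way that the invariants lift. The free orbits
  are used to enumerate the elements, and the fixed basis elements to enumerate the invariants.
\<close>
lemma cyclic_cover:
  fixes G (structure)
  assumes G: "comm_group G" and countable: "countable (carrier G)" and p: "0 < p"
    and act: "act \<in> hom G G" "\<forall>x\<in>carrier G. (act ^^ p) x = x"
  shows "\<exists>\<pi> \<in> hom (free_Abelian_group (UNIV :: (nat \<times> nat) set)) G.
    (\<forall>v. \<pi> (shift p v) = act (\<pi> v)) \<and> range \<pi> = carrier G \<and>
    (\<forall>x \<in> carrier G. act x = x \<longrightarrow> (\<exists>v. shift p v = v \<and> \<pi> v = x))"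
proof -
  interpret comm_group G by fact
  let ?F = "free_Abelian_group (UNIV :: (nat \<times> nat) set)"
  define B where "B = {x \<in> carrier G. act x = x}"
  have one: "\<one> \<in> carrier G" "act \<one> = \<one>" using hom_one[OF act(1)] is_group by auto
  have B: "countable B" "B \<noteq> {}" "B \<subseteq> carrier G"
    using countable one by (auto simp: B_def intro: countable_subset)
  define f where "f = (\<lambda>(n, j). if n < p then (act ^^ n) (from_nat_into (carrier G) j) else from_nat_into B j)"
  have gen: "from_nat_into (carrier G) j \<in> carrier G" "from_nat_into B j \<in> B" for j
    using from_nat_into[of "carrier G" j] from_nat_into[OF B(2)] one by auto
  have act_closed: "act x \<in> carrier G" if "x \<in> carrier G" for x using act(1) that by (auto simp: hom_def)
  have pow_closed: "(act ^^ n) x \<in> carrier G" if "x \<in> carrier G" for x n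
    by (induction n) (auto simp: act_closed that)
  have f: "f ` UNIV \<subseteq> carrier G"
    using gen pow_closed subsetD[OF B(3) gen(2)] by (auto simp: f_def)
  obtain \<pi> where \<pi>: "\<pi> \<in> hom ?F G" "\<And>z. \<pi> (frag_of z) = f z"
    using free_Abelian_group_universal[OF f] by auto
  have \<pi>_closed: "\<pi> v \<in> carrier G" for v using \<pi>(1) by (auto simp: hom_def free_Abelian_group_def)
  interpret P: group_hom ?F G \<pi>
    using \<pi>(1) by (simp add: group_hom_def group_hom_axioms_def is_group)
  interpret A: group_hom G G act
    using act(1) by (simp add: group_hom_def group_hom_axioms_def is_group)
  have \<pi>_diff: "\<pi> (v - w) = \<pi> v \<otimes> inv (\<pi> w)" for v w
    using P.hom_mult[of v "- w"] P.hom_inv[of w] by simp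
  have \<pi>0: "\<pi> 0 = \<one>" using P.hom_one by simp
  show ?thesis
  proof (intro bexI conjI allI ballI impI)
    show "\<pi> \<in> hom ?F G" by fact
    show "\<pi> (shift p v) = act (\<pi> v)" for v
    proof (induction v rule: frag_induct_UNIV)
      case zero
      then show ?case by (simp add: shift_simps \<pi>0 one)
    next
      case (diff x y)
      then show ?case by (simp add: shift_simps \<pi>_diff \<pi>_closed)
    next
      case (of z)
      obtain n j where z: "z = (n, j)" by (cases z)
      show ?case
      proof (cases "n < p")
        case True
        have "f (rot p n, j) = act (f (n, j))"
        proof (cases "Suc n = p")
          case True
          then have "act ((act ^^ n) (from_nat_into (carrier G) j)) = from_nat_into (carrier G) j"
            using act(2) gen(1)[of j] by auto
          then show ?thesis using True p by (simp add: f_def rot_def)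
        qed (use True in \<open>simp add: f_def rot_def\<close>)
        then show ?thesis by (simp add: z shift_of \<pi>)
      next
        case False
        then show ?thesis using gen(2)[of j] by (simp add: z shift_of \<pi> rot_def f_def B_def)
      qed
    qed
    show "range \<pi> = carrier G"
    proof
      show "carrier G \<subseteq> range \<pi>"
      proof
        fix x assume "x \<in> carrier G"
        then obtain j where "from_nat_into (carrier G) j = x"
          using from_nat_into_surj[OF countable] by blast
        then have "\<pi> (frag_of (0, j)) = x" using p by (simp add: \<pi> f_def)
        then show "x \<in> range \<pi>" by blast
      qed
    qed (use \<pi>_closed in auto)
    fix x assume "x \<in> carrier G" "act x = x"
    then have "x \<in> B" by (simp add: B_def)
    then obtain j where "from_nat_into B j = x" using from_nat_into_surj[OF B(1)] by blast
    then have "\<pi> (frag_of (p, j)) = x" by (simp add: \<pi> f_def)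
    moreover have "shift p (frag_of (p, j)) = frag_of (p, j)" by (simp add: shift_of rot_def)
    ultimately show "\<exists>v. shift p v = v \<and> \<pi> v = x" by blast
  qed
qed

text \<open>
  The assumption \<open>closed\<close> is the condition \<open>tG \<inter> H = tH\<close>, in multiplicative notation. It is trivially
  satisfied if \<open>H\<close> is the trivial subgroup, and then the preimage is the kernel of \<open>\<pi>\<close>.
\<close>
lemma acyclic_preimage:
  fixes G (structure) and \<pi> :: "('x::countable) perm_lattice \<Rightarrow> 'g"
  assumes p: "Factorial_Ring.prime p" and G: "comm_group G" and act: "act \<in> hom G G"
    and \<pi>: "\<pi> \<in> hom (free_Abelian_group UNIV) G" "\<And>v. \<pi> (shift p v) = act (\<pi> v)"
      "\<And>x. x \<in> carrier G \<Longrightarrow> act x = x \<Longrightarrow> \<exists>v. shift p v = v \<and> \<pi> v = x"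
    and H: "subgroup H G" "\<And>x. x \<in> H \<Longrightarrow> act x \<in> H"
    and closed: "\<And>x. x \<in> carrier G \<Longrightarrow> act x \<otimes> inv x \<in> H \<Longrightarrow> \<exists>y\<in>H. act y \<otimes> inv y = act x \<otimes> inv x"
  shows "cyclic_action.submod (shift p) {v. \<pi> v \<in> H}"
    and "cyclic_action.acyclic p (shift p) {v. \<pi> v \<in> H}"
proof -
  interpret comm_group G by fact
  interpret cyclic_action p "shift p :: 'x perm_lattice \<Rightarrow> _" by (rule shift_cyclic_action[OF p])
  let ?F = "free_Abelian_group (UNIV :: (nat \<times> 'x) set)"
  interpret P: group_hom ?F G \<pi>
    using \<pi>(1) by (simp add: group_hom_def group_hom_axioms_def is_group)
  interpret A: group_hom G G act
    using act(1) by (simp add: group_hom_def group_hom_axioms_def is_group)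
  have \<pi>_closed: "\<pi> v \<in> carrier G" for v using P.hom_closed[of v] by simp
  have \<pi>_diff: "\<pi> (v - w) = \<pi> v \<otimes> inv (\<pi> w)" for v w
    using P.hom_mult[of v "- w"] P.hom_inv[of w] by simp
  have \<pi>0: "\<pi> 0 = \<one>" using P.hom_one by simp
  have ac4: "c \<otimes> d \<otimes> y \<otimes> k = (y \<otimes> d) \<otimes> (c \<otimes> k)"
    if "c \<in> carrier G" "d \<in> carrier G" "y \<in> carrier G" "k \<in> carrier G" for c d y k
    using that by (simp add: m_ac)
  show "submod {v. \<pi> v \<in> H}"
    unfolding submod_def add_subgroup_def
    using subgroup.one_closed[OF H(1)] subgroup.m_closed[OF H(1)] subgroup.m_inv_closed[OF H(1)] H(2)
    by (simp add: \<pi>0 \<pi>_diff \<pi>(2))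
  show "acyclic {v. \<pi> v \<in> H}"
    unfolding acyclic_def
  proof (intro ballI impI)
    fix v assume v: "v \<in> {v. \<pi> v \<in> H}" "sigma v = 0"
    obtain y where y: "t_op y = v" using acyclic_UNIV[OF p, where ?'x = 'x] v(2) by (auto simp: acyclic_def)
    have "act (\<pi> y) \<otimes> inv (\<pi> y) \<in> H" using v(1) by (simp add: t_op_def \<pi>_diff \<pi>(2) flip: y)
    then obtain h where h: "h \<in> H" "act h \<otimes> inv h = act (\<pi> y) \<otimes> inv (\<pi> y)"
      using closed[OF \<pi>_closed] by blast
    have hG: "h \<in> carrier G" using h(1) subgroup.mem_carrier[OF H(1)] by blast
    have "act (\<pi> y \<otimes> inv h) = act (\<pi> y) \<otimes> inv (act h)"
      by (simp add: \<pi>_closed hG)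
    also have "act (\<pi> y) = act h \<otimes> inv h \<otimes> \<pi> y"
      unfolding h(2) using \<pi>_closed[of y] by (simp add: m_assoc)
    also have "act h \<otimes> inv h \<otimes> \<pi> y \<otimes> inv (act h) = \<pi> y \<otimes> inv h"
      using ac4[of "act h" "inv h" "\<pi> y" "inv (act h)"] \<pi>_closed[of y] hG by simp
    finally obtain v' where v': "shift p v' = v'" "\<pi> v' = \<pi> y \<otimes> inv h"
      using \<pi>(3)[of "\<pi> y \<otimes> inv h"] \<pi>_closed hG by auto
    have "\<pi> (y - v') = h"
      using \<pi>_closed[of y] hG inv_solve_right'[of "\<pi> y" h "\<pi> y \<otimes> inv h"]
      by (simp add: \<pi>_diff v'(2) inv_mult m_assoc[symmetric])
    moreover have "t_op (y - v') = v" using v'(1) y by (simp add: t_op_simps) (simp add: t_op_def)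
    ultimately show "\<exists>y\<in>{v. \<pi> v \<in> H}. t_op y = v" using h(1) by blast
  qed
qed

section \<open>Resolution of a pair of groups with cyclic action\<close>

text \<open>
  For an acyclic submodule \<open>E\<close> of the permutation lattice \<open>U\<close>, the lattices \<open>V\<close> and \<open>E \<oplus> V\<close> are
  isomorphic.
\<close>
lemma acyclic_swindle:
  fixes E :: "nat perm_lattice set"
  assumes p: "Factorial_Ring.prime p"
    and E: "cyclic_action.submod (shift p) E" "cyclic_action.acyclic p (shift p) E"
  obtains F :: "(nat \<times> nat) perm_lattice \<Rightarrow> (nat \<times> nat) perm_lattice" where
    "additive_on UNIV F" "\<And>v. F (shift p v) = shift p (F v)" "inj F" "range F = {w. coord 0 w \<in> E}"
proof -
  interpret cyclic_action p "shift p :: nat perm_lattice \<Rightarrow> _" by (rule shift_cyclic_action[OF p])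
  note E0 = add_subgroupD[OF submod_subgroup[OF E(1)]]
  define G :: "nat perm_lattice monoid" where "G = \<lparr>carrier = E, monoid.mult = (+), one = 0\<rparr>"
  have G_simps [simp]: "carrier G = E" "x \<otimes>\<^bsub>G\<^esub> y = x + y" "\<one>\<^bsub>G\<^esub> = 0" for x y
    by (simp_all add: G_def)
  have G: "comm_group G"
  proof (rule comm_groupI)
    fix x assume "x \<in> carrier G"
    then show "\<exists>y\<in>carrier G. y \<otimes>\<^bsub>G\<^esub> x = \<one>\<^bsub>G\<^esub>"
      using E0(3) by (auto intro!: bexI[of _ "- x"])
  qed (use E0 in \<open>auto simp: add.commute add.left_commute add.assoc\<close>)
  have cnt: "countable (carrier G)" using countable_subset[OF subset_UNIV countable_lattice, of E] by simp
  have act: "shift p \<in> hom G G" by (auto simp: hom_def shift_simps submod_a[OF E(1)])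
  obtain \<pi> where \<pi>: "\<pi> \<in> hom (free_Abelian_group (UNIV :: (nat \<times> nat) set)) G"
      "\<And>v. \<pi> (shift p v) = shift p (\<pi> v)" "range \<pi> = E"
      "\<And>x. x \<in> E \<Longrightarrow> shift p x = x \<Longrightarrow> \<exists>v. shift p v = v \<and> \<pi> v = x"
    using cyclic_cover[OF G cnt p_pos act] unfolding G_simps using shift_pow_p by blast
  have \<pi>_add: "additive_on UNIV \<pi>"
    using hom_mult[OF \<pi>(1)] by (simp add: additive_on_def)
  note pi_simps = additive_UNIV_D[OF \<pi>_add]
  have \<pi>E: "\<pi> v \<in> E" for v using \<pi>(3) by auto
  define \<rho> where "\<rho> = {(\<pi> u, u) | u. True}"
  have \<rho>: "add_subgroup \<rho>"
    by (auto simp: add_subgroup_def \<rho>_def pi_simps zero_prod_def)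
  obtain s where "additive_on E s" "\<And>x. x \<in> E \<Longrightarrow> s (shift p x) = shift p (s x)"
      "\<And>x. x \<in> E \<Longrightarrow> (x, s x) \<in> \<rho>"
  proof (rule equivariant_selection[OF E \<rho>])
    show "\<exists>y. (x, y) \<in> \<rho>" if "x \<in> E" for x
      using \<pi>(3) that by (auto simp: \<rho>_def image_iff set_eq_iff)
    show "\<exists>y. shift p y = y \<and> (x, y) \<in> \<rho>" if "x \<in> E" "shift p x = x" for x
      using \<pi>(4)[of x] that by (auto simp: \<rho>_def)
  qed (auto simp: \<rho>_def \<pi>(2))
  moreover from this have "\<pi> (s x) = x" if "x \<in> E" for x using that by (auto simp: \<rho>_def)
  ultimately show thesis
    using that by (auto intro: swindle[OF submod_subgroup[OF E(1)] \<pi>_add \<pi>(2) \<pi>E, of s])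
qed

text \<open>
  The commutative diagram at the level of lattices, with \<open>N\<^sub>0 = P\<^sub>0 = V\<close> and \<open>N = P = V \<oplus> V\<close>. Both
  columns are \<open>into True\<close>, the inclusion of the first summand. The group \<open>M\<close> is \<open>G\<close>, written
  multiplicatively, with generator acting by \<open>act\<close>, and \<open>M\<^sub>0\<close> is \<open>H\<close>.
\<close>
lemma relative_resolution:
  fixes G (structure)
  assumes p: "Factorial_Ring.prime p" and G: "comm_group G" and countable: "countable (carrier G)"
    and act: "act \<in> hom G G" "\<forall>x\<in>carrier G. (act ^^ p) x = x"
    and H: "subgroup H G" "\<And>x. x \<in> H \<Longrightarrow> act x \<in> H"
    and closed: "\<And>x. x \<in> carrier G \<Longrightarrow> act x \<otimes> inv x \<in> H \<Longrightarrow> \<exists>y\<in>H. act y \<otimes> inv y = act x \<otimes> inv x"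
  obtains f\<^sub>0 :: "(nat \<times> nat) perm_lattice \<Rightarrow> (nat \<times> nat) perm_lattice" and g\<^sub>0
    and f :: "(bool \<times> nat \<times> nat) perm_lattice \<Rightarrow> (bool \<times> nat \<times> nat) perm_lattice" and g
  where "additive_on UNIV f\<^sub>0" "\<And>v. f\<^sub>0 (shift p v) = shift p (f\<^sub>0 v)" "inj f\<^sub>0"
    "g\<^sub>0 \<in> hom (free_Abelian_group UNIV) G" "\<And>v. g\<^sub>0 (shift p v) = act (g\<^sub>0 v)" "range g\<^sub>0 = H"
    "range f\<^sub>0 = {v. g\<^sub>0 v = \<one>}"
    "additive_on UNIV f" "\<And>v. f (shift p v) = shift p (f v)" "inj f"
    "g \<in> hom (free_Abelian_group UNIV) G" "\<And>v. g (shift p v) = act (g v)" "range g = carrier G"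
    "range f = {v. g v = \<one>}"
    "\<And>v. f (into True v) = into True (f\<^sub>0 v)" "\<And>v. g (into True v) = g\<^sub>0 v"
proof -
  interpret comm_group G by fact
  interpret cyclic_action p "shift p :: nat perm_lattice \<Rightarrow> _" by (rule shift_cyclic_action[OF p])
  interpret A: group_hom G G act
    using act(1) by (simp add: group_hom_def group_hom_axioms_def is_group)
  let ?H = "G\<lparr>carrier := H\<rparr>"
  let ?F = "free_Abelian_group (UNIV :: (nat \<times> nat) set)"
  have HG: "x \<in> carrier G" if "x \<in> H" for x using subgroup.mem_carrier[OF H(1) that] .
  have gH: "comm_group ?H" 
    by (rule group.group_comm_groupI[OF subgroup.subgroup_is_group[OF H(1) is_group]])
       (simp add: m_comm HG)
  have cH: "countable (carrier ?H)" using countable_subset[OF subgroup.subset[OF H(1)] countable] by simp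
  have aH: "act \<in> hom ?H ?H" using H(2) HG act(1) by (auto simp: hom_def)
  obtain \<pi>\<^sub>0 where \<pi>0: "\<pi>\<^sub>0 \<in> hom ?F ?H" "\<And>v. \<pi>\<^sub>0 (shift p v) = act (\<pi>\<^sub>0 v)" "range \<pi>\<^sub>0 = carrier ?H"
      "\<And>x. x \<in> carrier ?H \<Longrightarrow> act x = x \<Longrightarrow> \<exists>v. shift p v = v \<and> \<pi>\<^sub>0 v = x"
  proof -
    have "\<forall>x\<in>carrier ?H. (act ^^ p) x = x" using act(2) HG by simp
    from cyclic_cover[OF gH cH p_pos aH this] show thesis using that by blast
  qed
  obtain \<pi>\<^sub>1 where \<pi>1: "\<pi>\<^sub>1 \<in> hom ?F G" "\<And>v. \<pi>\<^sub>1 (shift p v) = act (\<pi>\<^sub>1 v)" "range \<pi>\<^sub>1 = carrier G"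
      "\<And>x. x \<in> carrier G \<Longrightarrow> act x = x \<Longrightarrow> \<exists>v. shift p v = v \<and> \<pi>\<^sub>1 v = x"
    using cyclic_cover[OF G countable p_pos act] by blast
  interpret P0: group_hom ?F ?H \<pi>\<^sub>0
    using \<pi>0(1) gH by (simp add: group_hom_def group_hom_axioms_def comm_group_def)
  interpret P1: group_hom ?F G \<pi>\<^sub>1
    using \<pi>1(1) by (simp add: group_hom_def group_hom_axioms_def is_group)
  have \<pi>0H: "\<pi>\<^sub>0 v \<in> H" for v using \<pi>0(3) by auto
  have \<pi>0G: "\<pi>\<^sub>0 v \<in> carrier G" and \<pi>1G: "\<pi>\<^sub>1 v \<in> carrier G" for v
    using HG[OF \<pi>0H] P1.hom_closed[of v] by auto
  have \<pi>0_add: "\<pi>\<^sub>0 (v + w) = \<pi>\<^sub>0 v \<otimes> \<pi>\<^sub>0 w" and \<pi>1_add: "\<pi>\<^sub>1 (v + w) = \<pi>\<^sub>1 v \<otimes> \<pi>\<^sub>1 w" for v w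
    using P0.hom_mult[of v w] P1.hom_mult[of v w] by simp_all
  have \<pi>0_zero: "\<pi>\<^sub>0 0 = \<one>" and \<pi>1_zero: "\<pi>\<^sub>1 0 = \<one>" using P0.hom_one P1.hom_one by simp_all
  have \<pi>0_minus: "\<pi>\<^sub>0 (- v) = inv (\<pi>\<^sub>0 v)" and \<pi>1_minus: "\<pi>\<^sub>1 (- v) = inv (\<pi>\<^sub>1 v)" for v
    using \<pi>0_add[of v "- v"] \<pi>1_add[of v "- v"] inv_unique'[OF \<pi>0G \<pi>0G] inv_unique'[OF \<pi>1G \<pi>1G]
      m_comm[OF \<pi>0G \<pi>0G] m_comm[OF \<pi>1G \<pi>1G] by (simp_all add: \<pi>0_zero \<pi>1_zero)
  have \<pi>0_diff: "\<pi>\<^sub>0 (v - w) = \<pi>\<^sub>0 v \<otimes> inv (\<pi>\<^sub>0 w)" and \<pi>1_diff: "\<pi>\<^sub>1 (v - w) = \<pi>\<^sub>1 v \<otimes> inv (\<pi>\<^sub>1 w)" for v w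
    using \<pi>0_add[of v "- w"] \<pi>1_add[of v "- w"] by (simp_all add: \<pi>0_minus \<pi>1_minus)
  define E where "E = {u. \<pi>\<^sub>1 u \<in> H}"
  have E: "submod E" "acyclic E"
    unfolding E_def by (rule acyclic_preimage[OF p G act(1) \<pi>1(1,2,4) H closed]; assumption)+
  define K where "K = {u. \<pi>\<^sub>0 u \<in> {\<one>}}"
  have triv: "subgroup {\<one>} ?H"
    using group.triv_subgroup[OF comm_group.axioms(2)[OF gH]] by simp
  have triv_act: "act x \<in> {\<one>}" if "x \<in> {\<one>}" for x using that by simp
  have triv_closed: "\<exists>y\<in>{\<one>}. act y \<otimes>\<^bsub>?H\<^esub> inv\<^bsub>?H\<^esub> y = act x \<otimes>\<^bsub>?H\<^esub> inv\<^bsub>?H\<^esub> x"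
    if "act x \<otimes>\<^bsub>?H\<^esub> inv\<^bsub>?H\<^esub> x \<in> {\<one>}" for x
    using that monoid.inv_one[OF group.is_monoid[OF comm_group.axioms(2)[OF gH]]] by simp
  have K: "submod K" "acyclic K"
    unfolding K_def
    by (rule acyclic_preimage[OF p gH aH \<pi>0(1,2,4) triv triv_act triv_closed]; assumption)+
  obtain F\<^sub>0 :: "(nat \<times> nat) perm_lattice \<Rightarrow> (nat \<times> nat) perm_lattice"
    where F0: "additive_on UNIV F\<^sub>0" "\<And>v. F\<^sub>0 (shift p v) = shift p (F\<^sub>0 v)" "inj F\<^sub>0"
      "range F\<^sub>0 = {w. coord 0 w \<in> K}"
    by (rule acyclic_swindle[OF p K]) blast
  obtain F\<^sub>1 :: "(nat \<times> nat) perm_lattice \<Rightarrow> (nat \<times> nat) perm_lattice"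
    where F1: "additive_on UNIV F\<^sub>1" "\<And>v. F\<^sub>1 (shift p v) = shift p (F\<^sub>1 v)" "inj F\<^sub>1"
      "range F\<^sub>1 = {w. coord 0 w \<in> E}"
    by (rule acyclic_swindle[OF p E]) blast
  have F1E: "coord 0 (F\<^sub>1 v) \<in> E" for v using F1(4) by blast
  have F0K: "coord 0 (F\<^sub>0 v) \<in> K" for v using F0(4) by blast
  \<comment> \<open>An equivariant lift \<open>c\<close> of \<open>\<pi>\<^sub>1 : E \<rightarrow> H\<close> through \<open>\<pi>\<^sub>0\<close> splits the kernel of \<open>U \<oplus> U \<rightarrow> G\<close>
    as the direct sum of \<open>K\<close> and the graph of \<open>- c\<close>.\<close>
  define \<rho> where "\<rho> = {(x, u). \<pi>\<^sub>0 u = \<pi>\<^sub>1 x}"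
  have \<rho>: "add_subgroup \<rho>"
    by (auto simp: add_subgroup_def \<rho>_def \<pi>0_zero \<pi>1_zero \<pi>0_diff \<pi>1_diff zero_prod_def)
  obtain c where c: "additive_on E c" "\<And>x. x \<in> E \<Longrightarrow> c (shift p x) = shift p (c x)"
      "\<And>x. x \<in> E \<Longrightarrow> (x, c x) \<in> \<rho>"
  proof (rule equivariant_selection[OF E \<rho>])
    show "\<exists>y. (x, y) \<in> \<rho>" if "x \<in> E" for x
    proof -
      have "\<pi>\<^sub>1 x \<in> range \<pi>\<^sub>0" using \<pi>0(3) that by (simp add: E_def)
      then show ?thesis by (auto simp: \<rho>_def)
    qed
    show "\<exists>y. shift p y = y \<and> (x, y) \<in> \<rho>" if "x \<in> E" "shift p x = x" for x
      using \<pi>0(4)[of "\<pi>\<^sub>1 x"] \<pi>1(2)[of x] that by (auto simp: \<rho>_def E_def)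
  qed (auto simp: \<rho>_def \<pi>0(2) \<pi>1(2))
  have \<pi>c: "\<pi>\<^sub>0 (c x) = \<pi>\<^sub>1 x" if "x \<in> E" for x using c(3)[OF that] by (simp add: \<rho>_def)
  note F0_simps = additive_UNIV_D[OF F0(1)] and F1_simps = additive_UNIV_D[OF F1(1)]
  have c_add: "c (coord 0 (F\<^sub>1 v) + coord 0 (F\<^sub>1 w)) = c (coord 0 (F\<^sub>1 v)) + c (coord 0 (F\<^sub>1 w))" for v w
    using c(1) F1E by (simp add: additive_on_def)
  have c0: "c 0 = 0" using additive_on_zero[OF submod_subgroup[OF E(1)] c(1)] .
  define g\<^sub>0 where "g\<^sub>0 v = \<pi>\<^sub>0 (coord 0 v)" for v :: "(nat \<times> nat) perm_lattice"
  define g where "g w = \<pi>\<^sub>0 (coord 0 (coord True w)) \<otimes> \<pi>\<^sub>1 (coord 0 (coord False w))"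
    for w :: "(bool \<times> nat \<times> nat) perm_lattice"
  define f where "f w = into True (F\<^sub>0 (coord True w) - into 0 (c (coord 0 (F\<^sub>1 (coord False w)))))
      + into False (F\<^sub>1 (coord False w))" for w
  have f_add: "additive_on UNIV f"
    by (simp add: additive_on_def f_def coord_simps into_simps F0_simps F1_simps c_add algebra_simps)
  have cptf: "coord True (f w) = F\<^sub>0 (coord True w) - into 0 (c (coord 0 (F\<^sub>1 (coord False w))))"
    "coord False (f w) = F\<^sub>1 (coord False w)" for w
    by (simp_all add: f_def coord_simps coord_into)
  have gf: "g (f w) = \<one>" for w
    using F0K[of "coord True w"] \<pi>1G
    by (simp add: g_def cptf coord_simps coord_into \<pi>0_diff \<pi>c F1E K_def)
  have surj_f: "w \<in> range f" if "g w = \<one>" for w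
  proof -
    define v :: "(nat \<times> nat) perm_lattice" where "v = coord False w"
    have "\<pi>\<^sub>1 (coord 0 v) = inv (\<pi>\<^sub>0 (coord 0 (coord True w)))"
      using that \<pi>0G \<pi>1G by (metis g_def inv_equality m_comm v_def)
    then have vE: "coord 0 v \<in> E" using subgroup.m_inv_closed[OF H(1) \<pi>0H] by (simp add: E_def)
    then have "v \<in> range F\<^sub>1" unfolding F1(4) by simp
    then obtain z1 where z1: "F\<^sub>1 z1 = v" by blast
    define u where "u = coord True w + into 0 (c (coord 0 v))"
    have "\<pi>\<^sub>0 (coord 0 u) = g w"
      by (simp add: u_def coord_simps coord_into \<pi>0_add \<pi>c[OF vE, unfolded v_def] g_def v_def)
    then have "u \<in> range F\<^sub>0" unfolding F0(4) by (simp add: K_def that)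
    then obtain z0 where z0: "F\<^sub>0 z0 = u" by blast
    have "f (into True z0 + into False z1) = into True (coord True w) + into False (coord False w)"
      by (simp add: f_def coord_simps coord_into z0 z1) (simp add: u_def v_def)
    then show ?thesis by (metis frag_bool_decomp rangeI)
  qed
  show thesis
  proof
    show "additive_on UNIV F\<^sub>0" "\<And>v. F\<^sub>0 (shift p v) = shift p (F\<^sub>0 v)" "inj F\<^sub>0" by fact+
    show "additive_on UNIV f" by fact
    show "g\<^sub>0 \<in> hom (free_Abelian_group UNIV) G"
      by (rule homI) (simp_all add: g\<^sub>0_def \<pi>0G coord_simps \<pi>0_add)
    show "g\<^sub>0 (shift p v) = act (g\<^sub>0 v)" for v by (simp add: g\<^sub>0_def coord_shift \<pi>0(2))
    show "range g\<^sub>0 = H"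
    proof
      show "H \<subseteq> range g\<^sub>0"
      proof
        fix x assume "x \<in> H"
        then obtain u where "\<pi>\<^sub>0 u = x" using \<pi>0(3) by auto
        then have "g\<^sub>0 (into 0 u) = x" by (simp add: g\<^sub>0_def coord_into)
        then show "x \<in> range g\<^sub>0" by blast
      qed
    qed (auto simp: g\<^sub>0_def \<pi>0H)
    show "range F\<^sub>0 = {v. g\<^sub>0 v = \<one>}" by (simp add: F0(4) g\<^sub>0_def K_def)
    show "f (shift p v) = shift p (f v)" for v
      by (simp add: f_def coord_shift F0(2) F1(2) c(2)[OF F1E] shift_simps flip: into_shift)
    show "inj f"
    proof (rule injI)
      fix v w assume eq: "f v = f w"
      have 1: "coord False v = coord False w"
        using arg_cong[OF eq, of "coord False"] injD[OF F1(3)] by (simp add: cptf)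
      have "coord True v = coord True w"
        using arg_cong[OF eq, of "coord True"] injD[OF F0(3)] by (simp add: cptf 1)
      then show "v = w" using 1 frag_bool_decomp by metis
    qed
    show "g \<in> hom (free_Abelian_group UNIV) G"
    proof (rule homI)
      fix v w :: "(bool \<times> nat \<times> nat) perm_lattice"
      show "g (v \<otimes>\<^bsub>free_Abelian_group UNIV\<^esub> w) = g v \<otimes> g w"
        using \<pi>0G \<pi>1G by (simp add: g_def coord_simps \<pi>0_add \<pi>1_add m_ac)
    qed (simp add: g_def \<pi>0G \<pi>1G)
    show "g (shift p v) = act (g v)" for v
      by (simp add: g_def coord_shift \<pi>0(2) \<pi>1(2) \<pi>0G \<pi>1G)
    show "range g = carrier G"
    proof
      show "carrier G \<subseteq> range g"
      proof
        fix x assume "x \<in> carrier G"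
        then obtain u where "\<pi>\<^sub>1 u = x" unfolding \<pi>1(3)[symmetric] by blast
        then have "g (into False (into 0 u)) = x"
          using \<pi>1G[of u] by (simp add: g_def coord_into coord_simps \<pi>0_zero)
        then show "x \<in> range g" by blast
      qed
    qed (auto simp: g_def \<pi>0G \<pi>1G)
    show "range f = {v. g v = \<one>}" using gf surj_f by auto
    show "f (into True v) = into True (F\<^sub>0 v)" for v
      by (simp add: f_def coord_into F1_simps coord_simps c0 into_simps)
    show "g (into True v) = g\<^sub>0 v" for v
      by (simp add: g_def g\<^sub>0_def coord_into coord_simps \<pi>1_zero \<pi>0G)
  qed
qed

section \<open>The integral group ring of a cyclic group\<close>

lemma ex1_implies_eq: "\<exists>!x. P x \<Longrightarrow> P a \<Longrightarrow> P b \<Longrightarrow> a = b"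
  by blast

lemma module_homsD:
  assumes "Module.module R A" "Module.module R B" "f \<in> module_homs R A B"
  shows module_hom_closed: "x \<in> carrier A \<Longrightarrow> f x \<in> carrier B"
    and module_hom_add: "x \<in> carrier A \<Longrightarrow> y \<in> carrier A \<Longrightarrow> f (x \<oplus>\<^bsub>A\<^esub> y) = f x \<oplus>\<^bsub>B\<^esub> f y"
    and module_hom_smult: "r \<in> carrier R \<Longrightarrow> x \<in> carrier A \<Longrightarrow> f (r \<odot>\<^bsub>A\<^esub> x) = r \<odot>\<^bsub>B\<^esub> f x"
    and module_hom_zero: "f \<zero>\<^bsub>A\<^esub> = \<zero>\<^bsub>B\<^esub>"
    and module_hom_minus: "x \<in> carrier A \<Longrightarrow> y \<in> carrier A \<Longrightarrow> f (x \<ominus>\<^bsub>A\<^esub> y) = f x \<ominus>\<^bsub>B\<^esub> f y"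
proof -
  interpret A: module R A by fact
  interpret B: module R B by fact
  interpret H: abelian_group_hom A B f
  proof (rule abelian_group_homI)
    show "abelian_group A" "abelian_group B" by unfold_locales
    show "group_hom (add_monoid A) (add_monoid B) f"
      using assms(3) by (simp add: module_homs_def group_hom_def group_hom_axioms_def A.a_group B.a_group)
  qed
  show "x \<in> carrier A \<Longrightarrow> f x \<in> carrier B"
    "x \<in> carrier A \<Longrightarrow> y \<in> carrier A \<Longrightarrow> f (x \<oplus>\<^bsub>A\<^esub> y) = f x \<oplus>\<^bsub>B\<^esub> f y"
    "f \<zero>\<^bsub>A\<^esub> = \<zero>\<^bsub>B\<^esub>"
    "x \<in> carrier A \<Longrightarrow> y \<in> carrier A \<Longrightarrow> f (x \<ominus>\<^bsub>A\<^esub> y) = f x \<ominus>\<^bsub>B\<^esub> f y"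
    by (simp_all add: a_minus_def)
  show "r \<in> carrier R \<Longrightarrow> x \<in> carrier A \<Longrightarrow> f (r \<odot>\<^bsub>A\<^esub> x) = r \<odot>\<^bsub>B\<^esub> f x"
    using assms(3) by (simp add: module_homs_def)
qed

text \<open>
  A cyclic group of prime order with a generator, and its integral group ring.
\<close>
locale cyclic_group_ring =
  fixes p :: nat and C :: "'g monoid" and \<alpha> :: 'g and R :: "('g \<Rightarrow> int) ring"
  assumes prime_p: "Factorial_Ring.prime p"
    and group_C: "Group.group C" and order_C: "order C = p"
    and \<alpha>: "\<alpha> \<in> carrier C" and generate_\<alpha>: "carrier C = generate C {\<alpha>}"
    and R_def: "R = int_group_ring C"
begin

sublocale C: group C by (rule group_C)

abbreviation apow :: "nat \<Rightarrow> 'g" where "apow k \<equiv> \<alpha> [^]\<^bsub>C\<^esub> k"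
abbreviation gr :: "'g \<Rightarrow> 'g \<Rightarrow> int" where "gr \<equiv> group_ring_of"

lemma p_pos: "0 < p" using prime_p prime_gt_0_nat by blast

lemma finite_C: "finite (carrier C)"
  using order_C p_pos by (metis card.infinite order_def not_less0)

lemma ord_\<alpha>: "C.ord \<alpha> = p"
  using C.generate_pow_card[OF \<alpha>] order_C generate_\<alpha> by (simp add: order_def)

lemma apow_closed: "apow k \<in> carrier C" using \<alpha> by simp

lemma apow_p: "apow p = \<one>\<^bsub>C\<^esub>" using C.pow_ord_eq_1[OF \<alpha>] ord_\<alpha> by simp

lemma apow_inj: "inj_on apow {..<p}"
proof -
  have "{0..C.ord \<alpha> - 1} = {..<p}" using p_pos by (auto simp: ord_\<alpha>)
  then show ?thesis using C.ord_inj[OF \<alpha>] by simp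
qed

lemma carrier_C: "carrier C = apow ` {..<p}"
proof -
  have "card (apow ` {..<p}) = card (carrier C)"
    using card_image[OF apow_inj] order_C by (simp add: order_def)
  then show ?thesis using card_subset_eq[OF finite_C, of "apow ` {..<p}"] apow_closed by auto
qed

lemma apow_mod: "apow (k mod p) = apow k"
proof -
  have "apow k = apow (p * (k div p)) \<otimes>\<^bsub>C\<^esub> apow (k mod p)"
    using C.nat_pow_mult[OF \<alpha>, of "p * (k div p)" "k mod p"] by simp
  also have "apow (p * (k div p)) = \<one>\<^bsub>C\<^esub>"
    using C.nat_pow_pow[OF \<alpha>, of p "k div p"] by (simp add: apow_p)
  finally show ?thesis using apow_closed by simp
qed

lemma comm_C: "comm_group C"
proof (rule C.group_comm_groupI)
  fix x y assume "x \<in> carrier C" "y \<in> carrier C"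
  then obtain i j where "x = apow i" "y = apow j" by (auto simp: carrier_C)
  then show "x \<otimes>\<^bsub>C\<^esub> y = y \<otimes>\<^bsub>C\<^esub> x" using C.nat_pow_mult[OF \<alpha>] by (simp add: add.commute)
qed

sublocale R: cring R unfolding R_def by (rule cring_int_group_ring[OF comm_C finite_C])

lemma R_simps:
  "r \<in> carrier R \<longleftrightarrow> (\<forall>g. g \<notin> carrier C \<longrightarrow> r g = 0)"
  "\<zero>\<^bsub>R\<^esub> = (\<lambda>g. 0)" "\<one>\<^bsub>R\<^esub> = gr \<one>\<^bsub>C\<^esub>" "r \<oplus>\<^bsub>R\<^esub> s = (\<lambda>g. r g + s g)"
  by (auto simp: R_def int_group_ring_def group_ring_of_def)

lemma gr_closed: "x \<in> carrier C \<Longrightarrow> gr x \<in> carrier R"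
  by (auto simp: R_simps group_ring_of_def)

lemma R_uminus: "r \<in> carrier R \<Longrightarrow> \<ominus>\<^bsub>R\<^esub> r = (\<lambda>g. - r g)"
  by (rule R.minus_equality) (auto simp: R_simps)

lemma R_minus: "s \<in> carrier R \<Longrightarrow> r \<ominus>\<^bsub>R\<^esub> s = (\<lambda>g. r g - s g)"
  by (simp add: a_minus_def R_uminus R_simps(4))

lemma gr_mult:
  assumes "x \<in> carrier C" "y \<in> carrier C"
  shows "gr x \<otimes>\<^bsub>R\<^esub> gr y = gr (x \<otimes>\<^bsub>C\<^esub> y)"
proof
  fix g
  show "(gr x \<otimes>\<^bsub>R\<^esub> gr y) g = gr (x \<otimes>\<^bsub>C\<^esub> y) g"
  proof (cases "g \<in> carrier C")
    case True
    have "(\<Sum>h\<in>carrier C. gr x h * gr y (inv\<^bsub>C\<^esub> h \<otimes>\<^bsub>C\<^esub> g))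
        = (\<Sum>h\<in>carrier C. if h = x then gr y (inv\<^bsub>C\<^esub> x \<otimes>\<^bsub>C\<^esub> g) else 0)"
      by (rule sum.cong) (auto simp: group_ring_of_def)
    also have "\<dots> = gr y (inv\<^bsub>C\<^esub> x \<otimes>\<^bsub>C\<^esub> g)" using finite_C assms by simp
    also have "\<dots> = gr (x \<otimes>\<^bsub>C\<^esub> y) g"
      using assms True C.inv_solve_left[of y x g] by (auto simp: group_ring_of_def)
    finally show ?thesis using True by (simp add: R_def int_group_ring_def)
  next
    case False
    then show ?thesis using assms by (auto simp: R_def int_group_ring_def group_ring_of_def)
  qed
qed

text \<open>
  The group ring is additively generated by the powers of the generator.
\<close>
lemma R_induct [consumes 1, case_names zero gr diff]:
  assumes r: "r \<in> carrier R"
    and "P \<zero>\<^bsub>R\<^esub>" "\<And>k. P (gr (apow k))"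
    and "\<And>r s. r \<in> carrier R \<Longrightarrow> s \<in> carrier R \<Longrightarrow> P r \<Longrightarrow> P s \<Longrightarrow> P (r \<ominus>\<^bsub>R\<^esub> s)"
  shows "P r"
proof -
  have look: "coeff_at v \<in> carrier R" if "Poly_Mapping.keys v \<subseteq> carrier C" for v :: "'g \<Rightarrow>\<^sub>0 int"
    using that by (auto simp: R_simps in_keys_iff)
  have "finite {g. r g \<noteq> 0}"
    by (rule finite_subset[OF _ finite_C]) (use r in \<open>auto simp: R_simps\<close>)
  then have lr: "coeff_at (Abs_poly_mapping r) = r" by simp
  have keys: "Poly_Mapping.keys (Abs_poly_mapping r) \<subseteq> carrier C"
    using r by (auto simp: R_simps in_keys_iff lr)
  have "Poly_Mapping.keys v \<subseteq> carrier C \<and> P (coeff_at v)"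
    if "Poly_Mapping.keys v \<subseteq> carrier C" for v :: "'g \<Rightarrow>\<^sub>0 int"
    using that
  proof (induction v rule: frag_induction)
    case zero
    have "coeff_at (0 :: 'g \<Rightarrow>\<^sub>0 int) = \<zero>\<^bsub>R\<^esub>" by (auto simp: R_simps)
    then show ?case using assms(2) by simp
  next
    case (one x)
    then obtain k where "x = apow k" by (auto simp: carrier_C)
    moreover have "coeff_at (frag_of x) = gr x" by (auto simp: group_ring_of_def)
    ultimately show ?case using assms(3) one by simp
  next
    case (diff v w)
    then have "coeff_at (v - w) = coeff_at v \<ominus>\<^bsub>R\<^esub> coeff_at w"
      by (simp add: R_minus look lookup_minus fun_eq_iff)
    moreover have "Poly_Mapping.keys (v - w) \<subseteq> carrier C"
      using diff by (auto dest: subsetD[OF keys_diff])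
    ultimately show ?case using diff assms(4) look by simp
  qed
  from this[OF keys] show ?thesis by (simp add: lr)
qed

definition t :: "'g \<Rightarrow> int" where
  "t = gr \<alpha> \<ominus>\<^bsub>R\<^esub> \<one>\<^bsub>R\<^esub>"

text \<open>
  The norm element \<open>\<sigma>\<close> of the group ring.
\<close>
definition norm_elt :: "'g \<Rightarrow> int" where
  "norm_elt g = (if g \<in> carrier C then 1 else 0)"

text \<open>
  The partial sums \<open>1 + \<alpha> + \<dots> + \<alpha>\<^sup>n\<^sup>-\<^sup>1\<close> of the norm element.
\<close>
definition partial_norm_elt :: "nat \<Rightarrow> 'g \<Rightarrow> int" where
  "partial_norm_elt n g = (\<Sum>k<n. gr (apow k) g)"

lemma t_closed: "t \<in> carrier R" and norm_elt_closed: "norm_elt \<in> carrier R"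
  and partial_norm_elt_closed: "partial_norm_elt n \<in> carrier R"
proof -
  show "t \<in> carrier R" by (simp add: t_def gr_closed \<alpha>)
  show "norm_elt \<in> carrier R" by (simp add: R_simps norm_elt_def)
  have "gr (apow k) g = 0" if "g \<notin> carrier C" for g k
    using that apow_closed[of k] by (auto simp: group_ring_of_def)
  then show "partial_norm_elt n \<in> carrier R" by (simp add: R_simps partial_norm_elt_def)
qed

lemma partial_norm_elt_simps: "partial_norm_elt 0 = \<zero>\<^bsub>R\<^esub>" "partial_norm_elt (Suc n) = partial_norm_elt n \<oplus>\<^bsub>R\<^esub> gr (apow n)"
  by (auto simp: partial_norm_elt_def R_simps)

lemma partial_norm_elt_p: "partial_norm_elt p = norm_elt"
proof
  fix g
  have "partial_norm_elt p g = (\<Sum>x\<in>carrier C. gr x g)"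
    unfolding partial_norm_elt_def carrier_C by (simp add: sum.reindex[OF apow_inj])
  also have "\<dots> = norm_elt g" using finite_C by (simp add: norm_elt_def group_ring_of_def)
  finally show "partial_norm_elt p g = norm_elt g" .
qed

lemma t_mult: "r \<in> carrier R \<Longrightarrow> t \<otimes>\<^bsub>R\<^esub> r = (gr \<alpha> \<otimes>\<^bsub>R\<^esub> r) \<ominus>\<^bsub>R\<^esub> r"
  using gr_closed[OF \<alpha>] by (simp add: t_def a_minus_def R.l_distr R.l_minus)

lemma gr_apow_Suc: "gr (apow (Suc k)) = gr \<alpha> \<otimes>\<^bsub>R\<^esub> gr (apow k)"
proof -
  have "apow (Suc k) = \<alpha> \<otimes>\<^bsub>C\<^esub> apow k"
    using C.nat_pow_Suc2[OF \<alpha>] by simp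
  then show ?thesis by (simp only: gr_mult[OF \<alpha> apow_closed])
qed

lemma t_norm_elt: "t \<otimes>\<^bsub>R\<^esub> norm_elt = \<zero>\<^bsub>R\<^esub>"
proof -
  note c = partial_norm_elt_closed gr_closed[OF \<alpha>] gr_closed[OF apow_closed]
  have *: "(gr \<alpha> \<otimes>\<^bsub>R\<^esub> partial_norm_elt n) g + gr \<one>\<^bsub>C\<^esub> g = partial_norm_elt n g + gr (apow n) g" for n g
  proof (induction n)
    case 0
    then show ?case using gr_closed[OF \<alpha>] by (simp add: partial_norm_elt_simps)
  next
    case (Suc n)
    have "(gr \<alpha> \<otimes>\<^bsub>R\<^esub> partial_norm_elt (Suc n)) g = (gr \<alpha> \<otimes>\<^bsub>R\<^esub> partial_norm_elt n) g + gr (apow (Suc n)) g"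
      unfolding partial_norm_elt_simps R.r_distr[OF c(1,3,2)] gr_apow_Suc by (simp add: R_simps)
    with Suc show ?case by (simp add: partial_norm_elt_simps R_simps)
  qed
  have "gr \<alpha> \<otimes>\<^bsub>R\<^esub> norm_elt = norm_elt"
    using *[of p] by (auto simp: partial_norm_elt_p apow_p)
  then show ?thesis using norm_elt_closed by (simp add: t_mult R.r_neg a_minus_def)
qed

text \<open>
  The group ring is acyclic. Every element is congruent to its augmentation modulo \<open>t\<close>, and the
  augmentation is the coefficient of \<open>\<sigma>r\<close> at the identity.
\<close>
lemma norm_elt_annihilated:
  assumes r: "r \<in> carrier R" and z: "norm_elt \<otimes>\<^bsub>R\<^esub> r = \<zero>\<^bsub>R\<^esub>"
  shows "\<exists>d\<in>carrier R. r = t \<otimes>\<^bsub>R\<^esub> d"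
proof -
  define aug where "aug s = (\<Sum>g\<in>carrier C. s g)" for s :: "'g \<Rightarrow> int"
  have decomp: "\<exists>d\<in>carrier R. \<forall>g. r g = (t \<otimes>\<^bsub>R\<^esub> d) g + (if g = \<one>\<^bsub>C\<^esub> then aug r else 0)"
    using r
  proof (induction rule: R_induct)
    case zero
    show ?case using t_closed by (intro bexI[of _ "\<zero>\<^bsub>R\<^esub>"]) (simp_all add: aug_def R_simps(2)[symmetric], simp add: R_simps)
  next
    case (gr k)
    have a1: "aug (gr (apow k)) = 1" for k
      using apow_closed finite_C by (simp add: aug_def group_ring_of_def)
    show ?case
    proof (induction k)
      case 0
      show ?case
        using a1[of 0] R.r_null[OF t_closed] R.zero_closed
        by (intro bexI[of _ "\<zero>\<^bsub>R\<^esub>"]) (auto simp: R_simps(2) group_ring_of_def)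
    next
      case (Suc k)
      then obtain d where d: "d \<in> carrier R"
        "\<And>g. gr (apow k) g = (t \<otimes>\<^bsub>R\<^esub> d) g + (if g = \<one>\<^bsub>C\<^esub> then aug (gr (apow k)) else 0)" by auto
      have "gr (apow (Suc k)) g = (t \<otimes>\<^bsub>R\<^esub> gr (apow k)) g + gr (apow k) g" for g
        using gr_closed[OF apow_closed] by (simp only: t_mult R_minus gr_apow_Suc)
      moreover have "(t \<otimes>\<^bsub>R\<^esub> (gr (apow k) \<oplus>\<^bsub>R\<^esub> d)) g = (t \<otimes>\<^bsub>R\<^esub> gr (apow k)) g + (t \<otimes>\<^bsub>R\<^esub> d) g" for g
        using R.r_distr[OF gr_closed[OF apow_closed] d(1) t_closed] by (simp add: R_simps)
      ultimately show ?case
        using d gr_closed[OF apow_closed] a1[of k] a1[of "Suc k"]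
        by (intro bexI[of _ "gr (apow k) \<oplus>\<^bsub>R\<^esub> d"]) simp_all
    qed
  next
    case (diff r s)
    then obtain d e where d: "d \<in> carrier R" "e \<in> carrier R"
      "\<And>g. r g = (t \<otimes>\<^bsub>R\<^esub> d) g + (if g = \<one>\<^bsub>C\<^esub> then aug r else 0)"
      "\<And>g. s g = (t \<otimes>\<^bsub>R\<^esub> e) g + (if g = \<one>\<^bsub>C\<^esub> then aug s else 0)" by auto
    have "t \<otimes>\<^bsub>R\<^esub> (d \<ominus>\<^bsub>R\<^esub> e) = (t \<otimes>\<^bsub>R\<^esub> d) \<ominus>\<^bsub>R\<^esub> (t \<otimes>\<^bsub>R\<^esub> e)"
      using d t_closed by (simp add: a_minus_def R.r_distr R.r_minus)
    then have "(t \<otimes>\<^bsub>R\<^esub> (d \<ominus>\<^bsub>R\<^esub> e)) g = (t \<otimes>\<^bsub>R\<^esub> d) g - (t \<otimes>\<^bsub>R\<^esub> e) g" for g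
      using R_minus[OF R.m_closed[OF t_closed d(2)]] by simp
    moreover have "aug (r \<ominus>\<^bsub>R\<^esub> s) = aug r - aug s"
      using diff by (simp add: aug_def R_minus sum_subtractf)
    ultimately have "(r \<ominus>\<^bsub>R\<^esub> s) g = (t \<otimes>\<^bsub>R\<^esub> (d \<ominus>\<^bsub>R\<^esub> e)) g
        + (if g = \<one>\<^bsub>C\<^esub> then aug (r \<ominus>\<^bsub>R\<^esub> s) else 0)" for g
      using d(3)[of g] d(4)[of g] R_minus[OF diff(2), of r] by simp
    moreover have "d \<ominus>\<^bsub>R\<^esub> e \<in> carrier R" using d by simp
    ultimately show ?case by blast
  qed
  have "(norm_elt \<otimes>\<^bsub>R\<^esub> r) \<one>\<^bsub>C\<^esub> = (\<Sum>h\<in>carrier C. r (inv\<^bsub>C\<^esub> h))"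
    by (simp add: R_def int_group_ring_def norm_elt_def)
  also have "\<dots> = aug r"
    unfolding aug_def
    by (rule sum.reindex_bij_witness[where i = "\<lambda>h. inv\<^bsub>C\<^esub> h" and j = "\<lambda>h. inv\<^bsub>C\<^esub> h"]) auto
  finally have "aug r = 0" using z by (simp add: R_simps)
  with decomp have "\<exists>d\<in>carrier R. \<forall>g. r g = (t \<otimes>\<^bsub>R\<^esub> d) g" by (simp cong: if_cong)
  then show ?thesis by (simp add: fun_eq_iff)
qed

lemma free_module_acyclic:
  assumes M: "Module.module R M" and free: "free_module R M"
    and x: "x \<in> carrier M" "norm_elt \<odot>\<^bsub>M\<^esub> x = \<zero>\<^bsub>M\<^esub>"
  shows "\<exists>y\<in>carrier M. x = t \<odot>\<^bsub>M\<^esub> y"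
proof -
  interpret M: module R M by fact
  define Q where "Q B x c \<longleftrightarrow> (\<forall>b\<in>B. c b \<in> carrier R) \<and> (\<forall>b. b \<notin> B \<longrightarrow> c b = \<zero>\<^bsub>R\<^esub>) \<and>
      finite {b. c b \<noteq> \<zero>\<^bsub>R\<^esub>} \<and> x = (\<Oplus>\<^bsub>M\<^esub>b\<in>{b. c b \<noteq> \<zero>\<^bsub>R\<^esub>}. c b \<odot>\<^bsub>M\<^esub> b)" for B x c
  have "\<exists>B\<subseteq>carrier M. \<forall>x\<in>carrier M. \<exists>!c. Q B x c"
    using free by (simp add: free_module_def Q_def)
  then obtain B where B: "B \<subseteq> carrier M" and ex1: "\<forall>x\<in>carrier M. \<exists>!c. Q B x c"
    by (elim exE conjE) (rule that)
  obtain c where "Q B x c" using ex1 x(1) by (elim ballE ex1E) auto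
  then have c: "\<forall>b\<in>B. c b \<in> carrier R" "\<forall>b. b \<notin> B \<longrightarrow> c b = \<zero>\<^bsub>R\<^esub>" "finite {b. c b \<noteq> \<zero>\<^bsub>R\<^esub>}"
    "x = (\<Oplus>\<^bsub>M\<^esub>b\<in>{b. c b \<noteq> \<zero>\<^bsub>R\<^esub>}. c b \<odot>\<^bsub>M\<^esub> b)"
    by (simp_all add: Q_def)
  define A where "A = {b. c b \<noteq> \<zero>\<^bsub>R\<^esub>}"
  have A: "finite A" "A \<subseteq> B" using c by (auto simp: A_def)
  have cR: "c b \<in> carrier R" for b using c(1,2) by (cases "b \<in> B") auto
  have bM: "b \<in> carrier M" if "b \<in> A" for b using that A B by blast
  define c' where "c' b = norm_elt \<otimes>\<^bsub>R\<^esub> c b" for b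
  have c'R: "c' b \<in> carrier R" for b by (simp add: c'_def norm_elt_closed cR)
  have supp: "{b. c' b \<noteq> \<zero>\<^bsub>R\<^esub>} \<subseteq> A" using norm_elt_closed by (auto simp: c'_def A_def)
  have "(\<Oplus>\<^bsub>M\<^esub>b\<in>{b. c' b \<noteq> \<zero>\<^bsub>R\<^esub>}. c' b \<odot>\<^bsub>M\<^esub> b) = (\<Oplus>\<^bsub>M\<^esub>b\<in>A. c' b \<odot>\<^bsub>M\<^esub> b)"
    by (rule M.add.finprod_mono_neutral_cong_left) (use A supp bM c'R in auto)
  also have "\<dots> = (\<Oplus>\<^bsub>M\<^esub>b\<in>A. norm_elt \<odot>\<^bsub>M\<^esub> (c b \<odot>\<^bsub>M\<^esub> b))"
    by (rule M.finsum_cong') (use bM cR norm_elt_closed in \<open>auto simp: c'_def M.smult_assoc1\<close>)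
  also have "\<dots> = norm_elt \<odot>\<^bsub>M\<^esub> x"
    unfolding c(4) A_def[symmetric]
    by (rule M.finsum_smult_ldistr[symmetric]) (use A norm_elt_closed bM cR in auto)
  finally have sum0: "\<zero>\<^bsub>M\<^esub> = (\<Oplus>\<^bsub>M\<^esub>b\<in>{b. c' b \<noteq> \<zero>\<^bsub>R\<^esub>}. c' b \<odot>\<^bsub>M\<^esub> b)" using x(2) by simp
  have "c' = (\<lambda>b. \<zero>\<^bsub>R\<^esub>)"
  proof (rule ex1_implies_eq[OF ex1[rule_format, OF M.zero_closed]])
    have "c' b = \<zero>\<^bsub>R\<^esub>" if "b \<notin> B" for b using c(2) that norm_elt_closed by (simp add: c'_def)
    then show "Q B \<zero>\<^bsub>M\<^esub> c'"
      unfolding Q_def using c'R sum0 finite_subset[OF supp A(1)] by blast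
  qed (simp add: Q_def)
  then have "\<exists>d\<in>carrier R. c b = t \<otimes>\<^bsub>R\<^esub> d" for b
    using norm_elt_annihilated[OF cR] by (metis c'_def)
  then obtain d where d: "\<And>b. d b \<in> carrier R" "\<And>b. c b = t \<otimes>\<^bsub>R\<^esub> d b" by metis
  have "x = (\<Oplus>\<^bsub>M\<^esub>b\<in>A. t \<odot>\<^bsub>M\<^esub> (d b \<odot>\<^bsub>M\<^esub> b))"
    unfolding c(4) A_def[symmetric]
    by (rule M.finsum_cong') (use bM d t_closed in \<open>auto simp: M.smult_assoc1\<close>)
  also have "\<dots> = t \<odot>\<^bsub>M\<^esub> (\<Oplus>\<^bsub>M\<^esub>b\<in>A. d b \<odot>\<^bsub>M\<^esub> b)"
    by (rule M.finsum_smult_ldistr[symmetric]) (use A t_closed bM d in auto)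
  finally show ?thesis using bM d by (intro bexI[of _ "\<Oplus>\<^bsub>M\<^esub>b\<in>A. d b \<odot>\<^bsub>M\<^esub> b"]) auto
qed

lemma trivial_module_acyclic:
  fixes M :: "('g \<Rightarrow> int, 'b, 'm) module_scheme"
  assumes M: "Module.module R M" and triv: "trivial_module \<alpha> M" and free: "additively_free M"
    and x: "x \<in> carrier M" "norm_elt \<odot>\<^bsub>M\<^esub> x = \<zero>\<^bsub>M\<^esub>"
  shows "x = \<zero>\<^bsub>M\<^esub>"
proof -
  interpret M: module R M by fact
  have gr_act: "gr (apow k) \<odot>\<^bsub>M\<^esub> x = x" for k
  proof (induction k)
    case 0
    then show ?case using x(1) by (simp add: R_simps(3)[symmetric])
  next
    case (Suc k)
    have "gr (apow (Suc k)) \<odot>\<^bsub>M\<^esub> x = gr \<alpha> \<odot>\<^bsub>M\<^esub> (gr (apow k) \<odot>\<^bsub>M\<^esub> x)"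
      unfolding gr_apow_Suc by (rule M.smult_assoc1) (use gr_closed \<alpha> apow_closed x in auto)
    then show ?case using Suc triv x(1) by (simp add: trivial_module_def)
  qed
  have "partial_norm_elt n \<odot>\<^bsub>M\<^esub> x = x [^]\<^bsub>add_monoid M\<^esub> n" for n
  proof (induction n)
    case 0
    then show ?case using x(1) by (simp add: partial_norm_elt_simps)
  next
    case (Suc n)
    have "partial_norm_elt (Suc n) \<odot>\<^bsub>M\<^esub> x = partial_norm_elt n \<odot>\<^bsub>M\<^esub> x \<oplus>\<^bsub>M\<^esub> gr (apow n) \<odot>\<^bsub>M\<^esub> x"
      unfolding partial_norm_elt_simps
      by (rule M.smult_l_distr) (use gr_closed apow_closed x partial_norm_elt_closed in auto)
    then show ?case using Suc gr_act by simp
  qed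
  from this[of p] have pow0: "x [^]\<^bsub>add_monoid M\<^esub> p = \<zero>\<^bsub>M\<^esub>" using x(2) by (simp add: partial_norm_elt_p)
  obtain S :: "'b set" and \<phi> where \<phi>: "\<phi> \<in> iso (add_monoid M) (free_Abelian_group S)"
    using free by (auto simp: additively_free_def is_iso_def)
  interpret H: group_hom "add_monoid M" "free_Abelian_group S" \<phi>
    using \<phi> M.a_group by (auto simp: group_hom_def group_hom_axioms_def iso_def)
  have "frag_cmul (int p) (\<phi> x) = 0"
    using H.hom_nat_pow[of x p] H.hom_one pow0 x(1) by simp
  then have "\<phi> x = 0" using p_pos by simp
  moreover have "\<phi> \<zero>\<^bsub>M\<^esub> = 0" using H.hom_one by simp
  moreover have "inj_on \<phi> (carrier M)" using \<phi> by (simp add: iso_def bij_betw_def)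
  ultimately show ?thesis using x(1) by (metis M.zero_closed inj_onD)
qed

lemma direct_sum_acyclic:
  assumes M: "Module.module R M" and sum: "internal_direct_sum R M \<T>"
    and ac: "\<And>S x. S \<in> \<T> \<Longrightarrow> x \<in> S \<Longrightarrow> norm_elt \<odot>\<^bsub>M\<^esub> x = \<zero>\<^bsub>M\<^esub> \<Longrightarrow> \<exists>y\<in>S. x = t \<odot>\<^bsub>M\<^esub> y"
    and x: "x \<in> carrier M" "norm_elt \<odot>\<^bsub>M\<^esub> x = \<zero>\<^bsub>M\<^esub>"
  shows "\<exists>y\<in>carrier M. x = t \<odot>\<^bsub>M\<^esub> y"
proof -
  interpret M: module R M by fact
  have sub: "submodule S R M" if "S \<in> \<T>" for S using sum that by (simp add: internal_direct_sum_def)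
  have SM: "y \<in> carrier M" if "S \<in> \<T>" "y \<in> S" for S y
    using M.submoduleE(1)[OF sub[OF that(1)]] that(2) by blast
  define Q where "Q x y \<longleftrightarrow> (\<forall>S\<in>\<T>. y S \<in> S) \<and> (\<forall>S. S \<notin> \<T> \<longrightarrow> y S = \<zero>\<^bsub>M\<^esub>) \<and>
      finite {S. y S \<noteq> \<zero>\<^bsub>M\<^esub>} \<and> x = (\<Oplus>\<^bsub>M\<^esub>S\<in>{S. y S \<noteq> \<zero>\<^bsub>M\<^esub>}. y S)" for x y
  have ex1: "\<forall>x\<in>carrier M. \<exists>!y. Q x y"
    using sum by (simp add: internal_direct_sum_def Q_def)
  obtain y where "Q x y" using ex1 x(1) by (elim ballE ex1E) auto
  then have y: "\<forall>S\<in>\<T>. y S \<in> S" "\<forall>S. S \<notin> \<T> \<longrightarrow> y S = \<zero>\<^bsub>M\<^esub>" "finite {S. y S \<noteq> \<zero>\<^bsub>M\<^esub>}"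
      "x = (\<Oplus>\<^bsub>M\<^esub>S\<in>{S. y S \<noteq> \<zero>\<^bsub>M\<^esub>}. y S)"
    by (simp_all add: Q_def)
  define A where "A = {S. y S \<noteq> \<zero>\<^bsub>M\<^esub>}"
  have A: "finite A" "A \<subseteq> \<T>" using y by (auto simp: A_def)
  have yM: "y S \<in> carrier M" for S using y(1,2) SM by (cases "S \<in> \<T>") auto
  define y' where "y' S = norm_elt \<odot>\<^bsub>M\<^esub> y S" for S
  have y'M: "y' S \<in> carrier M" for S by (simp add: y'_def norm_elt_closed yM)
  have supp: "{S. y' S \<noteq> \<zero>\<^bsub>M\<^esub>} \<subseteq> A" using norm_elt_closed by (auto simp: y'_def A_def)
  have "(\<Oplus>\<^bsub>M\<^esub>S\<in>{S. y' S \<noteq> \<zero>\<^bsub>M\<^esub>}. y' S) = (\<Oplus>\<^bsub>M\<^esub>S\<in>A. y' S)"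
    by (rule M.add.finprod_mono_neutral_cong_left) (use A supp y'M in auto)
  also have "\<dots> = norm_elt \<odot>\<^bsub>M\<^esub> x"
    unfolding y(4) A_def[symmetric] y'_def
    by (rule M.finsum_smult_ldistr[symmetric]) (use A norm_elt_closed yM in auto)
  finally have sum0: "\<zero>\<^bsub>M\<^esub> = (\<Oplus>\<^bsub>M\<^esub>S\<in>{S. y' S \<noteq> \<zero>\<^bsub>M\<^esub>}. y' S)" using x(2) by simp
  have "y' = (\<lambda>S. \<zero>\<^bsub>M\<^esub>)"
  proof (rule ex1_implies_eq[OF ex1[rule_format, OF M.zero_closed]])
    have "y' S = \<zero>\<^bsub>M\<^esub>" if "S \<notin> \<T>" for S using y(2) that norm_elt_closed by (simp add: y'_def)
    moreover have "y' S \<in> S" if "S \<in> \<T>" for S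
      using y(1) that norm_elt_closed M.submoduleE(4)[OF sub[OF that]] by (simp add: y'_def)
    ultimately show "Q \<zero>\<^bsub>M\<^esub> y'"
      unfolding Q_def using sum0 finite_subset[OF supp A(1)] by blast
    show "Q \<zero>\<^bsub>M\<^esub> (\<lambda>S. \<zero>\<^bsub>M\<^esub>)"
      using subgroup.one_closed[OF submodule.axioms(1)[OF sub]] by (simp add: Q_def)
  qed
  then have "norm_elt \<odot>\<^bsub>M\<^esub> y S = \<zero>\<^bsub>M\<^esub>" for S by (metis y'_def)
  then have "\<exists>z\<in>S. y S = t \<odot>\<^bsub>M\<^esub> z" if "S \<in> \<T>" for S using ac[OF that] y(1) that by blast
  then obtain z where z: "\<And>S. S \<in> \<T> \<Longrightarrow> z S \<in> S" "\<And>S. S \<in> \<T> \<Longrightarrow> y S = t \<odot>\<^bsub>M\<^esub> z S" by metis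
  have zM: "z S \<in> carrier M" if "S \<in> A" for S using z(1) SM A that by blast
  have "x = (\<Oplus>\<^bsub>M\<^esub>S\<in>A. t \<odot>\<^bsub>M\<^esub> z S)"
    unfolding y(4) A_def[symmetric]
    by (rule M.finsum_cong') (use zM z A t_closed in auto)
  also have "\<dots> = t \<odot>\<^bsub>M\<^esub> (\<Oplus>\<^bsub>M\<^esub>S\<in>A. z S)"
    by (rule M.finsum_smult_ldistr[symmetric]) (use A t_closed zM in auto)
  finally show ?thesis using zM by (intro bexI[of _ "\<Oplus>\<^bsub>M\<^esub>S\<in>A. z S"]) auto
qed

lemma sum_of_free_and_trivial_acyclic:
  assumes M: "Module.module R M" and sum: "sum_of_free_and_trivial R \<alpha> M"
    and x: "x \<in> carrier M" "norm_elt \<odot>\<^bsub>M\<^esub> x = \<zero>\<^bsub>M\<^esub>"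
  shows "\<exists>y\<in>carrier M. x = t \<odot>\<^bsub>M\<^esub> y"
proof -
  interpret M: module R M by fact
  obtain \<T> where S: "internal_direct_sum R M \<T>"
    "\<And>S. S \<in> \<T> \<Longrightarrow> free_module R (M\<lparr>carrier := S\<rparr>) \<or>
        (trivial_module \<alpha> (M\<lparr>carrier := S\<rparr>) \<and> additively_free (M\<lparr>carrier := S\<rparr>))"
    using sum by (auto simp: sum_of_free_and_trivial_def)
  show ?thesis
  proof (rule direct_sum_acyclic[OF M S(1) _ x])
    fix S x assume x: "S \<in> \<T>" "x \<in> S" "norm_elt \<odot>\<^bsub>M\<^esub> x = \<zero>\<^bsub>M\<^esub>"
    have sub: "submodule S R M" using S(1) x(1) by (simp add: internal_direct_sum_def)
    note mS = submodule.submodule_is_module[OF sub M]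
    show "\<exists>y\<in>S. x = t \<odot>\<^bsub>M\<^esub> y"
      using S(2)[OF x(1)]
    proof
      assume "free_module R (M\<lparr>carrier := S\<rparr>)"
      from free_module_acyclic[OF mS this, of x] x show ?thesis by simp
    next
      assume "trivial_module \<alpha> (M\<lparr>carrier := S\<rparr>) \<and> additively_free (M\<lparr>carrier := S\<rparr>)"
      with trivial_module_acyclic[OF mS, of x] x have "x = \<zero>\<^bsub>M\<^esub>" by simp
      then show ?thesis
        using subgroup.one_closed[OF submodule.axioms(1)[OF sub]] t_closed
        by (intro bexI[of _ "\<zero>\<^bsub>M\<^esub>"]) auto
    qed
  qed
qed

end

section \<open>Purity from a resolution\<close>

lemma (in module) minus_unique_sum:
  assumes "x \<in> carrier M" "y \<in> carrier M" "z \<in> carrier M" "x = y \<oplus>\<^bsub>M\<^esub> z"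
  shows "x \<ominus>\<^bsub>M\<^esub> y = z"
  using assms by (simp add: a_minus_def M.a_comm[of y z] M.a_assoc M.r_neg)

lemma (in module) eq_if_minus_zero:
  assumes "x \<in> carrier M" "y \<in> carrier M" "x \<ominus>\<^bsub>M\<^esub> y = \<zero>\<^bsub>M\<^esub>"
  shows "x = y"
proof -
  have "x = (x \<ominus>\<^bsub>M\<^esub> y) \<oplus>\<^bsub>M\<^esub> y" using assms(1,2) by (simp add: a_minus_def M.a_assoc M.l_neg)
  then show ?thesis using assms by simp
qed

lemma (in module) smult_minus:
  assumes "a \<in> carrier R" "x \<in> carrier M" "y \<in> carrier M"
  shows "a \<odot>\<^bsub>M\<^esub> (x \<ominus>\<^bsub>M\<^esub> y) = a \<odot>\<^bsub>M\<^esub> x \<ominus>\<^bsub>M\<^esub> a \<odot>\<^bsub>M\<^esub> y"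
  using assms by (simp add: a_minus_def smult_r_distr smult_r_minus)

lemma (in module) submodule_finsum:
  assumes S: "submodule S R M" and f: "f \<in> A \<rightarrow> S" and fin: "finite A"
  shows "finsum (M\<lparr>carrier := S\<rparr>) f A = finsum M f A"
proof -
  interpret S: module R "M\<lparr>carrier := S\<rparr>"
    by (rule submodule.submodule_is_module[OF S]) unfold_locales
  have SM: "S \<subseteq> carrier M" using submoduleE(1)[OF S] .
  from fin f show ?thesis
  proof (induction A rule: finite_induct)
    case (insert a A)
    then have "f \<in> A \<rightarrow> carrier (M\<lparr>carrier := S\<rparr>)" "f a \<in> carrier (M\<lparr>carrier := S\<rparr>)" by auto
    from S.M.finsum_insert[OF insert.hyps this]
    have "finsum (M\<lparr>carrier := S\<rparr>) f (insert a A) = f a \<oplus>\<^bsub>M\<^esub> finsum (M\<lparr>carrier := S\<rparr>) f A" by simp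
    moreover have "finsum M f (insert a A) = f a \<oplus>\<^bsub>M\<^esub> finsum M f A"
      by (rule M.finsum_insert) (use insert SM in auto)
    ultimately show ?case using insert by simp
  qed simp
qed

lemma (in module) internal_direct_sum_pair:
  assumes S: "submodule S R M" and T: "submodule T R M" and ne: "S \<noteq> T"
    and int: "S \<inter> T = {\<zero>\<^bsub>M\<^esub>}" and sum: "\<And>x. x \<in> carrier M \<Longrightarrow> \<exists>s\<in>S. \<exists>u\<in>T. x = s \<oplus>\<^bsub>M\<^esub> u"
  shows "internal_direct_sum R M {S, T}"
proof -
  note S0 = submoduleE[OF S] and T0 = submoduleE[OF T]
  have SM: "x \<in> carrier M" if "x \<in> S" for x using S0(1) that by blast
  have TM: "x \<in> carrier M" if "x \<in> T" for x using T0(1) that by blast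
  have pair: "(\<Oplus>\<^bsub>M\<^esub>U\<in>{U. y U \<noteq> \<zero>\<^bsub>M\<^esub>}. y U) = y S \<oplus>\<^bsub>M\<^esub> y T"
    if "y S \<in> S" "y T \<in> T" "\<And>U. U \<notin> {S, T} \<Longrightarrow> y U = \<zero>\<^bsub>M\<^esub>" for y
  proof -
    have "(\<Oplus>\<^bsub>M\<^esub>U\<in>{U. y U \<noteq> \<zero>\<^bsub>M\<^esub>}. y U) = (\<Oplus>\<^bsub>M\<^esub>U\<in>{S, T}. y U)"
      by (rule M.add.finprod_mono_neutral_cong_left) (use that SM TM in auto)
    also have "\<dots> = y S \<oplus>\<^bsub>M\<^esub> y T"
      using that ne SM TM by (simp add: M.finsum_insert)
    finally show ?thesis .
  qed
  define Q where "Q x y \<longleftrightarrow> (\<forall>U\<in>{S, T}. y U \<in> U) \<and> (\<forall>U. U \<notin> {S, T} \<longrightarrow> y U = \<zero>\<^bsub>M\<^esub>) \<and>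
      finite {U. y U \<noteq> \<zero>\<^bsub>M\<^esub>} \<and> x = (\<Oplus>\<^bsub>M\<^esub>U\<in>{U. y U \<noteq> \<zero>\<^bsub>M\<^esub>}. y U)" for x y
  have Q: "Q x y \<longleftrightarrow> y S \<in> S \<and> y T \<in> T \<and> (\<forall>U. U \<notin> {S, T} \<longrightarrow> y U = \<zero>\<^bsub>M\<^esub>) \<and> x = y S \<oplus>\<^bsub>M\<^esub> y T"
    for x y
  proof -
    have "finite {U. y U \<noteq> \<zero>\<^bsub>M\<^esub>}" if "\<forall>U. U \<notin> {S, T} \<longrightarrow> y U = \<zero>\<^bsub>M\<^esub>"
      by (rule finite_subset[of _ "{S, T}"]) (use that in auto)
    then show ?thesis unfolding Q_def using pair[of y] by auto
  qed
  have "\<exists>!y. Q x y" if x: "x \<in> carrier M" for x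
  proof -
    obtain s u where su: "s \<in> S" "u \<in> T" "x = s \<oplus>\<^bsub>M\<^esub> u" using sum[OF x] by blast
    show ?thesis
    proof (rule ex1I)
      show "Q x (\<lambda>U. if U = S then s else if U = T then u else \<zero>\<^bsub>M\<^esub>)"
        using su ne by (simp add: Q)
      fix y assume "Q x y"
      then have y: "y S \<in> S" "y T \<in> T" "\<And>U. U \<notin> {S, T} \<Longrightarrow> y U = \<zero>\<^bsub>M\<^esub>" "x = y S \<oplus>\<^bsub>M\<^esub> y T"
        by (auto simp: Q)
      note cl = SM[OF su(1)] TM[OF su(2)] SM[OF y(1)] TM[OF y(2)]
      have eq: "s \<oplus>\<^bsub>M\<^esub> u = y S \<oplus>\<^bsub>M\<^esub> y T" using su y by simp
      have "s \<ominus>\<^bsub>M\<^esub> y S = y T \<ominus>\<^bsub>M\<^esub> u"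
      proof -
        have "s = (y S \<oplus>\<^bsub>M\<^esub> y T) \<ominus>\<^bsub>M\<^esub> u"
          using minus_unique_sum[OF _ cl(2,1) M.a_comm[OF cl(1,2)]] cl(1,2) by (simp flip: eq)
        also have "\<dots> = y S \<oplus>\<^bsub>M\<^esub> (y T \<ominus>\<^bsub>M\<^esub> u)" using cl by (simp add: a_minus_def M.a_assoc)
        finally show ?thesis using minus_unique_sum cl by simp
      qed
      moreover have "s \<ominus>\<^bsub>M\<^esub> y S \<in> S" "y T \<ominus>\<^bsub>M\<^esub> u \<in> T"
        using su y S0(3,5) T0(3,5) by (simp_all add: a_minus_def)
      ultimately have "s \<ominus>\<^bsub>M\<^esub> y S = \<zero>\<^bsub>M\<^esub>" "y T \<ominus>\<^bsub>M\<^esub> u = \<zero>\<^bsub>M\<^esub>" using int by auto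
      then have "s = y S" "u = y T" using eq_if_minus_zero[OF cl(1,3)] eq_if_minus_zero[OF cl(4,2)] by simp_all
      then show "y = (\<lambda>U. if U = S then s else if U = T then u else \<zero>\<^bsub>M\<^esub>)"
        using y(3) by (intro ext) simp
    qed
  qed
  then have "\<forall>x\<in>carrier M. \<exists>!y. Q x y" ..
  moreover have "\<forall>U\<in>{S, T}. submodule U R M" using S T by blast
  ultimately show ?thesis unfolding internal_direct_sum_def Q_def by (intro conjI)
qed

context cyclic_group_ring
begin

lemma t_smult:
  assumes "Module.module R M" "x \<in> carrier M"
  shows "t \<odot>\<^bsub>M\<^esub> x = gr \<alpha> \<odot>\<^bsub>M\<^esub> x \<ominus>\<^bsub>M\<^esub> x"
proof -
  interpret M: module R M by fact
  show ?thesis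
    unfolding t_def using assms(2) gr_closed[OF \<alpha>]
    by (simp add: a_minus_def M.smult_l_distr M.smult_l_minus)
qed

text \<open>
  The diagram chase behind the embeddings of \<open>H\<^sup>-\<^sup>1(M\<^sub>0)\<close> into \<open>H\<^sup>0(N\<^sub>0)\<close> and of \<open>H\<^sup>0(N\<^sub>0)\<close> into \<open>H\<^sup>0(N)\<close>. It
  starts from \<open>x = tm\<close> in \<open>M\<^sub>0\<close>; a lift \<open>q0\<close> of \<open>x\<close> to \<open>P\<^sub>0\<close> has its norm in \<open>N\<^sub>0\<close>.
\<close>
lemma resolution_imp_t_pure:
  assumes M: "Module.module R M" and M0: "submodule M\<^sub>0 R M"
    and N: "Module.module R N" and P: "Module.module R P"
    and N0: "Module.module R N\<^sub>0" and P0: "Module.module R P\<^sub>0"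
    and row: "short_exact_row R N P M f g"
    and row0: "short_exact_row R N\<^sub>0 P\<^sub>0 (M\<lparr>carrier := M\<^sub>0\<rparr>) f\<^sub>0 g\<^sub>0"
    and i: "i \<in> module_homs R N\<^sub>0 N" "inj_on i (carrier N\<^sub>0)"
    and j: "j \<in> module_homs R P\<^sub>0 P"
    and comm: "\<And>x. x \<in> carrier N\<^sub>0 \<Longrightarrow> f (i x) = j (f\<^sub>0 x)" "\<And>x. x \<in> carrier P\<^sub>0 \<Longrightarrow> g (j x) = g\<^sub>0 x"
    and ac: "\<And>x. x \<in> carrier P\<^sub>0 \<Longrightarrow> norm_elt \<odot>\<^bsub>P\<^sub>0\<^esub> x = \<zero>\<^bsub>P\<^sub>0\<^esub> \<Longrightarrow> \<exists>y\<in>carrier P\<^sub>0. x = t \<odot>\<^bsub>P\<^sub>0\<^esub> y"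
    and summand: "direct_summand R N (i ` carrier N\<^sub>0)"
  shows "(\<lambda>x. t \<odot>\<^bsub>M\<^esub> x) ` carrier M \<inter> M\<^sub>0 = (\<lambda>x. t \<odot>\<^bsub>M\<^esub> x) ` M\<^sub>0"
proof
  interpret M: module R M by fact
  interpret N: module R N by fact
  interpret P: module R P by fact
  interpret N0: module R N\<^sub>0 by fact
  interpret P0: module R P\<^sub>0 by fact
  let ?M0 = "M\<lparr>carrier := M\<^sub>0\<rparr>"
  have M0': "Module.module R ?M0" by (rule submodule.submodule_is_module[OF M0 M])
  have f: "f \<in> module_homs R N P" "inj_on f (carrier N)" "f ` carrier N = a_kernel P M g"
    and g: "g \<in> module_homs R P M" "g ` carrier P = carrier M"
    using row by (auto simp: short_exact_row_def)
  have f0: "f\<^sub>0 \<in> module_homs R N\<^sub>0 P\<^sub>0" "inj_on f\<^sub>0 (carrier N\<^sub>0)" "f\<^sub>0 ` carrier N\<^sub>0 = a_kernel P\<^sub>0 ?M0 g\<^sub>0"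
    and g0: "g\<^sub>0 \<in> module_homs R P\<^sub>0 ?M0" "g\<^sub>0 ` carrier P\<^sub>0 = M\<^sub>0"
    using row0 by (auto simp: short_exact_row_def)
  note f_hom = module_homsD[OF N P f(1)] and g_hom = module_homsD[OF P M g(1)]
    and f0_hom = module_homsD[OF N0 P0 f0(1)] and g0_hom = module_homsD[OF P0 M0' g0(1), simplified]
    and i_hom = module_homsD[OF N0 N i(1)] and j_hom = module_homsD[OF P0 P j]
  have g0_minus: "g\<^sub>0 (x \<ominus>\<^bsub>P\<^sub>0\<^esub> y) = g\<^sub>0 x \<ominus>\<^bsub>M\<^esub> g\<^sub>0 y" if "x \<in> carrier P\<^sub>0" "y \<in> carrier P\<^sub>0" for x y
    using comm(2)[of "x \<ominus>\<^bsub>P\<^sub>0\<^esub> y"] comm(2)[OF that(1)] comm(2)[OF that(2)] that j_hom g_hom by simp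
  have ker: "\<exists>n\<in>carrier N. x = f n" if "x \<in> carrier P" "g x = \<zero>\<^bsub>M\<^esub>" for x
  proof -
    have "x \<in> f ` carrier N" unfolding f(3) using that by (simp add: a_kernel_def')
    then show ?thesis by blast
  qed
  have ker0: "\<exists>n\<in>carrier N\<^sub>0. x = f\<^sub>0 n" if "x \<in> carrier P\<^sub>0" "g\<^sub>0 x = \<zero>\<^bsub>M\<^esub>" for x
  proof -
    have "x \<in> f\<^sub>0 ` carrier N\<^sub>0" unfolding f0(3) using that by (simp add: a_kernel_def')
    then show ?thesis by blast
  qed
  have im0: "g\<^sub>0 (f\<^sub>0 n) = \<zero>\<^bsub>M\<^esub>" if "n \<in> carrier N\<^sub>0" for n
  proof -
    have "f\<^sub>0 n \<in> a_kernel P\<^sub>0 ?M0 g\<^sub>0" unfolding f0(3)[symmetric] using that by blast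
    then show ?thesis by (simp add: a_kernel_def')
  qed
  have im: "g (f n) = \<zero>\<^bsub>M\<^esub>" if "n \<in> carrier N" for n
  proof -
    have "f n \<in> a_kernel P M g" unfolding f(3)[symmetric] using that by blast
    then show ?thesis by (simp add: a_kernel_def')
  qed
  note tc = t_closed and nc = norm_elt_closed
  have nt: "norm_elt \<odot>\<^bsub>A\<^esub> (t \<odot>\<^bsub>A\<^esub> x) = \<zero>\<^bsub>A\<^esub>" if "Module.module R A" "x \<in> carrier A"
    for A :: "('g \<Rightarrow> int, 'z, 'y) module_scheme" and x
  proof -
    interpret A: module R A by fact
    have "norm_elt \<otimes>\<^bsub>R\<^esub> t = \<zero>\<^bsub>R\<^esub>" using t_norm_elt R.m_comm[OF tc nc] by simp
    then show ?thesis using A.smult_assoc1[OF nc tc that(2)] that(2) by simp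
  qed
  show "(\<lambda>x. t \<odot>\<^bsub>M\<^esub> x) ` M\<^sub>0 \<subseteq> (\<lambda>x. t \<odot>\<^bsub>M\<^esub> x) ` carrier M \<inter> M\<^sub>0"
    using M.submoduleE(1,4)[OF M0] tc by auto
  show "(\<lambda>x. t \<odot>\<^bsub>M\<^esub> x) ` carrier M \<inter> M\<^sub>0 \<subseteq> (\<lambda>x. t \<odot>\<^bsub>M\<^esub> x) ` M\<^sub>0"
  proof
    fix x assume "x \<in> (\<lambda>x. t \<odot>\<^bsub>M\<^esub> x) ` carrier M \<inter> M\<^sub>0"
    then obtain m where m: "m \<in> carrier M" "x = t \<odot>\<^bsub>M\<^esub> m" "x \<in> M\<^sub>0" by blast
    have "x \<in> g\<^sub>0 ` carrier P\<^sub>0" using g0(2) m(3) by simp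
    then obtain q0 where q0: "q0 \<in> carrier P\<^sub>0" "g\<^sub>0 q0 = x" by blast
    have "g\<^sub>0 (norm_elt \<odot>\<^bsub>P\<^sub>0\<^esub> q0) = \<zero>\<^bsub>M\<^esub>" using g0_hom(3)[OF nc q0(1)] nt[OF M m(1)] by (simp add: q0 m)
    then obtain n0 where n0: "n0 \<in> carrier N\<^sub>0" "norm_elt \<odot>\<^bsub>P\<^sub>0\<^esub> q0 = f\<^sub>0 n0"
      using ker0[of "norm_elt \<odot>\<^bsub>P\<^sub>0\<^esub> q0"] q0(1) nc by auto
    have "m \<in> g ` carrier P" using g(2) m(1) by simp
    then obtain q where q: "q \<in> carrier P" "g q = m" by blast
    define w where "w = j q0 \<ominus>\<^bsub>P\<^esub> t \<odot>\<^bsub>P\<^esub> q"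
    have wP: "w \<in> carrier P" using j_hom(1)[OF q0(1)] q(1) tc by (simp add: w_def)
    have "g w = x \<ominus>\<^bsub>M\<^esub> x"
      using g_hom(3)[OF tc q(1)] g_hom(5)[of "j q0" "t \<odot>\<^bsub>P\<^esub> q"] j_hom(1)[OF q0(1)] q tc
      by (simp add: w_def comm(2) q0 m(2))
    then have "g w = \<zero>\<^bsub>M\<^esub>" using m tc by (simp add: a_minus_def M.M.r_neg)
    then obtain n where n: "n \<in> carrier N" "w = f n" using ker[OF wP] by blast
    have "norm_elt \<odot>\<^bsub>P\<^esub> w = norm_elt \<odot>\<^bsub>P\<^esub> j q0 \<ominus>\<^bsub>P\<^esub> norm_elt \<odot>\<^bsub>P\<^esub> (t \<odot>\<^bsub>P\<^esub> q)"
      unfolding w_def by (rule P.smult_minus) (use nc tc j_hom(1)[OF q0(1)] q in auto)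
    also have "\<dots> = norm_elt \<odot>\<^bsub>P\<^esub> j q0" using nt[OF P q(1)] nc j_hom(1)[OF q0(1)] by (simp add: a_minus_def)
    also have "\<dots> = f (i n0)" using j_hom(3)[OF nc q0(1)] n0 comm(1)[OF n0(1)] by simp
    finally have "f (i n0) = f (norm_elt \<odot>\<^bsub>N\<^esub> n)" using f_hom(3)[OF nc n(1)] n(2) by simp
    then have in0: "i n0 = norm_elt \<odot>\<^bsub>N\<^esub> n"
      using inj_onD[OF f(2)] i_hom(1)[OF n0(1)] n(1) nc by simp
    \<comment> \<open>The component of \<open>n\<close> in the complement \<open>K\<close> is killed by \<open>\<sigma>\<close>, since \<open>\<sigma>n\<close> lies in the image of \<open>N\<^sub>0\<close>.\<close>
    obtain K where K: "submodule K R N" "i ` carrier N\<^sub>0 <+>\<^bsub>N\<^esub> K = carrier N" "i ` carrier N\<^sub>0 \<inter> K = {\<zero>\<^bsub>N\<^esub>}"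
      using summand by (auto simp: direct_summand_def)
    have "n \<in> i ` carrier N\<^sub>0 <+>\<^bsub>N\<^esub> K" using K(2) n(1) by simp
    then obtain n1 k where n1: "n1 \<in> carrier N\<^sub>0" "k \<in> K" "n = i n1 \<oplus>\<^bsub>N\<^esub> k"
      by (auto simp: set_add_def')
    have kN: "k \<in> carrier N" using N.submoduleE(1)[OF K(1)] n1(2) by blast
    have in1: "i n1 \<in> carrier N" using i_hom(1)[OF n1(1)] .
    have "i n0 = i (norm_elt \<odot>\<^bsub>N\<^sub>0\<^esub> n1) \<oplus>\<^bsub>N\<^esub> norm_elt \<odot>\<^bsub>N\<^esub> k"
      using i_hom(3)[OF nc n1(1)] N.smult_r_distr[OF nc in1 kN] by (simp add: in0 n1(3))
    then have eq: "i n0 \<ominus>\<^bsub>N\<^esub> i (norm_elt \<odot>\<^bsub>N\<^sub>0\<^esub> n1) = norm_elt \<odot>\<^bsub>N\<^esub> k"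
      using N.minus_unique_sum i_hom(1) n0(1) n1(1) nc kN by simp
    have "i n0 \<ominus>\<^bsub>N\<^esub> i (norm_elt \<odot>\<^bsub>N\<^sub>0\<^esub> n1) = i (n0 \<ominus>\<^bsub>N\<^sub>0\<^esub> norm_elt \<odot>\<^bsub>N\<^sub>0\<^esub> n1)"
      using i_hom(5) n0(1) n1(1) nc by simp
    then have "i (n0 \<ominus>\<^bsub>N\<^sub>0\<^esub> norm_elt \<odot>\<^bsub>N\<^sub>0\<^esub> n1) \<in> i ` carrier N\<^sub>0 \<inter> K"
      using eq N.submoduleE(4)[OF K(1) nc n1(2)] n0(1) n1(1) nc by auto
    then have "i (n0 \<ominus>\<^bsub>N\<^sub>0\<^esub> norm_elt \<odot>\<^bsub>N\<^sub>0\<^esub> n1) = i \<zero>\<^bsub>N\<^sub>0\<^esub>" using K(3) i_hom(4) by auto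
    then have "n0 \<ominus>\<^bsub>N\<^sub>0\<^esub> norm_elt \<odot>\<^bsub>N\<^sub>0\<^esub> n1 = \<zero>\<^bsub>N\<^sub>0\<^esub>"
      using inj_onD[OF i(2)] n0(1) n1(1) nc by simp
    then have n01: "n0 = norm_elt \<odot>\<^bsub>N\<^sub>0\<^esub> n1" using N0.eq_if_minus_zero n0(1) n1(1) nc by simp
    \<comment> \<open>This modification of \<open>q0\<close> has the same image in \<open>M\<^sub>0\<close> and is killed by \<open>\<sigma>\<close>.\<close>
    define u where "u = q0 \<ominus>\<^bsub>P\<^sub>0\<^esub> f\<^sub>0 n1"
    have uP: "u \<in> carrier P\<^sub>0" using q0(1) f0_hom(1)[OF n1(1)] by (simp add: u_def)
    have "norm_elt \<odot>\<^bsub>P\<^sub>0\<^esub> u = norm_elt \<odot>\<^bsub>P\<^sub>0\<^esub> q0 \<ominus>\<^bsub>P\<^sub>0\<^esub> norm_elt \<odot>\<^bsub>P\<^sub>0\<^esub> f\<^sub>0 n1"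
      unfolding u_def by (rule P0.smult_minus[OF nc q0(1) f0_hom(1)[OF n1(1)]])
    also have "\<dots> = f\<^sub>0 n0 \<ominus>\<^bsub>P\<^sub>0\<^esub> f\<^sub>0 n0" using n0(2) f0_hom(3)[OF nc n1(1)] n01 by simp
    also have "\<dots> = \<zero>\<^bsub>P\<^sub>0\<^esub>" using f0_hom(1)[OF n0(1)] by (simp add: a_minus_def P0.M.r_neg)
    finally obtain q1 where q1: "q1 \<in> carrier P\<^sub>0" "u = t \<odot>\<^bsub>P\<^sub>0\<^esub> q1" using ac[OF uP] by blast
    have "g\<^sub>0 u = x \<ominus>\<^bsub>M\<^esub> \<zero>\<^bsub>M\<^esub>"
      using g0_minus[OF q0(1) f0_hom(1)[OF n1(1)]] im0[OF n1(1)] by (simp add: u_def q0)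
    also have "\<dots> = x" using m tc by (simp add: a_minus_def)
    finally have "x = t \<odot>\<^bsub>M\<^esub> g\<^sub>0 q1" using g0_hom(3)[OF tc q1(1)] q1(2) by simp
    then show "x \<in> (\<lambda>x. t \<odot>\<^bsub>M\<^esub> x) ` M\<^sub>0" using g0_hom(1)[OF q1(1)] by blast
  qed
qed

end

section \<open>Permutation modules over the group ring\<close>

context cyclic_group_ring
begin

text \<open>
  The action of the group ring on the permutation lattice for which \<open>\<alpha>\<close> acts as \<open>shift p\<close>.
\<close>
definition ring_act :: "('g \<Rightarrow> int) \<Rightarrow> 'x perm_lattice \<Rightarrow> 'x perm_lattice" where
  "ring_act r v = (\<Sum>k<p. frag_cmul (r (apow k)) ((shift p ^^ k) v))"

lemma shift_pow_mod: "(shift p ^^ (k mod p)) v = (shift p ^^ k) v"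
proof -
  have pm: "(shift p ^^ (p * j)) w = w" for j and w :: "'a perm_lattice"
    by (induction j) (simp_all add: shift_pow_p funpow_add)
  have "(shift p ^^ k) v = (shift p ^^ (p * (k div p) + k mod p)) v" by simp
  also have "\<dots> = (shift p ^^ (k mod p)) v" by (simp only: funpow_add comp_apply pm)
  finally show ?thesis by simp
qed

lemma ring_act_gr: "ring_act (gr (apow k)) v = (shift p ^^ k) v"
proof -
  have k: "k mod p < p" using p_pos by simp
  have "ring_act (gr (apow k)) v = ring_act (gr (apow (k mod p))) v" by (simp only: apow_mod)
  also have "\<dots> = (\<Sum>i<p. if i = k mod p then (shift p ^^ i) v else 0)"
    unfolding ring_act_def
  proof (rule sum.cong[OF refl])
    fix i assume "i \<in> {..<p}"
    then have "apow i = apow (k mod p) \<longleftrightarrow> i = k mod p"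
      using inj_onD[OF apow_inj, of i "k mod p"] k by auto
    then show "frag_cmul (gr (apow (k mod p)) (apow i)) ((shift p ^^ i) v) =
        (if i = k mod p then (shift p ^^ i) v else 0)"
      by (simp add: group_ring_of_def del: apow_mod)
  qed
  also have "\<dots> = (shift p ^^ k) v" using k by (simp add: shift_pow_mod)
  finally show ?thesis .
qed

lemma ring_act_additive: "additive_on UNIV (ring_act r)"
proof -
  have "(shift p ^^ k) (v + w) = (shift p ^^ k) v + (shift p ^^ k) w"
    for k and v w :: "'a perm_lattice"
    by (induction k) (simp_all add: shift_simps)
  then show ?thesis by (simp add: additive_on_def ring_act_def frag_cmul_distrib2 sum.distrib)
qed

lemmas ring_act_simps = additive_UNIV_D[OF ring_act_additive]

lemma ring_act_zero: "ring_act \<zero>\<^bsub>R\<^esub> v = 0"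
  by (simp add: ring_act_def R_simps(2))

lemma ring_act_add: "ring_act (r \<oplus>\<^bsub>R\<^esub> s) v = ring_act r v + ring_act s v"
  by (simp add: ring_act_def R_simps(4) frag_cmul_distrib sum.distrib)

lemma ring_act_minus: "s \<in> carrier R \<Longrightarrow> ring_act (r \<ominus>\<^bsub>R\<^esub> s) v = ring_act r v - ring_act s v"
  by (simp add: ring_act_def R_minus frag_cmul_diff_distrib sum_subtractf)

lemma ring_act_one: "ring_act \<one>\<^bsub>R\<^esub> v = v"
  using ring_act_gr[of 0 v] by (simp add: R_simps(3))

lemma ring_act_mult:
  assumes "r \<in> carrier R" "s \<in> carrier R"
  shows "ring_act (r \<otimes>\<^bsub>R\<^esub> s) v = ring_act r (ring_act s v)"
  using assms(1)
proof (induction r rule: R_induct)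
  case zero
  then show ?case using assms(2) by (simp add: ring_act_zero)
next
  case (diff r r')
  have "(r \<ominus>\<^bsub>R\<^esub> r') \<otimes>\<^bsub>R\<^esub> s = (r \<otimes>\<^bsub>R\<^esub> s) \<ominus>\<^bsub>R\<^esub> (r' \<otimes>\<^bsub>R\<^esub> s)"
    using diff assms(2) by (simp add: a_minus_def R.l_distr R.l_minus)
  then show ?case using diff assms(2) by (simp add: ring_act_minus)
next
  case (gr k)
  show ?case
    using assms(2)
  proof (induction s rule: R_induct)
    case zero
    then show ?case using gr_closed[OF apow_closed] by (simp add: ring_act_zero ring_act_simps)
  next
    case (diff s s')
    note c = gr_closed[OF apow_closed, of k]
    have "gr (apow k) \<otimes>\<^bsub>R\<^esub> (s \<ominus>\<^bsub>R\<^esub> s') = (gr (apow k) \<otimes>\<^bsub>R\<^esub> s) \<ominus>\<^bsub>R\<^esub> (gr (apow k) \<otimes>\<^bsub>R\<^esub> s')"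
      using diff c by (simp add: a_minus_def R.r_distr R.r_minus)
    then show ?case using diff c by (simp add: ring_act_minus ring_act_simps)
  next
    case (gr j)
    have "gr (apow k) \<otimes>\<^bsub>R\<^esub> gr (apow j) = gr (apow (k + j))"
      by (simp only: gr_mult[OF apow_closed apow_closed] C.nat_pow_mult[OF \<alpha>])
    then show ?case by (simp add: ring_act_gr funpow_add)
  qed
qed

lemma ring_act_closed:
  assumes "add_subgroup E" "\<And>v. v \<in> E \<Longrightarrow> shift p v \<in> E" "v \<in> E"
  shows "ring_act r v \<in> E"
proof -
  have "(shift p ^^ k) v \<in> E" for k by (induction k) (auto simp: assms)
  then show ?thesis unfolding ring_act_def by (intro add_subgroup_sum add_subgroup_frag_cmul assms(1))
qed

lemma ring_act_equivariant:
  assumes F: "additive_on UNIV F" "\<And>v. F (shift p v) = shift p (F v)" and r: "r \<in> carrier R"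
  shows "F (ring_act r v) = ring_act r (F v)"
  using r
proof (induction r rule: R_induct)
  case (gr k)
  have "F ((shift p ^^ k) v) = (shift p ^^ k) (F v)" by (induction k) (simp_all add: F(2))
  then show ?case by (simp add: ring_act_gr)
qed (simp_all add: ring_act_zero ring_act_minus additive_UNIV_D[OF F(1)])

text \<open>
  The permutation lattice as a module over the group ring, transported to the type \<open>'b\<close> along an
  injection \<open>h\<close>. The multiplicative part of the module record plays no role.
\<close>
definition perm_mod :: "('x perm_lattice \<Rightarrow> 'b) \<Rightarrow> ('g \<Rightarrow> int, 'b) module" where
  "perm_mod h = \<lparr>carrier = range h, monoid.mult = undefined, one = undefined, ring.zero = h 0,
    ring.add = (\<lambda>x y. h (the_inv h x + the_inv h y)), smult = (\<lambda>r x. h (ring_act r (the_inv h x)))\<rparr>"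

lemma perm_mod_simps [simp]:
  assumes "inj h"
  shows "carrier (perm_mod h) = range h" "\<zero>\<^bsub>perm_mod h\<^esub> = h 0"
    "h v \<oplus>\<^bsub>perm_mod h\<^esub> h w = h (v + w)" "r \<odot>\<^bsub>perm_mod h\<^esub> h v = h (ring_act r v)"
  using assms by (simp_all add: perm_mod_def the_inv_f_f)

lemma perm_mod_module:
  assumes h: "inj h"
  shows "Module.module R (perm_mod h)"
proof (rule moduleI)
  show "cring R" by unfold_locales
  show "abelian_group (perm_mod h)"
  proof (rule abelian_groupI)
    fix x assume "x \<in> carrier (perm_mod h)"
    then obtain v where "x = h v" using h by auto
    then show "\<exists>y\<in>carrier (perm_mod h). y \<oplus>\<^bsub>perm_mod h\<^esub> x = \<zero>\<^bsub>perm_mod h\<^esub>"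
      using h by (intro bexI[of _ "h (- v)"]) simp_all
  qed (use h in \<open>auto simp: ac_simps\<close>)
qed (use h in \<open>auto simp: ring_act_add ring_act_simps ring_act_mult ring_act_one\<close>)

lemma perm_mod_minus:
  assumes h: "inj h"
  shows "\<ominus>\<^bsub>perm_mod h\<^esub> h v = h (- v)"
proof -
  interpret module R "perm_mod h" by (rule perm_mod_module[OF h])
  show ?thesis by (rule M.minus_equality) (use h in simp_all)
qed

lemma perm_mod_finsum:
  assumes h: "inj h" and A: "finite A"
  shows "(\<Oplus>\<^bsub>perm_mod h\<^esub>x\<in>A. h (F x)) = h (\<Sum>x\<in>A. F x)"
proof -
  interpret module R "perm_mod h" by (rule perm_mod_module[OF h])
  from A show ?thesis
  proof (induction A rule: finite_induct)
    case (insert x A)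
    then have "(\<Oplus>\<^bsub>perm_mod h\<^esub>x\<in>insert x A. h (F x)) = h (F x) \<oplus>\<^bsub>perm_mod h\<^esub> (\<Oplus>\<^bsub>perm_mod h\<^esub>x\<in>A. h (F x))"
      by (intro M.finsum_insert) (use h in auto)
    then show ?case using insert h by simp
  qed (use h in simp)
qed

lemma perm_mod_submodule:
  assumes h: "inj h" and E: "add_subgroup E" "\<And>v. v \<in> E \<Longrightarrow> shift p v \<in> E"
  shows "submodule (h ` E) R (perm_mod h)"
proof -
  interpret module R "perm_mod h" by (rule perm_mod_module[OF h])
  show ?thesis
    by (rule submoduleI)
       (use h add_subgroupD[OF E(1)] ring_act_closed[OF E] in \<open>auto simp: perm_mod_minus[OF h]\<close>)
qed

lemma perm_mod_hom:
  assumes h: "inj h" "inj h'" and F: "additive_on UNIV F" "\<And>v. F (shift p v) = shift p (F v)"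
  shows "(\<lambda>x. h' (F (the_inv h x))) \<in> module_homs R (perm_mod h) (perm_mod h')"
  using h by (auto simp: module_homs_def hom_def the_inv_f_f additive_UNIV_D[OF F(1)]
      ring_act_equivariant[OF F])

lemma perm_mod_hom_to:
  fixes h :: "'x perm_lattice \<Rightarrow> 'b"
  assumes M: "Module.module R M" and h: "inj h"
    and g: "g \<in> hom (free_Abelian_group UNIV) (add_monoid M)" "\<And>v. g (shift p v) = gr \<alpha> \<odot>\<^bsub>M\<^esub> g v"
  shows "(\<lambda>x. g (the_inv h x)) \<in> module_homs R (perm_mod h) M"
proof -
  interpret M: module R M by fact
  interpret g: group_hom "free_Abelian_group (UNIV :: (nat \<times> 'x) set)" "add_monoid M" g
    using g(1) by (simp add: group_hom_def group_hom_axioms_def M.a_group)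
  have gM: "g v \<in> carrier M" for v using g.hom_closed[of v] by simp
  have g_add: "g (v + w) = g v \<oplus>\<^bsub>M\<^esub> g w" for v w using g.hom_mult[of v w] by simp
  have g0: "g 0 = \<zero>\<^bsub>M\<^esub>" using g.hom_one by simp
  have g_diff: "g (v - w) = g v \<ominus>\<^bsub>M\<^esub> g w" for v w
    using M.minus_unique_sum[OF gM gM gM, of v w "v - w"] g_add[of w "v - w"] by simp
  have "g (ring_act r v) = r \<odot>\<^bsub>M\<^esub> g v" if "r \<in> carrier R" for r v
    using that
  proof (induction r rule: R_induct)
    case zero
    then show ?case by (simp add: ring_act_zero g0 gM)
  next
    case (gr k)
    have "g ((shift p ^^ k) v) = gr (apow k) \<odot>\<^bsub>M\<^esub> g v"
    proof (induction k)
      case 0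
      then show ?case using gM by (simp add: R_simps(3)[symmetric])
    next
      case (Suc k)
      then show ?case
        unfolding gr_apow_Suc
        using M.smult_assoc1[OF gr_closed[OF \<alpha>] gr_closed[OF apow_closed] gM] by (simp add: g(2))
    qed
    then show ?case by (simp add: ring_act_gr)
  next
    case (diff r s)
    moreover have "(r \<ominus>\<^bsub>R\<^esub> s) \<odot>\<^bsub>M\<^esub> g v = r \<odot>\<^bsub>M\<^esub> g v \<ominus>\<^bsub>M\<^esub> s \<odot>\<^bsub>M\<^esub> g v"
      using diff gM by (simp add: a_minus_def M.smult_l_distr M.smult_l_minus)
    ultimately show ?case by (simp add: ring_act_minus g_diff)
  qed
  then show ?thesis
    using h gM by (auto simp: module_homs_def hom_def the_inv_f_f g_add)
qed

text \<open>
  The span of the basis elements with first component in \<open>S\<close>.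
\<close>
definition keys_in :: "nat set \<Rightarrow> 'x perm_lattice set" where
  "keys_in S = {v. Poly_Mapping.keys v \<subseteq> S \<times> UNIV}"

lemma keys_in_iff: "v \<in> keys_in S \<longleftrightarrow> (\<forall>n x. n \<notin> S \<longrightarrow> coeff_at v (n, x) = 0)"
  by (auto simp: keys_in_def in_keys_iff)

lemma keys_in_subgroup: "add_subgroup (keys_in S)"
  by (simp add: add_subgroup_def keys_in_iff lookup_minus)

lemma keys_in_shift:
  assumes "v \<in> keys_in S" "\<And>n. rot p n \<in> S \<longleftrightarrow> n \<in> S"
  shows "shift p v \<in> keys_in S"
proof -
  have "Poly_Mapping.keys v \<subseteq> S \<times> UNIV" using assms(1) by (simp add: keys_in_def)
  then show ?thesis
  proof (induction v rule: frag_induction)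
    case (one z)
    then show ?case by (cases z) (auto simp: shift_of keys_in_def assms(2))
  qed (auto simp: shift_simps add_subgroupD[OF keys_in_subgroup])
qed

lemma lookup_gact_basis:
  "coeff_at (ring_act r (frag_of (0, y))) (n, x) = (if n < p \<and> x = y then r (apow n) else 0)"
proof -
  have "coeff_at (ring_act r (frag_of (0, y))) (n, x)
      = (\<Sum>k<p. r (apow k) * (if (n, x) = ((rot p ^^ k) 0, y) then 1 else 0))"
    by (simp add: ring_act_def lookup_sum shift_pow_of)
  also have "\<dots> = (\<Sum>k<p. if k = n then (if x = y then r (apow n) else 0) else 0)"
    by (rule sum.cong) (auto simp: rot_pow)
  also have "\<dots> = (if n < p \<and> x = y then r (apow n) else 0)" by simp
  finally show ?thesis .
qed

text \<open>
  The elements \<open>(0, y)\<close> represent the free orbits and form a basis.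
\<close>
lemma perm_mod_free_part:
  fixes h :: "'x perm_lattice \<Rightarrow> 'b"
  assumes h: "inj h"
  shows "free_module R (perm_mod h\<lparr>carrier := h ` keys_in {..<p}\<rparr>)"
proof -
  interpret module R "perm_mod h" by (rule perm_mod_module[OF h])
  let ?S = "h ` keys_in {..<p}"
  have rot: "rot p n \<in> {..<p} \<longleftrightarrow> n \<in> {..<p}" for n by (simp add: rot_less_iff)
  have S: "submodule ?S R (perm_mod h)"
    by (rule perm_mod_submodule[OF h keys_in_subgroup keys_in_shift[OF _ rot]])
  define e where "e y = h (frag_of (0, y))" for y :: 'x
  have e_inj: "e x = e y \<longleftrightarrow> x = y" for x y using h by (auto simp: e_def inj_eq frag_of_eq)
  have eS: "e y \<in> ?S" for y using p_pos by (auto simp: e_def keys_in_def)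
  define Q where "Q x c \<longleftrightarrow> (\<forall>b\<in>range e. c b \<in> carrier R) \<and> (\<forall>b. b \<notin> range e \<longrightarrow> c b = \<zero>\<^bsub>R\<^esub>) \<and>
      finite {b. c b \<noteq> \<zero>\<^bsub>R\<^esub>} \<and>
      x = (\<Oplus>\<^bsub>perm_mod h\<lparr>carrier := ?S\<rparr>\<^esub>b\<in>{b. c b \<noteq> \<zero>\<^bsub>R\<^esub>}. c b \<odot>\<^bsub>perm_mod h\<lparr>carrier := ?S\<rparr>\<^esub> b)" for x c
  \<comment> \<open>The coefficient of \<open>e y\<close> in a representation of \<open>h v\<close> is read off from \<open>v\<close>: its value at \<open>\<alpha>\<^sup>n\<close>
    is the coordinate of \<open>v\<close> at \<open>(n, y)\<close>.\<close>
  have Q: "Q (h v) c \<longleftrightarrow> (\<forall>b\<in>range e. c b \<in> carrier R) \<and> (\<forall>b. b \<notin> range e \<longrightarrow> c b = \<zero>\<^bsub>R\<^esub>) \<and>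
      finite {y. c (e y) \<noteq> \<zero>\<^bsub>R\<^esub>} \<and> (\<forall>n<p. \<forall>y. coeff_at v (n, y) = c (e y) (apow n))"
    if v: "v \<in> keys_in {..<p}" for v c
  proof (cases "(\<forall>b\<in>range e. c b \<in> carrier R) \<and> (\<forall>b. b \<notin> range e \<longrightarrow> c b = \<zero>\<^bsub>R\<^esub>)")
    case True
    define Y where "Y = {y. c (e y) \<noteq> \<zero>\<^bsub>R\<^esub>}"
    have supp: "{b. c b \<noteq> \<zero>\<^bsub>R\<^esub>} = e ` Y" using True by (auto simp: Y_def)
    have inj: "inj_on e Y" by (auto simp: inj_on_def e_inj)
    have fin: "finite (e ` Y) \<longleftrightarrow> finite Y" using finite_image_iff[OF inj] .
    have "h v = (\<Oplus>\<^bsub>perm_mod h\<lparr>carrier := ?S\<rparr>\<^esub>b\<in>e ` Y. c b \<odot>\<^bsub>perm_mod h\<lparr>carrier := ?S\<rparr>\<^esub> b) \<longleftrightarrow>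
        (\<forall>n<p. \<forall>y. coeff_at v (n, y) = c (e y) (apow n))" if fY: "finite Y"
    proof -
      have cS: "c (e y) \<odot>\<^bsub>perm_mod h\<^esub> e y \<in> ?S" for y
        using submoduleE(4)[OF S, of "c (e y)" "e y"] True eS by simp
      have "(\<Oplus>\<^bsub>perm_mod h\<lparr>carrier := ?S\<rparr>\<^esub>b\<in>e ` Y. c b \<odot>\<^bsub>perm_mod h\<lparr>carrier := ?S\<rparr>\<^esub> b)
          = (\<Oplus>\<^bsub>perm_mod h\<^esub>b\<in>e ` Y. c b \<odot>\<^bsub>perm_mod h\<^esub> b)"
        using submodule_finsum[OF S, of "\<lambda>b. c b \<odot>\<^bsub>perm_mod h\<^esub> b" "e ` Y"] cS fY by auto
      also have "\<dots> = (\<Oplus>\<^bsub>perm_mod h\<^esub>y\<in>Y. c (e y) \<odot>\<^bsub>perm_mod h\<^esub> e y)"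
        by (rule M.finsum_reindex) (use inj cS submoduleE(1)[OF S] in auto)
      also have "\<dots> = h (\<Sum>y\<in>Y. ring_act (c (e y)) (frag_of (0, y)))"
        using perm_mod_finsum[OF h fY, of "\<lambda>y. ring_act (c (e y)) (frag_of (0, y))"] h by (simp add: e_def)
      finally have sum: "(\<Oplus>\<^bsub>perm_mod h\<lparr>carrier := ?S\<rparr>\<^esub>b\<in>e ` Y. c b \<odot>\<^bsub>perm_mod h\<lparr>carrier := ?S\<rparr>\<^esub> b)
          = h (\<Sum>y\<in>Y. ring_act (c (e y)) (frag_of (0, y)))" .
      have look: "coeff_at (\<Sum>y\<in>Y. ring_act (c (e y)) (frag_of (0, y))) (n, x)
          = (if n < p then c (e x) (apow n) else 0)" for n x
      proof -
        have "coeff_at (\<Sum>y\<in>Y. ring_act (c (e y)) (frag_of (0, y))) (n, x)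
            = (\<Sum>y\<in>Y. if y = x then (if n < p then c (e x) (apow n) else 0) else 0)"
          unfolding lookup_sum lookup_gact_basis by (rule sum.cong) auto
        also have "\<dots> = (if x \<in> Y then (if n < p then c (e x) (apow n) else 0) else 0)"
          using fY by simp
        also have "\<dots> = (if n < p then c (e x) (apow n) else 0)"
          by (auto simp: Y_def R_simps(2))
        finally show ?thesis .
      qed
      have "h v = h (\<Sum>y\<in>Y. ring_act (c (e y)) (frag_of (0, y))) \<longleftrightarrow>
          (\<forall>n x. coeff_at v (n, x) = (if n < p then c (e x) (apow n) else 0))"
        using h by (simp add: inj_eq poly_mapping_eq_iff fun_eq_iff look)
      also have "\<dots> \<longleftrightarrow> (\<forall>n<p. \<forall>y. coeff_at v (n, y) = c (e y) (apow n))"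
        using v by (auto simp: keys_in_iff)
      finally show ?thesis unfolding sum .
    qed
    then show ?thesis using True unfolding Q_def supp fin Y_def[symmetric] by blast
  qed (auto simp: Q_def)
  have "\<exists>!c. Q x c" if x: "x \<in> ?S" for x
  proof -
    obtain v where v: "v \<in> keys_in {..<p}" "x = h v" using x by blast
    define lg where "lg = the_inv_into {..<p} apow"
    have lg: "lg (apow n) = n" if "n < p" for n
      unfolding lg_def using the_inv_into_f_f[OF apow_inj] that by simp
    define c where "c b = (if b \<in> range e then
        (\<lambda>g. if g \<in> carrier C then coeff_at v (lg g, the_inv e b) else 0) else \<zero>\<^bsub>R\<^esub>)" for b
    have ie: "the_inv e (e y) = y" for y by (rule the_inv_f_f) (auto simp: inj_def e_inj)
    have ce': "c (e y) g = (if g \<in> carrier C then coeff_at v (lg g, y) else 0)" for y g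
      by (simp add: c_def ie)
    have cR: "c b \<in> carrier R" for b by (simp add: c_def R_simps)
    have c0: "c b = \<zero>\<^bsub>R\<^esub>" if "b \<notin> range e" for b using that by (simp add: c_def)
    have ce: "c (e y) (apow n) = coeff_at v (n, y)" if "n < p" for y n
      using apow_closed by (simp add: ce' lg that)
    show ?thesis
    proof (rule ex1I)
      have "{y. c (e y) \<noteq> \<zero>\<^bsub>R\<^esub>} \<subseteq> snd ` Poly_Mapping.keys v"
      proof
        fix y assume "y \<in> {y. c (e y) \<noteq> \<zero>\<^bsub>R\<^esub>}"
        then have "c (e y) \<noteq> (\<lambda>g. 0)" by (simp add: R_simps(2))
        then obtain g where "c (e y) g \<noteq> 0" by (meson ext)
        then have "coeff_at v (lg g, y) \<noteq> 0" unfolding ce' by presburger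
        then have "(lg g, y) \<in> Poly_Mapping.keys v" by (simp add: in_keys_iff)
        from imageI[OF this, of snd] show "y \<in> snd ` Poly_Mapping.keys v" by simp
      qed
      then have "finite {y. c (e y) \<noteq> \<zero>\<^bsub>R\<^esub>}" by (rule finite_subset) simp
      then show "Q x c"
        unfolding v(2) Q[OF v(1)] using ce cR c0 by simp
      fix d assume "Q x d"
      then have d: "\<forall>b\<in>range e. d b \<in> carrier R" "\<forall>b. b \<notin> range e \<longrightarrow> d b = \<zero>\<^bsub>R\<^esub>"
        "\<forall>n<p. \<forall>y. coeff_at v (n, y) = d (e y) (apow n)"
        unfolding v(2) Q[OF v(1)] by auto
      show "d = c"
      proof (intro ext)
        fix b g
        show "d b g = c b g"
        proof (cases "b \<in> range e \<and> g \<in> carrier C")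
          case True
          then obtain y n where "b = e y" "g = apow n" "n < p" by (auto simp: carrier_C)
          then show ?thesis using ce d(3) by simp
        next
          case False
          then show ?thesis
            using d(1,2) cR[of b] c0[of b] by (cases "b \<in> range e") (auto simp: R_simps)
        qed
      qed
    qed
  qed
  then have "\<forall>x\<in>carrier (perm_mod h\<lparr>carrier := ?S\<rparr>). \<exists>!c. Q x c" by simp
  moreover have "range e \<subseteq> carrier (perm_mod h\<lparr>carrier := ?S\<rparr>)" using eS by auto
  ultimately show ?thesis unfolding free_module_def Q_def by blast
qed

lemma perm_mod_trivial_part:
  fixes h :: "'x perm_lattice \<Rightarrow> 'b"
  assumes h: "inj h"
  shows "trivial_module \<alpha> (perm_mod h\<lparr>carrier := h ` keys_in {p..}\<rparr>)"
    and "additively_free (perm_mod h\<lparr>carrier := h ` keys_in {p..}\<rparr>)"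
proof -
  let ?T = "perm_mod h\<lparr>carrier := h ` keys_in {p..}\<rparr>"
  have fix_shift: "shift p v = v" if "v \<in> keys_in {p..}" for v :: "'x perm_lattice"
  proof -
    have "Poly_Mapping.keys v \<subseteq> {p..} \<times> UNIV" using that by (simp add: keys_in_def)
    then show ?thesis
    proof (induction v rule: frag_induction)
      case (one z)
      then show ?case by (cases z) (auto simp: shift_of rot_def)
    qed (simp_all add: shift_simps)
  qed
  have "ring_act (gr \<alpha>) v = shift p v" for v :: "'x perm_lattice"
    using ring_act_gr[of 1 v] \<alpha> by simp
  then show "trivial_module \<alpha> ?T"
    using h fix_shift by (auto simp: trivial_module_def)
  let ?K = "{p..} \<times> (UNIV :: 'x set)"
  have "the_inv h \<in> iso (add_monoid ?T) (free_Abelian_group ?K)"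
    unfolding iso_def
  proof (intro CollectI conjI homI)
    have cT: "carrier (add_monoid ?T) = h ` keys_in {p..}"
      and cK: "carrier (free_Abelian_group ?K) = keys_in {p..}"
      by (simp_all add: free_Abelian_group_def keys_in_def)
    have ih: "the_inv h (h v) = v" for v using h by (rule the_inv_f_f)
    show "the_inv h x \<in> carrier (free_Abelian_group ?K)" if "x \<in> carrier (add_monoid ?T)" for x
      using that unfolding cT cK by (elim imageE) (simp only: ih)
    show "the_inv h (x \<otimes>\<^bsub>add_monoid ?T\<^esub> y) = the_inv h x \<otimes>\<^bsub>free_Abelian_group ?K\<^esub> the_inv h y"
      if "x \<in> carrier (add_monoid ?T)" "y \<in> carrier (add_monoid ?T)" for x y
      using that unfolding cT by (elim imageE) (simp add: ih h)
    have "bij_betw (the_inv h) (h ` keys_in {p..}) (keys_in {p..})"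
      by (rule bij_betw_byWitness[where f' = h]) (auto simp: ih)
    then show "bij_betw (the_inv h) (carrier (add_monoid ?T)) (carrier (free_Abelian_group ?K))"
      unfolding cT cK .
  qed
  then have "add_monoid ?T \<cong> free_Abelian_group ?K" by (auto simp: is_iso_def)
  moreover have "?K \<approx> (\<lambda>z. h (frag_of z)) ` ?K"
    unfolding eqpoll_def bij_betw_def
    by (intro exI[of _ "\<lambda>z. h (frag_of z)"] conjI inj_onI) (simp_all add: inj_eq[OF h] frag_of_eq)
  ultimately have "add_monoid ?T \<cong> free_Abelian_group ((\<lambda>z. h (frag_of z)) ` ?K)"
    using isomorphic_free_Abelian_groups iso_trans by blast
  then show "additively_free ?T" unfolding additively_free_def by blast
qed

lemma perm_mod_sum_of_free_and_trivial:
  fixes h :: "'x perm_lattice \<Rightarrow> 'b"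
  assumes h: "inj h"
  shows "sum_of_free_and_trivial R \<alpha> (perm_mod h)"
proof -
  interpret module R "perm_mod h" by (rule perm_mod_module[OF h])
  let ?S = "h ` keys_in {..<p}" and ?T = "h ` keys_in {p..}"
  have rotS: "rot p n \<in> {..<p} \<longleftrightarrow> n \<in> {..<p}" and rotT: "rot p n \<in> {p..} \<longleftrightarrow> n \<in> {p..}" for n
    by (auto simp: rot_less_iff simp flip: not_less)
  have S: "submodule ?S R (perm_mod h)"
    by (rule perm_mod_submodule[OF h keys_in_subgroup keys_in_shift[OF _ rotS]])
  have T: "submodule ?T R (perm_mod h)"
    by (rule perm_mod_submodule[OF h keys_in_subgroup keys_in_shift[OF _ rotT]])
  have int: "?S \<inter> ?T = {\<zero>\<^bsub>perm_mod h\<^esub>}"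
  proof -
    have "v = 0" if "v \<in> keys_in {..<p}" "v \<in> keys_in {p..}" for v :: "'x perm_lattice"
    proof (rule poly_mapping_eqI)
      fix z show "coeff_at v z = coeff_at 0 z"
        using that by (cases z) (auto simp: keys_in_iff not_less)
    qed
    moreover have "0 \<in> keys_in {..<p}" "0 \<in> (keys_in {p..} :: 'x perm_lattice set)"
      by (simp_all add: keys_in_iff)
    ultimately show ?thesis using h by (auto simp: inj_eq)
  qed
  have "?S \<noteq> ?T"
  proof
    assume "?S = ?T"
    moreover have "h (frag_of (0, undefined)) \<in> ?S" using p_pos by (auto simp: keys_in_def)
    ultimately have "h (frag_of (0, undefined)) \<in> ?S \<inter> ?T" by simp
    then show False using int h by (auto simp: inj_eq)
  qed
  moreover have "\<exists>s\<in>?S. \<exists>u\<in>?T. x = s \<oplus>\<^bsub>perm_mod h\<^esub> u" if x: "x \<in> carrier (perm_mod h)" for x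
  proof -
    obtain v where v: "x = h v" using x h by auto
    have "Poly_Mapping.keys v \<subseteq> ({..<p} \<times> UNIV) \<union> ({p..} \<times> UNIV)" by (auto simp: not_less)
    then obtain s u where su: "s + u = v" "s \<in> keys_in {..<p}" "u \<in> keys_in {p..}"
      unfolding keys_in_def by (rule frag_split) blast
    have "x = h s \<oplus>\<^bsub>perm_mod h\<^esub> h u" using h by (simp add: v su(1))
    then show ?thesis using su(2,3) by blast
  qed
  ultimately have "internal_direct_sum R (perm_mod h) {?S, ?T}"
    using internal_direct_sum_pair[OF S T _ int] by blast
  then show ?thesis
    unfolding sum_of_free_and_trivial_def
    using perm_mod_free_part[OF h] perm_mod_trivial_part[OF h] by blast
qed


text \<open>
  The lattices of \<open>relative_resolution\<close> are countable, so they embed into the infinite type \<open>'b\<close>.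
\<close>
lemma resolution_of_t_pure:
  fixes M :: "('g \<Rightarrow> int, 'a) module"
  assumes M: "Module.module R M" and M0: "submodule M\<^sub>0 R M" and countable: "countable (carrier M)"
    and inf: "infinite (UNIV :: 'b set)"
    and pure: "(\<lambda>x. t \<odot>\<^bsub>M\<^esub> x) ` carrier M \<inter> M\<^sub>0 = (\<lambda>x. t \<odot>\<^bsub>M\<^esub> x) ` M\<^sub>0"
  shows "\<exists>(N :: ('g \<Rightarrow> int, 'b) module) (P :: ('g \<Rightarrow> int, 'b) module)
       (N\<^sub>0 :: ('g \<Rightarrow> int, 'b) module) (P\<^sub>0 :: ('g \<Rightarrow> int, 'b) module)
       f g f\<^sub>0 g\<^sub>0 i j.
        Module.module R N \<and> Module.module R P \<and>
        Module.module R N\<^sub>0 \<and> Module.module R P\<^sub>0 \<and>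
        short_exact_row R N P M f g \<and>
        short_exact_row R N\<^sub>0 P\<^sub>0 (M\<lparr>carrier := M\<^sub>0\<rparr>) f\<^sub>0 g\<^sub>0 \<and>
        i \<in> module_homs R N\<^sub>0 N \<and> inj_on i (carrier N\<^sub>0) \<and>
        j \<in> module_homs R P\<^sub>0 P \<and> inj_on j (carrier P\<^sub>0) \<and>
        (\<forall>x\<in>carrier N\<^sub>0. f (i x) = j (f\<^sub>0 x)) \<and>
        (\<forall>x\<in>carrier P\<^sub>0. g (j x) = g\<^sub>0 x) \<and>
        sum_of_free_and_trivial R \<alpha> N \<and> sum_of_free_and_trivial R \<alpha> P \<and>
        sum_of_free_and_trivial R \<alpha> N\<^sub>0 \<and> sum_of_free_and_trivial R \<alpha> P\<^sub>0 \<and>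
        direct_summand R N (i ` carrier N\<^sub>0) \<and> direct_summand R P (j ` carrier P\<^sub>0)"
proof -
  interpret M: module R M by fact
  define act where "act x = gr \<alpha> \<odot>\<^bsub>M\<^esub> x" for x
  have ga: "gr \<alpha> \<in> carrier R" using gr_closed \<alpha> .
  have act_hom: "act \<in> hom (add_monoid M) (add_monoid M)"
    using ga by (auto simp: act_def hom_def M.smult_r_distr)
  have "(act ^^ k) x = gr (apow k) \<odot>\<^bsub>M\<^esub> x" if "x \<in> carrier M" for k x
  proof (induction k)
    case 0
    then show ?case using that by (simp add: R_simps(3)[symmetric])
  next
    case (Suc k)
    then show ?case
      unfolding gr_apow_Suc
      using M.smult_assoc1[OF ga gr_closed[OF apow_closed] that] by (simp add: act_def)
  qed
  from this[of _ p] have act_p: "\<forall>x\<in>carrier (add_monoid M). (act ^^ p) x = x"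
    by (simp add: apow_p R_simps(3)[symmetric])
  have diff: "act x \<otimes>\<^bsub>add_monoid M\<^esub> inv\<^bsub>add_monoid M\<^esub> x = t \<odot>\<^bsub>M\<^esub> x" if "x \<in> carrier M" for x
    using t_smult[OF M that] by (simp add: act_def a_minus_def a_inv_def)
  have M0M: "x \<in> carrier M" if "x \<in> M\<^sub>0" for x using M.submoduleE(1)[OF M0] that by blast
  have act_M0: "act x \<in> M\<^sub>0" if "x \<in> M\<^sub>0" for x
    using M.submoduleE(4)[OF M0 ga that] by (simp add: act_def)
  have cl: "\<exists>y\<in>M\<^sub>0. act y \<otimes>\<^bsub>add_monoid M\<^esub> inv\<^bsub>add_monoid M\<^esub> y = act x \<otimes>\<^bsub>add_monoid M\<^esub> inv\<^bsub>add_monoid M\<^esub> x"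
    if x: "x \<in> carrier (add_monoid M)" "act x \<otimes>\<^bsub>add_monoid M\<^esub> inv\<^bsub>add_monoid M\<^esub> x \<in> M\<^sub>0" for x
  proof -
    have xM: "x \<in> carrier M" using x(1) by simp
    have "t \<odot>\<^bsub>M\<^esub> x \<in> (\<lambda>x. t \<odot>\<^bsub>M\<^esub> x) ` carrier M \<inter> M\<^sub>0" using x(2) xM by (simp only: diff) blast
    then have "t \<odot>\<^bsub>M\<^esub> x \<in> (\<lambda>x. t \<odot>\<^bsub>M\<^esub> x) ` M\<^sub>0" by (simp only: pure)
    then obtain y where "y \<in> M\<^sub>0" "t \<odot>\<^bsub>M\<^esub> x = t \<odot>\<^bsub>M\<^esub> y" by blast
    then show ?thesis using diff xM M0M by metis
  qed
  have cnt: "countable (carrier (add_monoid M))" using countable by simp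
  show ?thesis
  proof (rule relative_resolution[OF prime_p M.a_comm_group cnt act_hom act_p
      submodule.axioms(1)[OF M0] act_M0 cl])
    fix F\<^sub>0 :: "(nat \<times> nat) perm_lattice \<Rightarrow> (nat \<times> nat) perm_lattice" and G\<^sub>0
      and F :: "(bool \<times> nat \<times> nat) perm_lattice \<Rightarrow> (bool \<times> nat \<times> nat) perm_lattice" and G
    assume F0: "additive_on UNIV F\<^sub>0" "\<And>v. F\<^sub>0 (shift p v) = shift p (F\<^sub>0 v)" "inj F\<^sub>0"
      and G0: "G\<^sub>0 \<in> hom (free_Abelian_group UNIV) (add_monoid M)" "\<And>v. G\<^sub>0 (shift p v) = act (G\<^sub>0 v)"
        "range G\<^sub>0 = M\<^sub>0"
      and FG0: "range F\<^sub>0 = {v. G\<^sub>0 v = \<one>\<^bsub>add_monoid M\<^esub>}"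
      and F: "additive_on UNIV F" "\<And>v. F (shift p v) = shift p (F v)" "inj F"
      and G: "G \<in> hom (free_Abelian_group UNIV) (add_monoid M)" "\<And>v. G (shift p v) = act (G v)"
        "range G = carrier (add_monoid M)"
      and FG: "range F = {v. G v = \<one>\<^bsub>add_monoid M\<^esub>}"
      and sq: "\<And>v. F (into True v) = into True (F\<^sub>0 v)" "\<And>v. G (into True v) = G\<^sub>0 v"
    obtain e :: "nat \<Rightarrow> 'b" where e: "inj e" using inf infinite_countable_subset by blast
    define h :: "(nat \<times> nat) perm_lattice \<Rightarrow> 'b" where "h v = e (to_nat_on UNIV v)" for v
    define k :: "(bool \<times> nat \<times> nat) perm_lattice \<Rightarrow> 'b" where "k v = e (to_nat_on UNIV v)" for v
    have h: "inj h" and k: "inj k"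
      using inj_on_to_nat_on[OF countable_lattice] by (auto simp: h_def k_def inj_on_def inj_eq[OF e])
    have ih: "the_inv h (h v) = v" and ik: "the_inv k (k w) = w" for v w
      using h k by (simp_all add: the_inv_f_f)
    let ?N = "perm_mod k" and ?L = "perm_mod h"
    have mN: "Module.module R ?N" and mN0: "Module.module R ?L"
      using h k by (simp_all add: perm_mod_module)
    define f where "f x = k (F (the_inv k x))" for x
    define f\<^sub>0 where "f\<^sub>0 x = h (F\<^sub>0 (the_inv h x))" for x
    define g where "g x = G (the_inv k x)" for x
    define g\<^sub>0 where "g\<^sub>0 x = G\<^sub>0 (the_inv h x)" for x
    define i where "i x = k (into True (the_inv h x))" for x
    have f_hom: "f \<in> module_homs R ?N ?N" using perm_mod_hom[OF k k F(1,2)] by (simp add: f_def[abs_def])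
    have f0_hom: "f\<^sub>0 \<in> module_homs R ?L ?L" using perm_mod_hom[OF h h F0(1,2)] by (simp add: f\<^sub>0_def[abs_def])
    have i_hom: "i \<in> module_homs R ?L ?N"
      using perm_mod_hom[OF h k into_additive into_shift] by (simp add: i_def[abs_def])
    have g_hom: "g \<in> module_homs R ?N M"
      using perm_mod_hom_to[OF M k G(1)] G(2) by (simp add: g_def[abs_def] act_def)
    have "g\<^sub>0 \<in> module_homs R ?L M"
      using perm_mod_hom_to[OF M h G0(1)] G0(2) by (simp add: g\<^sub>0_def[abs_def] act_def)
    moreover have "g\<^sub>0 x \<in> M\<^sub>0" for x using G0(3) by (auto simp: g\<^sub>0_def)
    ultimately have g0_hom: "g\<^sub>0 \<in> module_homs R ?L (M\<lparr>carrier := M\<^sub>0\<rparr>)"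
      by (auto simp: module_homs_def hom_def)
    have row: "short_exact_row R ?N ?N M f g"
      unfolding short_exact_row_def
    proof (intro conjI f_hom g_hom)
      show "inj_on f (carrier ?N)"
        unfolding perm_mod_simps(1)[OF k]
        by (rule inj_onI, elim rangeE) (simp add: f_def ik inj_eq[OF k] inj_eq[OF F(3)])
      have "f ` range k = k ` range F" by (simp add: f_def image_image ik)
      also have "\<dots> = a_kernel ?N M g" using k by (auto simp: FG a_kernel_def' g_def ik)
      finally show "f ` carrier ?N = a_kernel ?N M g" using k by simp
      have "g ` range k = range G" by (simp add: g_def image_image ik)
      then show "g ` carrier ?N = carrier M" using k G(3) by simp
    qed
    have row0: "short_exact_row R ?L ?L (M\<lparr>carrier := M\<^sub>0\<rparr>) f\<^sub>0 g\<^sub>0"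
      unfolding short_exact_row_def
    proof (intro conjI f0_hom g0_hom)
      show "inj_on f\<^sub>0 (carrier ?L)"
        unfolding perm_mod_simps(1)[OF h]
        by (rule inj_onI, elim rangeE) (simp add: f\<^sub>0_def ih inj_eq[OF h] inj_eq[OF F0(3)])
      have "f\<^sub>0 ` range h = h ` range F\<^sub>0" by (simp add: f\<^sub>0_def image_image ih)
      also have "\<dots> = a_kernel ?L (M\<lparr>carrier := M\<^sub>0\<rparr>) g\<^sub>0" using h by (auto simp: FG0 a_kernel_def' g\<^sub>0_def ih)
      finally show "f\<^sub>0 ` carrier ?L = a_kernel ?L (M\<lparr>carrier := M\<^sub>0\<rparr>) g\<^sub>0" using h by simp
      have "g\<^sub>0 ` range h = range G\<^sub>0" by (simp add: g\<^sub>0_def image_image ih)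
      then show "g\<^sub>0 ` carrier ?L = carrier (M\<lparr>carrier := M\<^sub>0\<rparr>)" using h G0(3) by simp
    qed
    have i_inj: "inj_on i (carrier ?L)"
    proof -
      have "v = w" if "into True v = into True w" for v w :: "(nat \<times> nat) perm_lattice"
        using arg_cong[OF that, of "coord True"] by (simp add: coord_into)
      then have "inj (into True :: (nat \<times> nat) perm_lattice \<Rightarrow> _)" by (rule injI)
      then show ?thesis
        unfolding perm_mod_simps(1)[OF h]
        by (intro inj_onI, elim rangeE) (simp add: i_def ih inj_eq[OF k] inj_eq)
    qed
    have summand: "direct_summand R ?N (i ` carrier ?L)"
    proof -
      define I where "I b = range (into b :: (nat \<times> nat) perm_lattice \<Rightarrow> _)" for b :: bool
      have I: "add_subgroup (I b)" "\<And>v. v \<in> I b \<Longrightarrow> shift p v \<in> I b" for b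
      proof -
        show "add_subgroup (I b)"
          unfolding add_subgroup_def I_def
        proof (intro conjI ballI)
          show "0 \<in> range (into b :: (nat \<times> nat) perm_lattice \<Rightarrow> _)"
            using into_simps(2)[of b] by (rule range_eqI[OF sym])
        qed (auto simp flip: into_simps)
        show "shift p v \<in> I b" if "v \<in> I b" for v using that by (auto simp: I_def simp flip: into_shift)
      qed
      have "i ` carrier ?L = k ` I True" using h by (simp add: i_def I_def image_image ih)
      moreover have "submodule (k ` I b) R ?N" for b by (rule perm_mod_submodule[OF k I])
      moreover have "k ` I True <+>\<^bsub>?N\<^esub> k ` I False = carrier ?N"
      proof
        show "k ` I True <+>\<^bsub>?N\<^esub> k ` I False \<subseteq> carrier ?N" using k by (auto simp: set_add_def')
        show "carrier ?N \<subseteq> k ` I True <+>\<^bsub>?N\<^esub> k ` I False"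
        proof
          fix x assume "x \<in> carrier ?N"
          then obtain v where v: "x = k v" using k by auto
          have "x = k (into True (coord True v)) \<oplus>\<^bsub>?N\<^esub> k (into False (coord False v))"
            using k frag_bool_decomp[of v] by (simp add: v)
          then show "x \<in> k ` I True <+>\<^bsub>?N\<^esub> k ` I False" by (auto simp: set_add_def' I_def)
        qed
      qed
      moreover have "k ` I True \<inter> k ` I False = {\<zero>\<^bsub>?N\<^esub>}"
      proof -
        have "into False w = 0" if "into True v = into False w" for v w :: "(nat \<times> nat) perm_lattice"
          using arg_cong[OF that, of "coord False"] by (simp add: coord_into into_simps)
        then have "I True \<inter> I False = {0}"
          using add_subgroup_zero[OF I(1)] by (auto simp: I_def into_simps)
        then show ?thesis using k by (simp flip: image_Int[OF k])
      qed
      ultimately show ?thesis unfolding direct_summand_def by metis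
    qed
    have sum: "sum_of_free_and_trivial R \<alpha> ?N" "sum_of_free_and_trivial R \<alpha> ?L"
      using h k by (simp_all add: perm_mod_sum_of_free_and_trivial)
    have "\<forall>x\<in>carrier ?L. f (i x) = i (f\<^sub>0 x)" "\<forall>x\<in>carrier ?L. g (i x) = g\<^sub>0 x"
      by (simp_all add: f_def i_def f\<^sub>0_def g_def g\<^sub>0_def ih ik sq)
    then show ?thesis
      using mN mN0 row row0 i_hom i_inj sum summand by blast
  qed
qed

end

section \<open>The equivalence\<close>

theorem corollary1p18:
  fixes p :: nat
    and C :: "'g monoid" and \<alpha> :: 'g
    and R :: "('g \<Rightarrow> int) ring" and t :: "'g \<Rightarrow> int"
    and M :: "('g \<Rightarrow> int, 'a) module" and M\<^sub>0 :: "'a set"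
  assumes "Factorial_Ring.prime p"
    and "Group.group C" and "order C = p"
    and "\<alpha> \<in> carrier C" and "carrier C = generate C {\<alpha>}"
    and "R = int_group_ring C"
    and "t = group_ring_of \<alpha> \<ominus>\<^bsub>R\<^esub> \<one>\<^bsub>R\<^esub>"
    and "Module.module R M" and "submodule M\<^sub>0 R M"
    and "countable (carrier M)"
    and "infinite (UNIV :: 'b set)"
  shows
    "(\<exists>(N :: ('g \<Rightarrow> int, 'b) module) (P :: ('g \<Rightarrow> int, 'b) module)
       (N\<^sub>0 :: ('g \<Rightarrow> int, 'b) module) (P\<^sub>0 :: ('g \<Rightarrow> int, 'b) module)
       f g f\<^sub>0 g\<^sub>0 i j.
        Module.module R N \<and> Module.module R P \<and>
        Module.module R N\<^sub>0 \<and> Module.module R P\<^sub>0 \<and>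
        short_exact_row R N P M f g \<and>
        short_exact_row R N\<^sub>0 P\<^sub>0 (M\<lparr>carrier := M\<^sub>0\<rparr>) f\<^sub>0 g\<^sub>0 \<and>
        i \<in> module_homs R N\<^sub>0 N \<and> inj_on i (carrier N\<^sub>0) \<and>
        j \<in> module_homs R P\<^sub>0 P \<and> inj_on j (carrier P\<^sub>0) \<and>
        (\<forall>x\<in>carrier N\<^sub>0. f (i x) = j (f\<^sub>0 x)) \<and>
        (\<forall>x\<in>carrier P\<^sub>0. g (j x) = g\<^sub>0 x) \<and>
        sum_of_free_and_trivial R \<alpha> N \<and> sum_of_free_and_trivial R \<alpha> P \<and>
        sum_of_free_and_trivial R \<alpha> N\<^sub>0 \<and> sum_of_free_and_trivial R \<alpha> P\<^sub>0 \<and>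
        direct_summand R N (i ` carrier N\<^sub>0) \<and> direct_summand R P (j ` carrier P\<^sub>0))
     \<longleftrightarrow>
     ((\<lambda>x. t \<odot>\<^bsub>M\<^esub> x) ` carrier M) \<inter> M\<^sub>0 = (\<lambda>x. t \<odot>\<^bsub>M\<^esub> x) ` M\<^sub>0"
proof -
  interpret cyclic_group_ring p C \<alpha> R
    using assms(1-6) by (simp add: cyclic_group_ring_def)
  have t: "t = cyclic_group_ring.t \<alpha> R" using assms(7) by (simp add: t_def)
  show ?thesis
  proof (rule iffI, goal_cases)
    case 1
    then obtain N P N\<^sub>0 P\<^sub>0 :: "('g \<Rightarrow> int, 'b) module" and f g f\<^sub>0 g\<^sub>0 i j
      where mods: "Module.module R N" "Module.module R P" "Module.module R N\<^sub>0" "Module.module R P\<^sub>0"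
        and rows: "short_exact_row R N P M f g"
          "short_exact_row R N\<^sub>0 P\<^sub>0 (M\<lparr>carrier := M\<^sub>0\<rparr>) f\<^sub>0 g\<^sub>0"
        and cols: "i \<in> module_homs R N\<^sub>0 N" "inj_on i (carrier N\<^sub>0)" "j \<in> module_homs R P\<^sub>0 P"
        and comm: "\<forall>x\<in>carrier N\<^sub>0. f (i x) = j (f\<^sub>0 x)" "\<forall>x\<in>carrier P\<^sub>0. g (j x) = g\<^sub>0 x"
        and P0: "sum_of_free_and_trivial R \<alpha> P\<^sub>0"
        and summand: "direct_summand R N (i ` carrier N\<^sub>0)"
      by (elim exE conjE) (rule that; assumption)
    show ?case
      unfolding t
      by (rule resolution_imp_t_pure[OF assms(8,9) mods rows cols])
         (use comm summand sum_of_free_and_trivial_acyclic[OF mods(4) P0] in auto)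
  next
    case 2
    then show ?case unfolding t by (rule resolution_of_t_pure[OF assms(8-11)])
  qed
qed

end
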